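(* Consider the single-input single-output feedback control system $$z(t+1)=Az(t)+Bu(t),\qquad w(t)=Cz(t),\qquad u(t)=w(t)+\xi(t),$$ equivalently $z(t+1)=(A+BC)z(t)+B\xi(t)$, $w(t)=Cz(t)$, $u(t)=w(t)+\xi(t)$, where $z(t)\in\mathbb{R}^N$, $\xi(t)$ is i.i.d. zero-mean Gaussian noise, and $z(0)$ is Gaussian and independent of the noise. Then the average information transfer from the output $w$ to the input $u$ satisfies $$\bar T_{w\to u}=\int_{-1/2}^{1/2}\log|\mathcal{S}(e^{j2\pi\theta})|\,d\theta=\sum_{i=1}^m\log|\lambda_i(A_u)|,$$ where $\mathcal{S}$ is the sensitivity transfer function of the feedback loop and $\lambda_1(A_u),\ldots,\lambda_m(A_u)$ are the unstable eigenvalues of the open-loop system, i.e. the eigenvalues of $A$ of modulus greater than $1$ (with multiplicity).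
   Context: The $n$-step information transfer from $w$ to $u$ over times $0,\ldots,n$ is $$(T_{w\to u})_0^{n}=H(u(n)\mid u(n-1),\ldots,u(0))-H_{\not w}(u(n)\mid u(n-1),\ldots,u(0)),$$ where $H$ denotes (conditional) differential entropy and $H_{\not w}$ is the same quantity computed when $w$ is frozen (held at a constant deterministic value), so that $u$ is then $\xi$ up to a constant shift and $H_{\not w}(u(n),\ldots,u(0))=H(\xi(n),\ldots,\xi(0))$. The average information transfer is $$\bar T_{w\to u}=\lim_{T\to\infty}\frac1T\sum_{i=1}^T(T_{w\to u})_0^{i}.$$ The sensitivity transfer function $\mathcal{S}$ is the closed-loop transfer function from $\xi$ to $u$, so that $|\mathcal{S}(e^{j2\pi\theta})|=|u(e^{j2\pi\theta})|/|\xi(e^{j2\pi\theta})|$ (the ratio of the power spectra of $u$ and $\xi$ is $|\mathcal{S}|^2$).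
   Formalization: The closed loop is assumed stable (all eigenvalues of A+BC have modulus below 1), z(0) has a positive definite covariance, and the noise variance is positive; without stability or with degenerate z(0) the claim can fail. *)

theory Defs
  imports "HOL-Probability.Probability" "HOL-Computational_Algebra.Polynomial"
begin

section \<open>Eigenvalues and transfer functions\<close>

abbreviation complex_matrix :: "real^'m^'n \<Rightarrow> complex^'m^'n" where
  "complex_matrix \<equiv> map_matrix complex_of_real"

definition charpoly :: "real^'n^'n \<Rightarrow> complex poly" where
  "charpoly A = det (mat [:0, 1:] - map_matrix (\<lambda>a. [:complex_of_real a:]) A)"

definition eigenvalues :: "real^'n^'n \<Rightarrow> complex multiset" where
  "eigenvalues A = proots (charpoly A)"

definition unstable_eigenvalues :: "real^'n^'n \<Rightarrow> complex multiset" where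
  "unstable_eigenvalues A = filter_mset (\<lambda>z. 1 < cmod z) (eigenvalues A)"

definition schur_stable :: "real^'n^'n \<Rightarrow> bool" where
  "schur_stable A \<longleftrightarrow> (\<forall>z \<in># eigenvalues A. cmod z < 1)"

text \<open>Transfer function \<open>D + C (s I - A)\<^sup>-\<^sup>1 B\<close> of the single-input single-output system
  \<open>z(t+1) = A z(t) + B v(t)\<close>, \<open>y(t) = C z(t) + D v(t)\<close>. The vectors \<open>B\<close> and \<open>C\<close> stand for the
  input column and the output row.\<close>

definition transfer_function ::
    "real^'n^'n \<Rightarrow> real^'n \<Rightarrow> real^'n \<Rightarrow> real \<Rightarrow> complex \<Rightarrow> complex" where
  "transfer_function A B C D s = of_real D +
     (\<Sum>i\<in>UNIV. of_real (C $ i) *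
        (matrix_inv (mat s - complex_matrix A) *v (\<chi> j. of_real (B $ j))) $ i)"

definition closed_loop_matrix :: "real^'n^'n \<Rightarrow> real^'n \<Rightarrow> real^'n \<Rightarrow> real^'n^'n" where
  "closed_loop_matrix A B C = A + (columnvector B :: real^1^'n) ** (rowvector C :: real^'n^1)"

text \<open>In closed loop, \<open>z(t+1) = (A + B C) z(t) + B \<xi>(t)\<close> and \<open>u(t) = C z(t) + \<xi>(t)\<close>, so the
  map from \<open>\<xi>\<close> to \<open>u\<close> has unit feedthrough.\<close>

definition sensitivity :: "real^'n^'n \<Rightarrow> real^'n \<Rightarrow> real^'n \<Rightarrow> complex \<Rightarrow> complex" where
  "sensitivity A B C = transfer_function (closed_loop_matrix A B C) B C 1"


section \<open>Gaussian vectors and independence\<close>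

definition positive_definite :: "real^'n^'n \<Rightarrow> bool" where
  "positive_definite S \<longleftrightarrow> transpose S = S \<and> (\<forall>x. x \<noteq> 0 \<longrightarrow> 0 < x \<bullet> (S *v x))"

definition mv_normal_density :: "real^'n \<Rightarrow> real^'n^'n \<Rightarrow> real^'n \<Rightarrow> real" where
  "mv_normal_density \<mu> S x =
     exp (- ((x - \<mu>) \<bullet> (matrix_inv S *v (x - \<mu>))) / 2) / sqrt ((2 * pi) ^ CARD('n) * det S)"

definition gaussian_vector :: "'a measure \<Rightarrow> ('a \<Rightarrow> real^'n) \<Rightarrow> bool" where
  "gaussian_vector M X \<longleftrightarrow>
     (\<exists>\<mu> S. positive_definite S \<and> distributed M lborel X (mv_normal_density \<mu> S))"

text \<open>The constant \<open>indep_var\<close> forces both random variables to have the same range type. The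
  following is the characterization \<open>indep_var_eq\<close>, without that restriction.\<close>

definition independent_rv ::
    "'a measure \<Rightarrow> 'b measure \<Rightarrow> ('a \<Rightarrow> 'b) \<Rightarrow> 'c measure \<Rightarrow> ('a \<Rightarrow> 'c) \<Rightarrow> bool" where
  "independent_rv M S X T Y \<longleftrightarrow> X \<in> measurable M S \<and> Y \<in> measurable M T \<and>
     prob_space.indep_set M
       (sigma_sets (space M) {X -` E \<inter> space M | E. E \<in> sets S})
       (sigma_sets (space M) {Y -` E \<inter> space M | E. E \<in> sets T})"


section \<open>Information transfer\<close>

text \<open>The differential entropy \<open>H(u(n) | u(n-1), \<dots>, u(0))\<close>, to the base \<open>b\<close>: conditional entropy
  relative to Lebesgue measure.\<close>

definition entropy_given_past :: "'a measure \<Rightarrow> real \<Rightarrow> (nat \<Rightarrow> 'a \<Rightarrow> real) \<Rightarrow> nat \<Rightarrow> real" where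
  "entropy_given_past M b u n =
     prob_space.conditional_entropy M b lborel (Pi\<^sub>M {..<n} (\<lambda>_. lborel))
       (u n) (\<lambda>\<omega>. \<lambda>t\<in>{..<n}. u t \<omega>)"

text \<open>Information transfer from \<open>w\<close> to \<open>u = w + \<xi>\<close> over the times \<open>0, \<dots>, n\<close>. Freezing \<open>w\<close> at
  the constant value \<open>c\<close> turns the input \<open>u\<close> into \<open>c + \<xi>\<close>.\<close>

definition information_transfer ::
    "'a measure \<Rightarrow> real \<Rightarrow> real \<Rightarrow> (nat \<Rightarrow> 'a \<Rightarrow> real) \<Rightarrow> (nat \<Rightarrow> 'a \<Rightarrow> real) \<Rightarrow> nat \<Rightarrow> real" where
  "information_transfer M b c u \<xi> n =
     entropy_given_past M b u n -
     entropy_given_past M b (\<lambda>t \<omega>. c + \<xi> t \<omega>) n"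

definition mean_information_transfer ::
    "'a measure \<Rightarrow> real \<Rightarrow> real \<Rightarrow> (nat \<Rightarrow> 'a \<Rightarrow> real) \<Rightarrow> (nat \<Rightarrow> 'a \<Rightarrow> real) \<Rightarrow> nat \<Rightarrow> real" where
  "mean_information_transfer M b c u \<xi> T =
     1 / real T * (\<Sum>i=1..T. information_transfer M b c u \<xi> i)"

definition average_information_transfer ::
    "'a measure \<Rightarrow> real \<Rightarrow> real \<Rightarrow> (nat \<Rightarrow> 'a \<Rightarrow> real) \<Rightarrow> (nat \<Rightarrow> 'a \<Rightarrow> real) \<Rightarrow> real" where
  "average_information_transfer M b c u \<xi> = lim (mean_information_transfer M b c u \<xi>)"

end

theory Submission
  imports Defs "HOL-Computational_Algebra.Fundamental_Theorem_Algebra"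
    "HOL-Complex_Analysis.Cauchy_Integral_Formula"
begin

text \<open>Subtracting from \<open>u(n)\<close> its prediction from the past, a Kalman filter for \<open>z(0)\<close>, leaves an
  innovation that is Gaussian with variance \<open>\<sigma>\<^sup>2 det J(n+1) / det J(n)\<close>, where
  \<open>J(n) = J(0) + \<sigma>\<^sup>-\<^sup>2 \<Sum>t<n. (C A\<^sup>t)\<^sup>T (C A\<^sup>t)\<close> is the information matrix of \<open>z(0)\<close>. The sum of
  the transfers therefore telescopes to \<open>(ln det J(T+1) - ln det J(1)) / 2\<close>.

  The growth of \<open>det J(n)\<close> is found by comparing \<open>J(n)\<close>, up to factors polynomial in \<open>n\<close>, with
  \<open>G\<^sup>* G\<close> for \<open>G = 1 + w A\<^sup>n\<close>, where the unit complex number \<open>w\<close> keeps every factor of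
  \<open>det G = \<Prod>(1 + w \<lambda>\<^sup>n)\<close> of the order \<open>max 1 \<bar>\<lambda>\<bar>\<^sup>n\<close>. The powers \<open>A\<^sup>t x\<close> are averages of resolvents of
  \<open>A\<close> at the roots of \<open>1 + w \<zeta>\<^sup>n = 0\<close> applied to \<open>G x\<close>, which bounds \<open>J(n)\<close> from above. Since
  the closed loop is stable, \<open>A\<^sup>n x\<close> is controlled by \<open>x\<close> and the outputs \<open>C A\<^sup>t x\<close>, which bounds
  \<open>J(n)\<close> from below.

  The sensitivity function is the quotient of the open loop and closed loop characteristic
  polynomials, so its log integral is a sum of Jensen integrals of linear factors.\<close>

section \<open>Characteristic polynomials and determinants\<close>

text \<open>Powers of \<open>A\<close> alone cannot be compared with \<open>J(n)\<close>:
  eigenvalues inside the unit disc can make \<open>det (A^n)\<close> far smaller than the product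
  over the unstable ones. Adding 1 lifts each factor to the order
  \<open>max 1 |\<lambda>|^n\<close>, unless \<open>1 + \<lambda>^n\<close> is nearly zero; a
  pigeonhole choice of \<open>w\<close> among N + 1 roots of unity prevents this, with a constant
  depending only on the dimension N. Comparisons are made between forms \<open>x^* P x\<close> and
  then passed to determinants, so defective eigenvalues need no separate treatment, and every loss
  is a power of n, invisible in the logarithm divided by n. The same estimate applied to the closed
  loop matrix bounds its powers polynomially. An eigenvector of \<open>A\<close> annihilated by
  \<open>C\<close> is also an eigenvector of the closed loop, so stability forces its eigenvalue
  into the disc: this is why all unstable growth of \<open>A\<close> shows in the outputs and hence
  in \<open>J(n)\<close>. Both entropies come from one Gaussian computation: a channel observing
  rows \<open>h\<close> of \<open>z(0)\<close> through noise, shifted by a known function of its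
  past. Freezing \<open>w\<close> is the case \<open>h = 0\<close>.\<close>

definition complex_charpoly :: "complex^'n^'n \<Rightarrow> complex poly" where
  "complex_charpoly M = det (mat [:0, 1:] - map_matrix (\<lambda>a. [:a:]) M)"

lemma charpoly_eq_complex_charpoly: "charpoly A = complex_charpoly (complex_matrix A)"
  by (simp add: charpoly_def complex_charpoly_def map_matrix_def)

lemma poly_det: "poly (det P) s = det (map_matrix (\<lambda>p. poly p s) P)"
  for P :: "complex poly^'n^'n"
  by (simp add: det_def poly_sum poly_prod)

lemma poly_complex_charpoly: "poly (complex_charpoly M) s = det (mat s - M)"
  unfolding complex_charpoly_def poly_det by (intro arg_cong[of _ _ det]) (auto simp: vec_eq_iff mat_def)

lemma
  fixes f :: "'i \<Rightarrow> 'a::comm_ring_1 poly"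
  assumes "finite I" "\<And>i. i \<in> I \<Longrightarrow> degree (f i) \<le> 1"
  shows degree_prod_le_card: "degree (\<Prod>i\<in>I. f i) \<le> card I"
    and coeff_prod_card: "coeff (\<Prod>i\<in>I. f i) (card I) = (\<Prod>i\<in>I. coeff (f i) 1)"
proof -
  have "degree (\<Prod>i\<in>I. f i) \<le> card I \<and> coeff (\<Prod>i\<in>I. f i) (card I) = (\<Prod>i\<in>I. coeff (f i) 1)"
    using assms
  proof (induction I rule: finite_induct)
    case (insert i I)
    let ?g = "\<Prod>i\<in>I. f i"
    have IH: "degree ?g \<le> card I" "coeff ?g (card I) = (\<Prod>i\<in>I. coeff (f i) 1)"
      using insert by auto
    have fi: "degree (f i) \<le> 1" using insert by auto
    have "f i = [:coeff (f i) 0, coeff (f i) 1:]"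
      by (intro poly_eqI) (use fi in \<open>auto simp: coeff_pCons split: nat.splits intro: coeff_eq_0\<close>)
    then obtain a c where f: "f i = [:a, c:]" by blast
    have "degree (f i * ?g) \<le> Suc (card I)"
      using degree_mult_le[of "f i" ?g] fi IH by linarith
    moreover have "coeff (f i * ?g) (Suc (card I)) = c * coeff ?g (card I)"
      using IH by (simp add: f coeff_eq_0)
    ultimately show ?case
      using insert IH by (simp add: f)
  qed auto
  then show "degree (\<Prod>i\<in>I. f i) \<le> card I"
    "coeff (\<Prod>i\<in>I. f i) (card I) = (\<Prod>i\<in>I. coeff (f i) 1)" by auto
qed

text \<open>The coefficient of degree N of a Leibniz term is the product of the slopes of its
  entries. The slopes of \<open>s - M\<close> form the identity matrix, so these coefficients add up
  to \<open>det (mat 1) = 1\<close>.\<close>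

lemma degree_complex_charpoly: "degree (complex_charpoly (M :: complex^'n^'n)) = CARD('n)"
  and lead_coeff_complex_charpoly: "lead_coeff (complex_charpoly M) = 1"
proof -
  let ?P = "mat [:0, 1:] - map_matrix (\<lambda>a. [:a:]) M"
  have deg1: "degree (?P $ i $ j) \<le> 1" for i j
    by (auto simp: mat_def degree_diff_le)
  have c1: "coeff (?P $ i $ j) 1 = (mat 1 :: complex^'n^'n) $ i $ j" for i j
    by (auto simp: mat_def)
  have le: "degree (complex_charpoly M) \<le> CARD('n)"
    unfolding complex_charpoly_def det_def
  proof (intro degree_sum_le)
    fix p :: "'n \<Rightarrow> 'n" assume "p \<in> {p. p permutes UNIV}"
    have "degree (of_int (sign p) * (\<Prod>i\<in>UNIV. ?P $ i $ p i))
        \<le> degree (of_int (sign p) :: complex poly) + degree (\<Prod>i\<in>UNIV. ?P $ i $ p i)"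
      by (rule degree_mult_le)
    also have "\<dots> \<le> CARD('n)"
      using degree_prod_le_card[of UNIV "\<lambda>i. ?P $ i $ p i"] deg1 by simp
    finally show "degree (of_int (sign p) * (\<Prod>i\<in>UNIV. ?P $ i $ p i)) \<le> CARD('n)" .
  qed auto
  have sg: "of_int (sign p) = ([:of_int (sign p):] :: complex poly)" for p :: "'n \<Rightarrow> 'n"
    by (metis of_int_poly)
  have "coeff (complex_charpoly M) CARD('n) = det (mat 1 :: complex^'n^'n)"
    unfolding complex_charpoly_def det_def coeff_sum
  proof (intro sum.cong refl)
    fix p :: "'n \<Rightarrow> 'n"
    have "coeff (\<Prod>i\<in>UNIV. ?P $ i $ p i) CARD('n) = (\<Prod>i\<in>UNIV. mat 1 $ i $ p i)"
      using coeff_prod_card[of UNIV "\<lambda>i. ?P $ i $ p i"] deg1 by (simp only: c1) simp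
    then show "coeff (of_int (sign p) * (\<Prod>i\<in>UNIV. ?P $ i $ p i)) CARD('n) =
        of_int (sign p) * (\<Prod>i\<in>UNIV. mat 1 $ i $ p i)"
      by (simp only: sg) simp
  qed
  then have "coeff (complex_charpoly M) CARD('n) = 1" by simp
  with le show "degree (complex_charpoly M) = CARD('n)" "lead_coeff (complex_charpoly M) = 1"
    by (metis le_antisym le_degree one_neq_zero)+
qed

lemma complex_charpoly_nonzero: "complex_charpoly M \<noteq> 0"
  using lead_coeff_complex_charpoly[of M] by force

lemma poly_prod_proots:
  fixes p :: "complex poly"
  shows "poly p s = lead_coeff p * (\<Prod>l\<in>#proots p. s - l)"
  by (subst (1) complex_poly_decompose_multiset[symmetric])
    (simp add: poly_prod_mset image_mset.compositionality o_def)

lemma poly_complex_charpoly_prod: "poly (complex_charpoly M) s = (\<Prod>l\<in>#proots (complex_charpoly M). s - l)"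
  by (subst poly_prod_proots) (simp only: lead_coeff_complex_charpoly mult_1_left)

lemma size_proots_complex_charpoly: "size (proots (complex_charpoly (M :: complex^'n^'n))) = CARD('n)"
  by (simp add: size_proots_complex degree_complex_charpoly)

lemma exists_eigenvector:
  fixes M :: "complex^'n^'n"
  assumes "poly (complex_charpoly M) l = 0"
  obtains x where "x \<noteq> 0" "M *v x = l *s x"
proof -
  have "det (mat l - M) = 0" using assms by (simp add: poly_complex_charpoly)
  then have "\<not> inj ((*v) (mat l - M))"
    using inj_matrix_vector_mult invertible_det_nz 
    by (metis det_nz_iff_inj_gen matrix_of_matrix_vector_mul matrix_vector_mul_linear_gen)
  then obtain x y where "x \<noteq> y" "(mat l - M) *v x = (mat l - M) *v y"
    by (auto simp: inj_def)
  then have "x - y \<noteq> 0" "(mat l - M) *v (x - y) = 0"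
    by (auto simp: matrix_vector_mult_diff_distrib)
  moreover have "mat l *v z = l *s z" for z :: "complex^'n"
    by (simp add: vec_eq_iff matrix_vector_mult_def mat_def mult_delta_left)
  ultimately show thesis
    by (intro that[of "x - y"]) (auto simp: matrix_vector_mult_diff_rdistrib)
qed

text \<open>Evaluate the characteristic polynomial at 0; the factors \<open>(-1)^N\<close> on the
  two sides cancel.\<close>

lemma det_eq_prod_proots: "det M = (\<Prod>l\<in>#proots (complex_charpoly M). l)"
  for M :: "complex^'n^'n"
proof -
  have "det (- M) = (-1) ^ CARD('n) * det M"
    using det_rows_mul[of "\<lambda>_. -1" "\<lambda>i. M $ i"] 
    by (simp add: uminus_vec_def vector_scalar_mult_def vec_lambda_beta)
  moreover have "det (- M) = (\<Prod>l\<in>#proots (complex_charpoly M). - l)"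
    using poly_complex_charpoly_prod[of M 0] by (simp add: poly_complex_charpoly mat_0)
  moreover have "(\<Prod>l\<in>#proots (complex_charpoly M). - l) = (-1) ^ CARD('n) * (\<Prod>l\<in>#proots (complex_charpoly M). l)"
  proof -
    have "(\<Prod>l\<in>#E. - l) = (-1) ^ size E * (\<Prod>l\<in>#E. l)" for E :: "complex multiset"
      by (induction E) auto
    then show ?thesis by (simp add: size_proots_complex_charpoly)
  qed
  ultimately show ?thesis by simp
qed

section \<open>Rank-one updates and the sensitivity function\<close>

lemma invertible_matrix_inv:
  assumes "invertible M"
  shows "M ** matrix_inv M = mat 1" and "matrix_inv M ** M = mat 1"
  using someI_ex[OF assms[unfolded invertible_def]] by (simp_all add: matrix_inv_def)

text \<open>The matrix determinant lemma. Factoring out \<open>M\<close> leaves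
  \<open>1 + v c^T\<close>, which a conjugation turns into the identity with a single column
  changed. The field is arbitrary: complex for the transfer function, real for the information
  matrices.\<close>

lemma det_rank_one_update:
  fixes M :: "'a::field^'n^'n"
  assumes "det M \<noteq> 0"
  shows "det (M + (\<chi> i j. b $ i * c $ j)) =
    det M * (1 + (\<Sum>i\<in>UNIV. c $ i * (matrix_inv M *v b) $ i))"
proof -
  have one: "det (mat 1 + (\<chi> i j. v $ i * c $ j)) = 1 + (\<Sum>i\<in>UNIV. c $ i * v $ i)"
    for v :: "'a^'n"
  proof (cases "c = 0")
    case True
    then have "(\<chi> i j. v $ i * c $ j) = 0" by (simp add: vec_eq_iff)
    with True show ?thesis by simp
  next
    case False
    then obtain k where k: "c $ k \<noteq> 0" by (auto simp: vec_eq_iff)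
    \<comment> \<open>Row \<open>k\<close> of \<open>P\<close> is \<open>c\<close> and the others
      are unit rows, so \<open>c^T P^-1\<close> is the unit row \<open>k\<close> and
      \<open>P (1 + v c^T) P^-1\<close> is \<open>Q\<close> below.\<close>
    define P :: "'a^'n^'n" where "P = (\<chi> i. if i = k then c else axis i 1)"
    have "P = (\<chi> i. if i = k then \<Sum>i\<in>UNIV. c $ i *s row i (mat 1) else row i (mat 1))"
      by (auto simp: P_def vec_eq_iff row_def mat_def axis_def if_distrib cong: if_cong)
    then have P: "det P = c $ k"
      using cramer_lemma_transpose[of k c "mat 1"] by simp
    have Pv: "(P *v v) $ k = (\<Sum>i\<in>UNIV. c $ i * v $ i)"
      by (simp add: P_def matrix_vector_mult_def)
    define Q :: "'a^'n^'n" where "Q = (\<chi> i j. if j = k then (mat 1 *v (axis k 1 + P *v v)) $ i else mat 1 $ i $ j)"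
    have Q: "det Q = 1 + (\<Sum>i\<in>UNIV. c $ i * v $ i)"
      unfolding Q_def cramer_lemma by (simp add: Pv axis_def)
    have "P ** (mat 1 + (\<chi> i j. v $ i * c $ j)) = Q ** P"
    proof -
      have "(P ** (\<chi> i j. v $ i * c $ j)) $ i $ j = (P *v v) $ i * c $ j" for i j
        by (simp add: matrix_matrix_mult_def matrix_vector_mult_def sum_distrib_right mult.assoc)
      moreover have "(Q ** P) $ i $ j = P $ i $ j + (P *v v) $ i * c $ j" for i j
      proof -
        have "Q $ i $ l * P $ l $ j = mat 1 $ i $ l * P $ l $ j + (if l = k then (P *v v) $ i * P $ l $ j else 0)" for l
          proof -
          have "axis k 1 $ i = (mat 1 :: 'a^'n^'n) $ i $ k" by (auto simp: axis_def mat_def)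
          then show ?thesis by (simp add: Q_def algebra_simps)
        qed
        then have "(Q ** P) $ i $ j = (mat 1 ** P) $ i $ j + (\<Sum>l\<in>UNIV. if l = k then (P *v v) $ i * P $ l $ j else 0)"
          unfolding matrix_matrix_mult_def by (simp add: sum.distrib)
        then show ?thesis by (simp add: P_def)
      qed
      ultimately show ?thesis
        by (simp add: matrix_add_ldistrib vec_eq_iff)
    qed
    then have "det P * det (mat 1 + (\<chi> i j. v $ i * c $ j)) = det Q * det P"
      by (simp only: flip: det_mul)
    with k show ?thesis by (simp add: P Q)
  qed
  have inv: "M ** matrix_inv M = mat 1"
    using assms by (simp add: invertible_det_nz invertible_matrix_inv)
  have "M ** (mat 1 + (\<chi> i j. (matrix_inv M *v b) $ i * c $ j)) = M + (\<chi> i j. b $ i * c $ j)"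
  proof -
    have "(M ** (\<chi> i j. (matrix_inv M *v b) $ i * c $ j)) $ i $ j = (M *v (matrix_inv M *v b)) $ i * c $ j" for i j
      by (simp add: matrix_matrix_mult_def matrix_vector_mult_def sum_distrib_right mult.assoc)
    then have "M ** (\<chi> i j. (matrix_inv M *v b) $ i * c $ j) = (\<chi> i j. b $ i * c $ j)"
      by (simp add: vec_eq_iff matrix_vector_mul_assoc inv)
    then show ?thesis by (simp add: matrix_add_ldistrib)
  qed
  then show ?thesis
    using one[of "matrix_inv M *v b"] det_mul[of M "mat 1 + (\<chi> i j. (matrix_inv M *v b) $ i * c $ j)"]
    by simp
qed

text \<open>With \<open>L\<close> the closed loop matrix, \<open>s - A\<close> is
  \<open>s - L\<close> plus \<open>B C\<close>, and the factor \<open>1 + C (s - L)^-1 B\<close>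
  that the determinant lemma produces is the sensitivity itself.\<close>

lemma sensitivity_eq:
  assumes "poly (charpoly (closed_loop_matrix A B C)) s \<noteq> 0"
  shows "sensitivity A B C s = poly (charpoly A) s / poly (charpoly (closed_loop_matrix A B C)) s"
proof -
  let ?L = "closed_loop_matrix A B C"
  let ?b = "\<chi> j. complex_of_real (B $ j)" and ?c = "\<chi> j. complex_of_real (C $ j)"
  have "complex_matrix ?L = complex_matrix A + (\<chi> i j. ?b $ i * ?c $ j)"
    by (simp add: vec_eq_iff closed_loop_matrix_def matrix_matrix_mult_def columnvector_def rowvector_def)
  then have "mat s - complex_matrix A = (mat s - complex_matrix ?L) + (\<chi> i j. ?b $ i * ?c $ j)"
    by simp
  moreover have nz: "det (mat s - complex_matrix ?L) \<noteq> 0"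
    using assms by (simp add: charpoly_eq_complex_charpoly poly_complex_charpoly)
  ultimately have "det (mat s - complex_matrix A) = det (mat s - complex_matrix ?L) *
      (1 + (\<Sum>i\<in>UNIV. ?c $ i * (matrix_inv (mat s - complex_matrix ?L) *v ?b) $ i))"
    using det_rank_one_update[OF nz, of ?b ?c] by (simp only:)
  with nz show ?thesis
    by (simp add: charpoly_eq_complex_charpoly poly_complex_charpoly sensitivity_def transfer_function_def)
qed

section \<open>Comparison of determinants through quadratic forms\<close>

definition hermitian_form :: "complex^'n^'n \<Rightarrow> complex^'n \<Rightarrow> complex" where
  "hermitian_form P x = (\<Sum>i\<in>UNIV. cnj (x $ i) * (P *v x) $ i)"

text \<open>A vector with \<open>P x = l Q x\<close> makes the two forms differ by the factor
  \<open>l\<close>, so every eigenvalue of \<open>Q^-1 P\<close> has modulus at most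
  \<open>K\<close>; its determinant is the product of N such eigenvalues.\<close>

lemma det_le_of_form_le:
  fixes P Q :: "complex^'n^'n"
  assumes le: "\<And>x. cmod (hermitian_form P x) \<le> K * cmod (hermitian_form Q x)"
    and nz: "\<And>x. x \<noteq> 0 \<Longrightarrow> hermitian_form Q x \<noteq> 0"
  shows "cmod (det P) \<le> K ^ CARD('n) * cmod (det Q)"
proof -
  have "inj ((*v) Q)"
  proof (rule injI)
    fix x y assume "Q *v x = Q *v y"
    then have "hermitian_form Q (x - y) = 0"
      by (simp add: hermitian_form_def matrix_vector_mult_diff_distrib)
    with nz[of "x - y"] show "x = y" by auto
  qed
  then have Q: "invertible Q"
    by (metis invertible_det_nz det_nz_iff_inj_gen matrix_of_matrix_vector_mul matrix_vector_mul_linear_gen)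
  define R where "R = matrix_inv Q ** P"
  have QR: "Q ** R = P"
    using invertible_matrix_inv(1)[OF Q] by (simp add: R_def matrix_mul_assoc)
  have ev: "cmod l \<le> K" if "l \<in># proots (complex_charpoly R)" for l
  proof -
    from that have "poly (complex_charpoly R) l = 0" using complex_charpoly_nonzero[of R] by auto
    then obtain x where x: "x \<noteq> 0" "R *v x = l *s x" by (rule exists_eigenvector)
    have "P *v x = Q *v (R *v x)" by (simp add: QR matrix_vector_mul_assoc)
    also have "\<dots> = l *s (Q *v x)" by (simp only: x vector_scalar_commute)
    finally have "hermitian_form P x = l * hermitian_form Q x"
      by (simp add: hermitian_form_def sum_distrib_left mult_ac)
    then have "cmod l * cmod (hermitian_form Q x) \<le> K * cmod (hermitian_form Q x)"
      using le[of x] by (simp add: norm_mult)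
    with nz[OF x(1)] show ?thesis by simp
  qed
  have K: "cmod (\<Prod>l\<in>#E. l) \<le> K ^ size E" if "\<And>l. l \<in># E \<Longrightarrow> cmod l \<le> K" for E
    using that
  proof (induction E)
    case (add l E)
    then have "0 \<le> K" by (metis norm_ge_zero order_trans union_single_eq_member)
    with add show ?case by (auto simp: norm_mult intro!: mult_mono)
  qed auto
  have "cmod (det R) \<le> K ^ CARD('n)"
    unfolding det_eq_prod_proots using K[of "proots (complex_charpoly R)", OF ev] by (simp add: size_proots_complex_charpoly)
  then have "cmod (det Q) * cmod (det R) \<le> cmod (det Q) * K ^ CARD('n)"
    by (intro mult_left_mono) auto
  moreover have "det P = det Q * det R" by (simp flip: det_mul add: QR)
  ultimately show ?thesis by (simp add: norm_mult mult.commute)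
qed

section \<open>Polynomials in a matrix and their determinants\<close>

definition matrix_power :: "complex^'n^'n \<Rightarrow> nat \<Rightarrow> complex^'n^'n" where
  "matrix_power A k = (((**) A) ^^ k) (mat 1)"

lemma matrix_power_0 [simp]: "matrix_power A 0 = mat 1"
  and matrix_power_Suc: "matrix_power A (Suc k) = A ** matrix_power A k"
  by (simp_all add: matrix_power_def)

definition poly_matrix :: "complex poly \<Rightarrow> complex^'n^'n \<Rightarrow> complex^'n^'n" where
  "poly_matrix p A = (\<Sum>k\<le>degree p. mat (coeff p k) ** matrix_power A k)"

lemma mat_mult_component: "(mat c ** M) $ i $ j = c * (M $ i $ j)"
  for M :: "'a::comm_semiring_1^'n^'n"
  by (simp add: matrix_matrix_mult_def mat_def mult_delta_left)

lemma mat_mult_commute: "mat c ** M = M ** mat c"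
  for M :: "'a::comm_ring_1^'n^'n"
  by (simp add: vec_eq_iff matrix_matrix_mult_def mat_def mult_delta_left mult_delta_right mult.commute)

lemma poly_matrix_eq:
  assumes "degree p \<le> d"
  shows "poly_matrix p A = (\<Sum>k\<le>d. mat (coeff p k) ** matrix_power A k)"
  unfolding poly_matrix_def using assms
  by (intro sum.mono_neutral_left) (auto simp: coeff_eq_0 mat_0)

lemma matrix_mult_sum_right: "A ** (\<Sum>k\<in>I. f k) = (\<Sum>k\<in>I. A ** f k)"
  for A :: "'a::comm_ring_1^'n^'n"
  by (induction I rule: infinite_finite_induct) (simp_all add: matrix_add_ldistrib)

lemma poly_matrix_add: "poly_matrix (p + q) A = poly_matrix p A + poly_matrix q A" for A :: "complex^'n^'n"
proof -
  let ?d = "max (degree p) (degree q)"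
  have "mat (a + b) ** M = mat a ** M + mat b ** M" for a b and M :: "complex^'n^'n"
    by (simp add: vec_eq_iff mat_mult_component algebra_simps)
  then show ?thesis
    by (simp add: poly_matrix_eq[of p ?d] poly_matrix_eq[of q ?d] poly_matrix_eq[of "p + q" ?d] degree_add_le_max sum.distrib)
qed

lemma poly_matrix_smult: "poly_matrix (smult c p) A = mat c ** poly_matrix p A" for A :: "complex^'n^'n"
proof -
  have "mat (c * a) ** M = mat c ** (mat a ** M)" for a and M :: "complex^'n^'n"
    by (simp add: vec_eq_iff mat_mult_component)
  then show ?thesis
    by (simp add: poly_matrix_eq[of "smult c p" "degree p"] degree_smult_le matrix_mult_sum_right poly_matrix_def)
qed

lemma poly_matrix_pCons: "poly_matrix (pCons a p) A = mat a + A ** poly_matrix p A" for A :: "complex^'n^'n"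
proof -
  have "mat c ** (A ** M) = A ** (mat c ** M)" for c and M :: "complex^'n^'n"
    by (metis mat_mult_commute matrix_mul_assoc)
  then show ?thesis
    by (simp add: poly_matrix_eq[of "pCons a p" "Suc (degree p)"] degree_pCons_le sum.atMost_Suc_shift
      matrix_power_Suc matrix_mult_sum_right poly_matrix_def del: sum.atMost_Suc)
qed

lemma poly_matrix_linear_mult: "poly_matrix ([:- z, 1:] * p) A = (A - mat z) ** poly_matrix p A" for A :: "complex^'n^'n"
proof -
  have "poly_matrix ([:- z, 1:] * p) A = poly_matrix (smult (- z) p) A + poly_matrix (pCons 0 p) A"
    by (simp flip: poly_matrix_add)
  moreover have "(A - mat z) ** M = A ** M - mat z ** M" for M :: "complex^'n^'n"
    by (simp add: vec_eq_iff matrix_matrix_mult_def algebra_simps sum_subtractf)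
  moreover have "poly_matrix (smult (- z) p) A = - (mat z ** poly_matrix p A)"
    unfolding poly_matrix_smult by (simp add: vec_eq_iff mat_mult_component)
  ultimately show ?thesis
    by (simp add: poly_matrix_pCons mat_0)
qed

lemma poly_matrix_1: "poly_matrix 1 A = mat 1"
  by (simp add: poly_matrix_def)

lemma poly_matrix_monom: "poly_matrix (monom c n) A = mat c ** matrix_power A n"
proof (induction n)
  case 0
  then show ?case using poly_matrix_pCons[of c 0 A] by (simp add: monom_0 poly_matrix_def mat_0)
next
  case (Suc n)
  then show ?case
    by (simp add: monom_Suc poly_matrix_pCons mat_0 matrix_power_Suc) (metis mat_mult_commute matrix_mul_assoc)
qed

lemma det_mat_mult: "det (mat c ** M) = c ^ CARD('n) * det M"
  for M :: "'a::comm_ring_1^'n^'n"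
proof -
  have "mat c ** M = (\<chi> i. c *s M $ i)"
    by (simp add: vec_eq_iff mat_mult_component)
  then show ?thesis using det_rows_mul[of "\<lambda>_. c" "\<lambda>i. M $ i"] by simp
qed

lemma det_diff_mat: "det (A - mat z) = (\<Prod>l\<in>#proots (complex_charpoly A). l - z)"
  for A :: "complex^'n^'n"
proof -
  have "A - mat z = mat (-1) ** (mat z - A)"
    by (simp add: vec_eq_iff mat_mult_component)
  then have "det (A - mat z) = (-1) ^ CARD('n) * (\<Prod>l\<in>#proots (complex_charpoly A). z - l)"
    by (simp add: det_mat_mult flip: poly_complex_charpoly poly_complex_charpoly_prod)
  moreover have "(-1) ^ size E * (\<Prod>l\<in>#E. z - l) = (\<Prod>l\<in>#E. l - z)" for E :: "complex multiset"
    by (induction E) (auto simp: algebra_simps)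
  ultimately show ?thesis by (metis size_proots_complex_charpoly)
qed

text \<open>Spectral mapping at the level of determinants. Splitting \<open>p\<close> into linear
  factors reduces it to \<open>det (A - z)\<close>, which is a value of the characteristic
  polynomial up to sign.\<close>

lemma det_poly_matrix: "det (poly_matrix p A) = (\<Prod>l\<in>#proots (complex_charpoly A). poly p l)"
  for A :: "complex^'n^'n"
proof -
  have prod: "det (poly_matrix (\<Prod>z\<in>#Z. [:- z, 1:]) A) = (\<Prod>l\<in>#proots (complex_charpoly A). \<Prod>z\<in>#Z. l - z)" for Z
  proof (induction Z)
    case empty
    then show ?case by (simp add: poly_matrix_1)
  next
    case (add z Z)
    then show ?case
      by (simp only: poly_matrix_linear_mult image_mset_add_mset prod_mset.add_mset det_mul det_diff_mat
        prod_mset.distrib)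
  qed
  have "det (poly_matrix p A) = lead_coeff p ^ CARD('n) * (\<Prod>l\<in>#proots (complex_charpoly A). \<Prod>z\<in>#proots p. l - z)"
    by (subst (1) complex_poly_decompose_multiset[symmetric])
      (simp only: poly_matrix_smult det_mat_mult prod)
  also have "\<dots> = (\<Prod>l\<in>#proots (complex_charpoly A). lead_coeff p * (\<Prod>z\<in>#proots p. l - z))"
    by (simp only: prod_mset.distrib image_mset_const_eq prod_mset_replicate_mset size_proots_complex_charpoly)
  finally show ?thesis
    by (simp only: poly_prod_proots[of p])
qed

lemma det_one_plus_matrix_power:
  "det (mat 1 + mat w ** matrix_power A n) = (\<Prod>l\<in>#proots (complex_charpoly A). 1 + w * l ^ n)"
proof -
  have "mat 1 + mat w ** matrix_power A n = poly_matrix (1 + monom w n) A"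
    by (simp add: poly_matrix_add poly_matrix_1 poly_matrix_monom)
  then show ?thesis by (simp add: det_poly_matrix poly_monom)
qed

section \<open>Growth of the powers of a matrix\<close>

text \<open>Pigeonhole: among N + 1 roots of unity each \<open>v\<close> spoils at most one. If it
  spoiled two, their separation would force \<open>cmod v < 1/2\<close>, and then neither
  \<open>1 + w * v\<close> is small. The constant does not depend on \<open>E\<close>, which will
  consist of n-th powers of eigenvalues for varying n.\<close>

lemma exists_unit_avoiding:
  "\<exists>\<delta>>0. \<forall>E. size E \<le> N \<longrightarrow>
    (\<exists>w. cmod w = 1 \<and> (\<forall>v\<in>#E. \<delta> * max 1 (cmod v) \<le> cmod (1 + w * v)))"
proof -
  define W where "W = {z::complex. z ^ Suc N = 1}"
  have card: "card W = Suc N" unfolding W_def by (rule card_complex_roots_unity) simp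
  then have "finite W" using card.infinite by fastforce
  moreover have "cmod z = 1" if "z \<in> W" for z
    using that power_eq_1_iff[of z "Suc N"] by (simp add: W_def)
  ultimately have W: "finite W" "card W = Suc N" "W \<subseteq> sphere 0 1" using card by auto
  \<comment> \<open>The inserted 1 keeps \<open>D\<close> nonempty when \<open>W\<close> has a
    single element, and gives \<open>d \<le> 1\<close>.\<close>
  define D where "D = insert 1 ((\<lambda>(a, b). dist a b) ` {(a, b). a \<in> W \<and> b \<in> W \<and> a \<noteq> b})"
  have finD: "finite D"
    unfolding D_def using W(1)
    by (intro finite.insertI finite_imageI finite_subset[OF _ finite_cartesian_product[OF W(1) W(1)]]) auto
  define d where "d = Min D"
  have d0: "d > 0"
    unfolding d_def using finD by (subst Min_gr_iff) (auto simp: D_def)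
  have d1: "d \<le> 1" unfolding d_def using finD by (intro Min_le) (auto simp: D_def)
  have sep: "d \<le> dist a b" if "a \<in> W" "b \<in> W" "a \<noteq> b" for a b
    unfolding d_def using finD that by (intro Min_le) (auto simp: D_def)
  define \<delta> where "\<delta> = d / 4"
  have uniq: "a = b" if ab: "a \<in> W" "b \<in> W"
    and bad: "cmod (1 + a * v) < \<delta> * max 1 (cmod v)" "cmod (1 + b * v) < \<delta> * max 1 (cmod v)" for a b v
  proof (rule ccontr)
    assume "a \<noteq> b"
    have na: "cmod a = 1" using ab W by auto
    have "d * cmod v \<le> dist a b * cmod v"
      using sep[OF ab \<open>a \<noteq> b\<close>] by (intro mult_right_mono) auto
    also have "\<dots> = cmod ((1 + a * v) - (1 + b * v))"
      by (simp add: dist_norm left_diff_distrib flip: norm_mult)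
    also have "\<dots> < 2 * (\<delta> * max 1 (cmod v))"
      using bad norm_triangle_ineq4[of "1 + a * v" "1 + b * v"] by linarith
    finally have lt: "d * cmod v < d / 2 * max 1 (cmod v)" by (simp add: \<delta>_def)
    then have "cmod v < 1" using d0 by (auto simp: max_def split: if_splits)
    then have "cmod v < 1 / 2" using lt d0 by (simp add: max_def)
    moreover have "1 \<le> cmod (1 + a * v) + cmod v"
      using norm_triangle_ineq4[of "1 + a * v" "a * v"] na by (simp add: norm_mult)
    ultimately show False using bad(1) d1 by (simp add: \<delta>_def max_def split: if_splits)
  qed
  have "\<exists>w. cmod w = 1 \<and> (\<forall>v\<in>#E. \<delta> * max 1 (cmod v) \<le> cmod (1 + w * v))" if E: "size E \<le> N" for E
  proof -
    define bad where "bad v = {w\<in>W. cmod (1 + w * v) < \<delta> * max 1 (cmod v)}" for v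
    have "card (bad v) \<le> 1" for v
      using uniq W(1) by (intro card_le_Suc0_iff_eq[THEN iffD2, unfolded One_nat_def[symmetric]]) (auto simp: bad_def)
    then have "card (\<Union>v\<in>set_mset E. bad v) \<le> (\<Sum>v\<in>set_mset E. 1)"
      by (intro order.trans[OF card_UN_le] sum_mono) auto
    also have "\<dots> \<le> size E"
      unfolding size_multiset_overloaded_eq by (intro sum_mono) (auto simp: Suc_le_eq)
    finally have "card (\<Union>v\<in>set_mset E. bad v) < card W" using E W by simp
    moreover have "finite (\<Union>v\<in>set_mset E. bad v)" using W(1) by (auto simp: bad_def)
    ultimately obtain w where "w \<in> W" "w \<notin> (\<Union>v\<in>set_mset E. bad v)"
      by (metis card_mono linorder_not_less subsetI)
    then show ?thesis using W(3) by (intro exI[of _ w]) (auto simp: bad_def not_less)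
  qed
  then show ?thesis using d0 by (intro exI[of _ \<delta>]) (auto simp: \<delta>_def)
qed

section \<open>Bounds from Cramer's rule\<close>

lemma norm_vec_le_card:
  fixes x :: "complex^'n" and a :: real
  assumes "\<And>i. cmod (x $ i) \<le> a"
  shows "norm x \<le> CARD('n) * a"
  unfolding norm_vec_def
  by (rule order.trans[OF L2_set_le_sum]) (use assms in \<open>auto intro: order.trans[OF sum_bounded_above]\<close>)

lemma norm_vector_scalar: "norm (c *s x) = cmod c * norm x"
  for x :: "complex^'n"
  by (simp add: norm_vec_def norm_mult L2_set_right_distrib)

lemma cmod_det_le:
  fixes M :: "complex^'n^'n"
  assumes "\<And>i j. cmod (M $ i $ j) \<le> a"
  shows "cmod (det M) \<le> fact CARD('n) * a ^ CARD('n)"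
proof -
  have "cmod (det M) \<le> (\<Sum>p | p permutes (UNIV :: 'n set). a ^ CARD('n))"
    unfolding det_def
  proof (intro sum_norm_le)
    fix p :: "'n \<Rightarrow> 'n"
    have "(\<Prod>i\<in>UNIV. cmod (M $ i $ p i)) \<le> (\<Prod>i\<in>(UNIV :: 'n set). a)"
      using assms by (intro prod_mono) auto
    then show "cmod (of_int (sign p) * (\<Prod>i\<in>UNIV. M $ i $ p i)) \<le> a ^ CARD('n)"
      by (simp add: norm_mult prod_norm sign_def)
  qed
  then show ?thesis by (simp add: card_permutations)
qed

text \<open>Cramer's rule bounds the entries of the solution by \<open>N! a^N / d\<close>. It is
  applied to \<open>M *v x\<close> scaled to norm 1, so that the replaced column still has entries
  at most \<open>a\<close>; this is where \<open>1 \<le> a\<close> enters.\<close>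

lemma norm_le_of_det_ge:
  fixes M :: "complex^'n^'n"
  assumes a: "1 \<le> a" "\<And>i j. cmod (M $ i $ j) \<le> a" and d: "0 < d" "d \<le> cmod (det M)"
  shows "norm x \<le> CARD('n) * (fact CARD('n) * a ^ CARD('n) / d) * norm (M *v x)"
proof (cases "M *v x = 0")
  case True
  have "det M \<noteq> 0" using d by auto
  then have inv: "matrix_inv M ** M = mat 1" by (simp add: invertible_det_nz invertible_matrix_inv)
  have "x = (matrix_inv M ** M) *v x" by (simp add: inv)
  also have "\<dots> = matrix_inv M *v (M *v x)" by (simp add: matrix_vector_mul_assoc)
  finally have "x = 0" using True by simp
  then show ?thesis by simp
next
  case False
  define r where "r = norm (M *v x)"
  have r: "r > 0" using False by (simp add: r_def)
  define y where "y = complex_of_real (1 / r) *s x"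
  define b where "b = complex_of_real (1 / r) *s (M *v x)"
  have b: "norm b = 1" using r by (simp add: b_def norm_vector_scalar r_def[symmetric] norm_divide)
  have "det M \<noteq> 0" using d by auto
  moreover have "M *v y = b" by (simp only: y_def b_def vector_scalar_commute)
  ultimately have y: "y = (\<chi> k. det (\<chi> i j. if j = k then b $ i else M $ i $ j) / det M)"
    by (simp add: cramer)
  have yk: "cmod (y $ k) \<le> fact CARD('n) * a ^ CARD('n) / d" for k
  proof -
    have "cmod (b $ i) \<le> a" for i
      using Finite_Cartesian_Product.norm_nth_le[of b i] b a(1) by linarith
    then have "cmod (det (\<chi> i j. if j = k then b $ i else M $ i $ j)) \<le> fact CARD('n) * a ^ CARD('n)"
      by (intro cmod_det_le) (use a in auto)
    then have "cmod (det (\<chi> i j. if j = k then b $ i else M $ i $ j)) / cmod (det M)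
        \<le> fact CARD('n) * a ^ CARD('n) / d"
      using d a by (intro frac_le) auto
    then show ?thesis by (subst y) (simp add: norm_divide)
  qed
  have "norm y \<le> CARD('n) * (fact CARD('n) * a ^ CARD('n) / d)"
    by (rule norm_vec_le_card) (rule yk)
  moreover have "norm y = norm x / r"
    using r by (simp add: y_def norm_vector_scalar norm_divide)
  ultimately show ?thesis using r by (simp add: r_def field_simps)
qed

section \<open>Powers as averages of resolvents\<close>

lemma sum_root_unity_powers:
  assumes "n > 0"
  shows "(\<Sum>k<n. cis (2 * pi / n) ^ (k * m)) = (if n dvd m then of_nat n else 0)"
proof -
  define q where "q = cis (2 * pi / n) ^ m"
  have q: "q = exp (2 * of_real pi * \<i> * of_nat m / of_nat n)"
    unfolding q_def cis_conv_exp by (simp add: field_simps flip: exp_of_nat_mult)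
  have q1: "q = 1 \<longleftrightarrow> n dvd m"
    using complex_root_unity_eq_1[of n m] assms unfolding q by simp
  have "q ^ n = 1"
  proof -
    have "q ^ n = (cis (2 * pi / n) ^ n) ^ m" by (simp add: q_def mult.commute flip: power_mult)
    also have "cis (2 * pi / n) ^ n = 1" using assms by (simp add: Complex.DeMoivre)
    finally show ?thesis by simp
  qed
  then have "(\<Sum>k<n. q ^ k) = (if q = 1 then of_nat n else 0)"
    by (simp add: geometric_sum)
  then show ?thesis by (simp add: q1) (simp add: q_def mult.commute flip: power_mult)
qed


text \<open>Read backwards, this bounds \<open>cmod (l - z)\<close> from below: if
  \<open>l^n\<close> is far from \<open>z^n\<close>, then \<open>l\<close> keeps a distance from
  \<open>z\<close> that is smaller only by the factor \<open>n * max 1 (cmod l) ^ n\<close>.\<close>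

lemma norm_power_diff_le:
  fixes l z :: complex
  assumes "cmod z = 1" and "n \<ge> 1"
  shows "cmod (l ^ n - z ^ n) \<le> cmod (l - z) * (n * max 1 (cmod l) ^ n)"
proof -
  have "cmod (l ^ n - z ^ n) = cmod (l - z) * cmod (\<Sum>i<n. z ^ (n - Suc i) * l ^ i)"
    by (simp add: power_diff_sumr2 norm_mult)
  also have "cmod (\<Sum>i<n. z ^ (n - Suc i) * l ^ i) \<le> (\<Sum>i<n. max 1 (cmod l) ^ n)"
  proof (intro sum_norm_le)
    fix i assume "i \<in> {..<n}"
    then have "cmod l ^ i \<le> max 1 (cmod l) ^ i" "max 1 (cmod l) ^ i \<le> max 1 (cmod l) ^ n"
      by (auto intro: power_mono power_increasing)
    then show "cmod (z ^ (n - Suc i) * l ^ i) \<le> max 1 (cmod l) ^ n"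
      using assms by (simp add: norm_mult norm_power)
  qed
  finally show ?thesis by (simp add: mult_left_mono)
qed

lemma matrix_vector_mult_sum_right: "M *v (\<Sum>i\<in>I. f i) = (\<Sum>i\<in>I. M *v f i)"
  for M :: "'a::comm_ring_1^'n^'m"
  by (induction I rule: infinite_finite_induct) (simp_all add: matrix_vector_right_distrib)

lemma mat_vector_mult: "mat c *v x = c *s x"
  for x :: "'a::comm_ring_1^'n"
  by (simp add: vec_eq_iff matrix_vector_mult_def mat_def mult_delta_left)

lemma one_plus_matrix_power_vector:
  "(mat 1 + mat w ** matrix_power A n) *v x = x + w *s (matrix_power A n *v x)"
  by (simp add: matrix_vector_mult_add_rdistrib mat_vector_mult flip: matrix_vector_mul_assoc)

(* The vectors r k solve (A - \<zeta> k) r k = (1 + w A^n) x, where \<zeta> k runs through the solutions of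
   1 + w \<zeta>^n = 0; averaging over these unit circle points recovers A^t x from resolvents of A. *)
lemma matrix_power_vector_eq_resolvent_sum:
  fixes A :: "complex^'n^'n" and z :: complex and x :: "complex^'n"
  assumes n: "n \<ge> 1" and z: "w * z ^ n = -1"
  defines "\<zeta> \<equiv> \<lambda>k. z * cis (2 * pi / n) ^ k"
  defines "r \<equiv> \<lambda>k. \<Sum>j<n. (w * \<zeta> k ^ (n - Suc j)) *s (matrix_power A j *v x)"
  shows "(A - mat (\<zeta> k)) *v r k = (mat 1 + mat w ** matrix_power A n) *v x"
    and "t < n \<Longrightarrow> of_nat n *s (matrix_power A t *v x) = - (\<Sum>k<n. \<zeta> k ^ Suc t *s r k)"
proof -
  have zn: "\<zeta> k ^ n = z ^ n" for k
  proof -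
    have "(cis (2 * pi / n) ^ k) ^ n = (cis (2 * pi / n) ^ n) ^ k"
      by (metis mult.commute power_mult)
    also have "cis (2 * pi / n) ^ n = 1" using n by (simp add: Complex.DeMoivre)
    finally show ?thesis by (simp add: \<zeta>_def power_mult_distrib)
  qed
  \<comment> \<open>Chosen so that \<open>A - mat (\<zeta> k)\<close> sends summand \<open>j\<close>
    of \<open>r k\<close> to \<open>f (Suc j) - f j\<close>. The sum telescopes, and
    \<open>w * \<zeta> k ^ n = -1\<close> turns the boundary term \<open>- f 0\<close> into
    \<open>x\<close>.\<close>
  define f where "f j = (w * \<zeta> k ^ (n - j)) *s (matrix_power A j *v x)" for j
  have "(A - mat (\<zeta> k)) *v ((w * \<zeta> k ^ (n - Suc j)) *s (matrix_power A j *v x)) = f (Suc j) - f j"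
    if "j < n" for j
  proof -
    have "\<zeta> k ^ (n - j) = \<zeta> k * \<zeta> k ^ (n - Suc j)"
      using that by (metis Suc_diff_Suc power_Suc)
    then show ?thesis
      by (simp add: f_def matrix_vector_mult_diff_rdistrib mat_vector_mult vector_scalar_commute
        matrix_power_Suc mult_ac flip: matrix_vector_mul_assoc)
  qed
  then have "(A - mat (\<zeta> k)) *v r k = (\<Sum>j<n. f (Suc j) - f j)"
    unfolding r_def matrix_vector_mult_sum_right by (intro sum.cong) auto
  also have "\<dots> = f n - f 0" by (rule sum_lessThan_telescope)
  finally show "(A - mat (\<zeta> k)) *v r k = (mat 1 + mat w ** matrix_power A n) *v x"
    by (simp add: f_def zn z one_plus_matrix_power_vector add.commute)
  assume t: "t < n"
  have coef: "(\<Sum>k<n. \<zeta> k ^ Suc t * (w * \<zeta> k ^ (n - Suc j))) = (if j = t then - of_nat n else 0)"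
    if "j < n" for j
  proof -
    let ?m = "n + t - j"
    have "\<zeta> k ^ Suc t * (w * \<zeta> k ^ (n - Suc j)) = (w * z ^ ?m) * cis (2 * pi / n) ^ (k * ?m)" for k
    proof -
      have "\<zeta> k ^ Suc t * \<zeta> k ^ (n - Suc j) = \<zeta> k ^ ?m"
      proof -
        have "Suc t + (n - Suc j) = ?m" using that by simp
        then show ?thesis by (metis power_add)
      qed
      also have "\<dots> = z ^ ?m * cis (2 * pi / n) ^ (k * ?m)"
        by (simp add: \<zeta>_def power_mult_distrib power_mult)
      finally show ?thesis by (simp add: mult_ac)
    qed
    then have "(\<Sum>k<n. \<zeta> k ^ Suc t * (w * \<zeta> k ^ (n - Suc j))) =
        (w * z ^ ?m) * (if n dvd ?m then of_nat n else 0)"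
      using n by (simp only: sum_root_unity_powers flip: sum_distrib_left)
    moreover have "n dvd ?m \<longleftrightarrow> j = t"
    proof
      assume "n dvd ?m"
      then obtain q where q: "?m = n * q" by blast
      \<comment> \<open>\<open>?m\<close> lies strictly between 0 and \<open>2 n\<close>, so
        \<open>n\<close> divides it only when it equals \<open>n\<close>, that is for
        \<open>j = t\<close>.\<close>
      then have "0 < n * q" "n * q < n * 2" using t that by linarith+
      then have "q = 1" by (cases q) auto
      then show "j = t" using q that by auto
    qed auto
    ultimately show ?thesis by (simp add: z)
  qed
  have "(\<Sum>k<n. \<zeta> k ^ Suc t *s r k) =
      (\<Sum>j<n. (\<Sum>k<n. \<zeta> k ^ Suc t * (w * \<zeta> k ^ (n - Suc j))) *s (matrix_power A j *v x))"
    unfolding r_def vec.scale_sum_right vec.scale_sum_left vector_smult_assoc by (rule sum.swap)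
  also have "\<dots> = (\<Sum>j<n. if j = t then - (of_nat n *s (matrix_power A t *v x)) else 0)"
    by (intro sum.cong refl) (auto simp del: power_Suc simp: coef)
  finally show "of_nat n *s (matrix_power A t *v x) = - (\<Sum>k<n. \<zeta> k ^ Suc t *s r k)"
    using t by simp
qed


lemma prod_mset_norm: "cmod (\<Prod>x\<in>#E. f x) = (\<Prod>x\<in>#E. cmod (f x))"
  by (induction E) (auto simp: norm_mult)

lemma prod_mset_mono_real:
  fixes f g :: "'b \<Rightarrow> real"
  assumes "\<And>x. x \<in># E \<Longrightarrow> 0 \<le> f x \<and> f x \<le> g x"
  shows "(\<Prod>x\<in>#E. f x) \<le> (\<Prod>x\<in>#E. g x)" and "0 \<le> (\<Prod>x\<in>#E. f x)"
proof -
  have "0 \<le> (\<Prod>x\<in>#E. f x) \<and> (\<Prod>x\<in>#E. f x) \<le> (\<Prod>x\<in>#E. g x)"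
    using assms
  proof (induction E)
    case (add x E)
    then show ?case by (auto intro!: mult_mono intro: order.trans[of 0 "f x" "g x"])
  qed auto
  then show "(\<Prod>x\<in>#E. f x) \<le> (\<Prod>x\<in>#E. g x)" "0 \<le> (\<Prod>x\<in>#E. f x)" by auto
qed

lemma prod_mset_power_distrib: "(\<Prod>x\<in>#E. f x ^ n) = (\<Prod>x\<in>#E. f x) ^ n"
  for f :: "'b \<Rightarrow> real"
  by (induction E) (auto simp: power_mult_distrib)

text \<open>The Mahler measure of the characteristic polynomial. Its logarithm is the value of the
  Jensen integral as well as the sum over the unstable eigenvalues.\<close>

definition growth :: "complex^'n^'n \<Rightarrow> real" where
  "growth A = (\<Prod>l\<in>#proots (complex_charpoly A). max 1 (cmod l))"

lemma growth_ge_1: "1 \<le> growth A"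
proof -
  have "1 \<le> (\<Prod>l\<in>#E. max 1 (cmod l))" for E
    by (induction E) (auto simp: mult_ge1_I)
  then show ?thesis by (simp add: growth_def)
qed

text \<open>For the pigeonhole choice of \<open>w\<close>, the eigenvalues keep a distance of order
  \<open>1 / n\<close> from the roots of \<open>1 + w \<zeta>^n = 0\<close>, so Cramer's rule bounds
  the resolvents there polynomially in \<open>n\<close>. The same \<open>w\<close> serves the
  determinant and the norm bounds; \<open>w\<close> varies with \<open>n\<close>, but
  \<open>K\<close> and \<open>\<delta>\<close> do not.\<close>

lemma norm_matrix_power_le_one_plus:
  fixes A :: "complex^'n^'n"
  obtains K \<delta> :: real where "0 < \<delta>" "1 \<le> K"
    "\<And>n. 1 \<le> n \<Longrightarrow> \<exists>w. cmod w = 1 \<and>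
      \<delta> * growth A ^ n \<le> cmod (det (mat 1 + mat w ** matrix_power A n)) \<and>
      cmod (det (mat 1 + mat w ** matrix_power A n)) \<le> 2 ^ CARD('n) * growth A ^ n \<and>
      (\<forall>x. \<forall>t\<le>n. norm (matrix_power A t *v x) \<le> K * real n ^ CARD('n) * norm ((mat 1 + mat w ** matrix_power A n) *v x))"
proof -
  let ?N = "CARD('n)" and ?E = "proots (complex_charpoly A)"
  obtain \<delta> where \<delta>: "\<delta> > 0" and ex: "\<And>E. size E \<le> ?N \<Longrightarrow>
      \<exists>w. cmod w = 1 \<and> (\<forall>v\<in>#E. \<delta> * max 1 (cmod v) \<le> cmod (1 + w * v))"
    using exists_unit_avoiding[of ?N] by blast
  \<comment> \<open>Bounds the entries of \<open>A - mat z\<close> for all \<open>z\<close> of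
    modulus 1, and is at least 1.\<close>
  define a where "a = 1 + (\<Sum>i\<in>UNIV. \<Sum>j\<in>UNIV. cmod (A $ i $ j)) + 1"
  have ent: "cmod (A $ i $ j) \<le> (\<Sum>i\<in>UNIV. \<Sum>j\<in>UNIV. cmod (A $ i $ j))" for i j
  proof -
    have "cmod (A $ i $ j) \<le> (\<Sum>j\<in>UNIV. cmod (A $ i $ j))" by (intro member_le_sum) auto
    also have "\<dots> \<le> (\<Sum>i\<in>UNIV. \<Sum>j\<in>UNIV. cmod (A $ i $ j))"
      by (intro member_le_sum[of i _ "\<lambda>i. \<Sum>j\<in>UNIV. cmod (A $ i $ j)"]) (auto intro: sum_nonneg)
    finally show ?thesis .
  qed
  have a1: "1 \<le> a" unfolding a_def by (simp add: sum_nonneg)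
  have aA: "cmod ((A - mat z) $ i $ j) \<le> a" if "cmod z = 1" for z i j
    using norm_triangle_ineq4[of "A $ i $ j" "mat z $ i $ j"] ent[of i j] that
    by (auto simp: a_def mat_def split: if_splits)
  define R where "R = ?N * (fact ?N * a ^ ?N / \<delta> ^ ?N)"
  have R0: "0 \<le> R" using a1 \<delta> by (simp add: R_def)
  show thesis
  proof (rule that[of "\<delta> ^ ?N" "1 + R"])
    fix n :: nat assume n: "1 \<le> n"
    obtain w where w: "cmod w = 1"
      and away: "\<And>l. l \<in># ?E \<Longrightarrow> \<delta> * max 1 (cmod l) ^ n \<le> cmod (1 + w * l ^ n)"
    proof -
      have "max 1 (cmod (l ^ n)) = max 1 (cmod l) ^ n" for l
        by (cases "1 \<le> cmod l") (auto simp: norm_power max_def power_le_one one_le_power dest: antisym)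
      then show thesis
        using ex[of "{#l ^ n. l \<in># ?E#}"] that by (auto simp: size_proots_complex_charpoly)
    qed
    let ?G = "mat 1 + mat w ** matrix_power A n"
    have det: "cmod (det ?G) = (\<Prod>l\<in>#?E. cmod (1 + w * l ^ n))"
      by (simp add: det_one_plus_matrix_power prod_mset_norm)
    have "\<delta> ^ ?N * growth A ^ n = (\<Prod>l\<in>#?E. \<delta> * max 1 (cmod l) ^ n)"
      by (simp only: growth_def prod_mset.distrib image_mset_const_eq prod_mset_replicate_mset size_proots_complex_charpoly
        prod_mset_power_distrib)
    also have "\<dots> \<le> (\<Prod>l\<in>#?E. cmod (1 + w * l ^ n))"
      using \<delta> away by (intro prod_mset_mono_real) auto
    finally have lower: "\<delta> ^ ?N * growth A ^ n \<le> cmod (det ?G)" by (simp only: det)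
    have "(\<Prod>l\<in>#?E. cmod (1 + w * l ^ n)) \<le> (\<Prod>l\<in>#?E. 2 * max 1 (cmod l) ^ n)"
    proof (intro prod_mset_mono_real conjI)
      fix l
      have "cmod (1 + w * l ^ n) \<le> 1 + cmod l ^ n"
        using norm_triangle_ineq[of 1 "w * l ^ n"] w by (simp add: norm_mult norm_power)
      also have "\<dots> \<le> 2 * max 1 (cmod l) ^ n"
        using power_mono[OF max.cobounded2 norm_ge_zero, of l n 1] one_le_power[OF max.cobounded1[of 1 "cmod l"], of n] by linarith
      finally show "cmod (1 + w * l ^ n) \<le> 2 * max 1 (cmod l) ^ n" .
    qed auto
    also have "\<dots> = 2 ^ ?N * growth A ^ n"
      by (simp only: growth_def prod_mset.distrib image_mset_const_eq prod_mset_replicate_mset size_proots_complex_charpoly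
        prod_mset_power_distrib)
    finally have upper: "cmod (det ?G) \<le> 2 ^ ?N * growth A ^ n" by (simp only: det)
    have w0: "w \<noteq> 0" using w by auto
    obtain z where z: "w * z ^ n = -1"
    proof -
      obtain z where "- 1 / w = z ^ n" using exists_complex_root[of n "- 1 / w"] n by auto
      then show thesis using w0 by (intro that[of z]) (simp add: field_simps)
    qed
    have "cmod z ^ n = 1"
      using arg_cong[OF z, of cmod] w by (simp add: norm_mult norm_power)
    then have nz: "cmod z = 1" using n power_eq_1_iff[of "cmod z" n] by auto
    let ?z = "\<lambda>k::nat. z * cis (2 * pi / n) ^ k"
    let ?r = "\<lambda>k x. \<Sum>j<n. (w * ?z k ^ (n - Suc j)) *s (matrix_power A j *v x)"
    have nzk: "cmod (?z k) = 1" for k by (simp add: norm_mult norm_power nz)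
    have zk: "w * ?z k ^ n = -1" for k
    proof -
      have "(cis (2 * pi / n) ^ k) ^ n = (cis (2 * pi / n) ^ n) ^ k"
        by (metis mult.commute power_mult)
      also have "cis (2 * pi / n) ^ n = 1" using n by (simp add: Complex.DeMoivre)
      finally show ?thesis by (simp add: power_mult_distrib z)
    qed
    have rk: "norm (?r k x) \<le> R * real n ^ ?N * norm (?G *v x)" for k x
    proof -
      \<comment> \<open>Writing \<open>1 + w * l^n\<close> as \<open>w * (l^n - ?z k ^ n)\<close>
        bounds \<open>\<delta> * max 1 (cmod l) ^ n\<close> by
        \<open>cmod (l - ?z k) * n * max 1 (cmod l) ^ n\<close>. The growth factors cancel and leave
        the distance \<open>\<delta> / n\<close>, uniformly in \<open>l\<close>.\<close>
      have "(\<delta> / n) ^ ?N = (\<Prod>l\<in>#?E. \<delta> / n)"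
        by (simp add: size_proots_complex_charpoly image_mset_const_eq)
      also have "\<dots> \<le> (\<Prod>l\<in>#?E. cmod (l - ?z k))"
      proof (intro prod_mset_mono_real conjI)
        fix l assume l: "l \<in># ?E"
        have "\<delta> * max 1 (cmod l) ^ n \<le> cmod (1 + w * l ^ n)" by (rule away[OF l])
        also have "1 + w * l ^ n = w * (l ^ n - ?z k ^ n)"
          using zk[of k] by (simp add: right_diff_distrib)
        also have "cmod \<dots> = cmod (l ^ n - ?z k ^ n)" by (simp only: norm_mult w mult_1_left)
        also have "\<dots> \<le> cmod (l - ?z k) * (n * max 1 (cmod l) ^ n)"
          by (intro norm_power_diff_le nzk n)
        finally have "\<delta> * max 1 (cmod l) ^ n \<le> (cmod (l - ?z k) * n) * max 1 (cmod l) ^ n"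
          by (simp add: mult_ac)
        moreover have "0 < max 1 (cmod l) ^ n" by simp
        ultimately have "\<delta> \<le> cmod (l - ?z k) * n"
          by (simp only: mult_le_cancel_right_pos)
        then show "\<delta> / n \<le> cmod (l - ?z k)" using n by (simp add: field_simps)
      qed (use \<delta> in auto)
      finally have "(\<delta> / n) ^ ?N \<le> cmod (det (A - mat (?z k)))"
        by (simp only: det_diff_mat prod_mset_norm)
      then have "norm (?r k x) \<le> ?N * (fact ?N * a ^ ?N / (\<delta> / n) ^ ?N) * norm ((A - mat (?z k)) *v ?r k x)"
        using \<delta> n by (intro norm_le_of_det_ge a1 aA nzk) auto
      also have "(A - mat (?z k)) *v ?r k x = ?G *v x"
        by (rule matrix_power_vector_eq_resolvent_sum(1)[OF n z])
      finally show ?thesis using \<delta> by (simp add: R_def power_divide field_simps)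
    qed
    have lt: "norm (matrix_power A t *v x) \<le> R * real n ^ ?N * norm (?G *v x)" if "t < n" for t x
    proof -
      have "n * norm (matrix_power A t *v x) = norm (complex_of_nat n *s (matrix_power A t *v x))"
        by (simp add: norm_vector_scalar)
      also have "\<dots> = norm (\<Sum>k<n. ?z k ^ Suc t *s ?r k x)"
        by (subst matrix_power_vector_eq_resolvent_sum(2)[OF n z that]) simp
      also have "\<dots> \<le> (\<Sum>k<n. R * real n ^ ?N * norm (?G *v x))"
        by (intro sum_norm_le) (use nzk rk in \<open>simp only: norm_vector_scalar norm_power power_one mult_1_left\<close>)
      finally show ?thesis using n by simp
    qed
    have "norm (matrix_power A t *v x) \<le> (1 + R) * real n ^ ?N * norm (?G *v x)" if "t \<le> n" for t x
    \<comment> \<open>The averaging formula covers only \<open>t < n\<close>; the last power comes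
      from \<open>w A^n x = G x - x\<close>.\<close>
    proof (cases "t = n")
      case True
      have "norm (matrix_power A n *v x) = norm (w *s (matrix_power A n *v x))" by (simp add: norm_vector_scalar w)
      also have "w *s (matrix_power A n *v x) = ?G *v x - x" by (simp add: one_plus_matrix_power_vector)
      also have "norm \<dots> \<le> norm (?G *v x) + norm x" by (rule norm_triangle_ineq4)
      finally have "norm (matrix_power A n *v x) \<le> norm (?G *v x) + norm x" .
      moreover have "norm x \<le> R * real n ^ ?N * norm (?G *v x)" using lt[of 0 x] n by simp
      moreover have "norm (?G *v x) \<le> real n ^ ?N * norm (?G *v x)"
        using n by (simp add: mult_le_cancel_right1)
      ultimately have "norm (matrix_power A n *v x) \<le> real n ^ ?N * norm (?G *v x) + R * real n ^ ?N * norm (?G *v x)"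
        by linarith
      then show ?thesis using True by (simp only: distrib_right mult_1_left)
    next
      case False
      then have "norm (matrix_power A t *v x) \<le> R * real n ^ ?N * norm (?G *v x)" using lt that by simp
      also have "\<dots> \<le> (1 + R) * real n ^ ?N * norm (?G *v x)" by (intro mult_right_mono) auto
      finally show ?thesis .
    qed
    with w lower upper show "\<exists>w. cmod w = 1 \<and>
      \<delta> ^ ?N * growth A ^ n \<le> cmod (det (mat 1 + mat w ** matrix_power A n)) \<and>
      cmod (det (mat 1 + mat w ** matrix_power A n)) \<le> 2 ^ ?N * growth A ^ n \<and>
      (\<forall>x. \<forall>t\<le>n. norm (matrix_power A t *v x) \<le> (1 + R) * real n ^ ?N * norm ((mat 1 + mat w ** matrix_power A n) *v x))"
      by (intro exI[of _ w]) simp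
  qed (use \<delta> R0 in auto)
qed


text \<open>Without eigenvalues outside the closed disc \<open>growth A = 1\<close>, so
  \<open>det G\<close> stays between two positive constants. Cramer's rule then turns the bound on
  \<open>G^-1\<close> into one on \<open>G\<close>, and \<open>A^n\<close> is \<open>G - 1\<close>
  up to a unit factor.\<close>

lemma norm_matrix_power_le_polynomial:
  fixes A :: "complex^'n^'n"
  assumes "\<And>l. l \<in># proots (complex_charpoly A) \<Longrightarrow> cmod l \<le> 1"
  obtains K :: real and p where "1 \<le> K" "\<And>n x. norm (matrix_power A n *v x) \<le> K * real (Suc n) ^ p * norm x"
proof -
  let ?N = "CARD('n)"
  obtain K \<delta> where \<delta>: "0 < \<delta>" and K: "1 \<le> K" and
    ex: "\<And>n. 1 \<le> n \<Longrightarrow> \<exists>w. cmod w = 1 \<and>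
      \<delta> * growth A ^ n \<le> cmod (det (mat 1 + mat w ** matrix_power A n)) \<and>
      cmod (det (mat 1 + mat w ** matrix_power A n)) \<le> 2 ^ ?N * growth A ^ n \<and>
      (\<forall>x. \<forall>t\<le>n. norm (matrix_power A t *v x) \<le> K * real n ^ ?N * norm ((mat 1 + mat w ** matrix_power A n) *v x))"
    by (rule norm_matrix_power_le_one_plus[of A]) blast
  have growth: "growth A = 1"
  proof -
    have "image_mset (\<lambda>l. max 1 (cmod l)) (proots (complex_charpoly A)) = image_mset (\<lambda>_. 1) (proots (complex_charpoly A))"
      using assms by (intro image_mset_cong) (auto simp: max_def intro: antisym)
    then show ?thesis by (simp only: growth_def image_mset_const_eq prod_mset_replicate_mset power_one)
  qed
  \<comment> \<open>The first summand is Cramer's constant for recovering \<open>G x\<close> from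
    \<open>G^-1 (G x)\<close>, where \<open>det (G^-1)\<close> has modulus at least
    \<open>1 / 2^N\<close>; the 1 pays for \<open>x\<close> in
    \<open>w A^n x = G x - x\<close>.\<close>
  define L where "L = ?N * (fact ?N * K ^ ?N * 2 ^ ?N) + 1"
  have L0: "0 \<le> L" using K by (simp add: L_def)
  show thesis
  proof (rule that[of "L" "?N * ?N"])
    show "1 \<le> L" using K by (simp add: L_def)
    fix n :: nat and x :: "complex^'n"
    show "norm (matrix_power A n *v x) \<le> L * real (Suc n) ^ (?N * ?N) * norm x"
    proof (cases "n = 0")
      case True
      then show ?thesis using \<open>1 \<le> L\<close> by (simp add: mult_le_cancel_right1)
    next
      case False
      then have n: "1 \<le> n" by simp
      from ex[OF n] obtain w where w: "cmod w = 1"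
        and det: "\<delta> \<le> cmod (det (mat 1 + mat w ** matrix_power A n))"
          "cmod (det (mat 1 + mat w ** matrix_power A n)) \<le> 2 ^ ?N"
        and bd: "\<And>x t. t \<le> n \<Longrightarrow>
          norm (matrix_power A t *v x) \<le> K * real n ^ ?N * norm ((mat 1 + mat w ** matrix_power A n) *v x)"
        by (auto simp: growth)
      let ?G = "mat 1 + mat w ** matrix_power A n"
      have "det ?G \<noteq> 0" using det(1) \<delta> by auto
      then have inv: "matrix_inv ?G ** ?G = mat 1" "?G ** matrix_inv ?G = mat 1"
        by (simp_all add: invertible_det_nz invertible_matrix_inv)
      let ?a = "K * real n ^ ?N"
      have a1: "1 \<le> ?a" using K n by (simp add: mult_ge1_I)
      have ent: "cmod (matrix_inv ?G $ i $ j) \<le> ?a" for i j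
      proof -
        have "cmod (matrix_inv ?G $ i $ j) = cmod ((matrix_inv ?G *v axis j 1) $ i)"
          by (simp add: matrix_vector_mult_def axis_def mult_delta_right)
        also have "\<dots> \<le> norm (matrix_inv ?G *v axis j 1)" by (rule Finite_Cartesian_Product.norm_nth_le)
        also have "\<dots> \<le> ?a * norm (?G *v (matrix_inv ?G *v axis j 1))"
          using bd[of 0 "matrix_inv ?G *v axis j 1"] by simp
        also have "?G *v (matrix_inv ?G *v axis j 1) = axis j 1"
          unfolding matrix_vector_mul_assoc inv matrix_vector_mul_lid ..
        finally show ?thesis by (simp add: norm_axis_1)
      qed
      have "det (matrix_inv ?G) * det ?G = 1" by (simp add: inv flip: det_mul)
      then have prod1: "cmod (det (matrix_inv ?G)) * cmod (det ?G) = 1" by (metis norm_mult norm_one)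
      then have "1 \<le> cmod (det (matrix_inv ?G)) * 2 ^ ?N"
        using mult_left_mono[OF det(2) norm_ge_zero[of "det (matrix_inv ?G)"]] by simp
      then have "1 / 2 ^ ?N \<le> cmod (det (matrix_inv ?G))" by (simp add: field_simps)
      then have "norm (?G *v x) \<le> ?N * (fact ?N * ?a ^ ?N / (1 / 2 ^ ?N)) * norm (matrix_inv ?G *v (?G *v x))"
        by (intro norm_le_of_det_ge a1 ent) auto
      also have "matrix_inv ?G *v (?G *v x) = x"
        unfolding matrix_vector_mul_assoc inv matrix_vector_mul_lid ..
      also have "?N * (fact ?N * ?a ^ ?N / (1 / 2 ^ ?N)) = (L - 1) * real n ^ (?N * ?N)"
        by (simp add: L_def power_mult_distrib power_mult)
      finally have G: "norm (?G *v x) \<le> (L - 1) * real n ^ (?N * ?N) * norm x" .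
      have "norm (matrix_power A n *v x) = norm (w *s (matrix_power A n *v x))" by (simp add: norm_vector_scalar w)
      also have "w *s (matrix_power A n *v x) = ?G *v x - x" by (simp add: one_plus_matrix_power_vector)
      also have "norm \<dots> \<le> norm (?G *v x) + norm x" by (rule norm_triangle_ineq4)
      also have "\<dots> \<le> ((L - 1) * real n ^ (?N * ?N) + 1 * real n ^ (?N * ?N)) * norm x"
      proof -
        have "1 * norm x \<le> real n ^ (?N * ?N) * norm x"
          using n by (intro mult_right_mono one_le_power) auto
        with G show ?thesis by (simp add: distrib_right)
      qed
      also have "\<dots> = L * real n ^ (?N * ?N) * norm x" by (simp add: algebra_simps)
      also have "\<dots> \<le> L * real (Suc n) ^ (?N * ?N) * norm x"
        using L0 by (intro mult_right_mono mult_left_mono power_mono) auto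
      finally show ?thesis .
    qed
  qed
qed

section \<open>Growth of the information matrix\<close>

definition cdot :: "real^'n \<Rightarrow> complex^'n \<Rightarrow> complex" where
  "cdot c x = (\<Sum>i\<in>UNIV. of_real (c $ i) * x $ i)"

lemma cdot_le: "cmod (cdot c x) \<le> (\<Sum>i\<in>UNIV. \<bar>c $ i\<bar>) * norm x"
  unfolding cdot_def sum_distrib_right
  by (intro sum_norm_le) (auto simp: norm_mult intro!: mult_left_mono Finite_Cartesian_Product.norm_nth_le)

text \<open>The row \<open>C A^t\<close>, stored as a column vector.\<close>

definition output_row :: "real^'n^'n \<Rightarrow> real^'n \<Rightarrow> nat \<Rightarrow> real^'n" where
  "output_row A C t = ((\<lambda>v. transpose A *v v) ^^ t) C"

lemma cdot_transpose: "cdot (transpose A *v c) x = cdot c (complex_matrix A *v x)"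
proof -
  have "cdot (transpose A *v c) x = (\<Sum>i\<in>UNIV. \<Sum>j\<in>UNIV. of_real (c $ j) * (of_real (A $ j $ i) * x $ i))"
    by (simp add: cdot_def matrix_vector_mult_def transpose_def sum_distrib_right sum_distrib_left mult_ac)
  also have "\<dots> = cdot c (complex_matrix A *v x)"
    by (subst sum.swap) (simp add: cdot_def matrix_vector_mult_def sum_distrib_left)
  finally show ?thesis .
qed

lemma matrix_power_Suc2: "matrix_power A (Suc n) = matrix_power A n ** A"
  by (induction n) (simp_all add: matrix_power_Suc matrix_mul_assoc)

lemma cdot_output_row: "cdot (output_row A C t) x = cdot C (matrix_power (complex_matrix A) t *v x)"
proof (induction t arbitrary: x)
  case (Suc t)
  have "cdot (output_row A C (Suc t)) x = cdot (output_row A C t) (complex_matrix A *v x)"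
    unfolding output_row_def funpow.simps o_apply by (rule cdot_transpose)
  then show ?case by (simp add: Suc matrix_power_Suc2 matrix_vector_mul_assoc)
qed (simp add: output_row_def)

definition info_matrix :: "real \<Rightarrow> real^'n^'n \<Rightarrow> (nat \<Rightarrow> real^'n) \<Rightarrow> nat \<Rightarrow> real^'n^'n" where
  "info_matrix s J h n = J + (\<Sum>t<n. \<chi> i j. h t $ i * h t $ j / s\<^sup>2)"

lemma info_matrix_0 [simp]: "info_matrix s J h 0 = J"
  and info_matrix_Suc: "info_matrix s J h (Suc n) = info_matrix s J h n + (\<chi> i j. h n $ i * h n $ j / s\<^sup>2)"
  by (simp_all add: info_matrix_def)

lemma hermitian_form_info_matrix:
  "hermitian_form (complex_matrix (info_matrix s J h n)) x =
    hermitian_form (complex_matrix J) x + of_real ((\<Sum>t<n. (cmod (cdot (h t) x))\<^sup>2) / s\<^sup>2)"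
proof (induction n)
  case (Suc n)
  let ?O = "\<chi> i j. h n $ i * h n $ j / s\<^sup>2"
  have "hermitian_form (complex_matrix ?O) x = cnj (cdot (h n) x) * cdot (h n) x / of_real (s\<^sup>2)"
    by (simp add: hermitian_form_def cdot_def matrix_vector_mult_def sum_distrib_left sum_distrib_right
      sum_divide_distrib mult_ac)
  also have "\<dots> = of_real ((cmod (cdot (h n) x))\<^sup>2 / s\<^sup>2)"
    unfolding of_real_divide complex_norm_square by (simp add: mult.commute)
  finally have O: "hermitian_form (complex_matrix ?O) x = of_real ((cmod (cdot (h n) x))\<^sup>2 / s\<^sup>2)" .
  have "hermitian_form (complex_matrix (M + M')) x = hermitian_form (complex_matrix M) x + hermitian_form (complex_matrix M') x" for M M'
    by (simp add: hermitian_form_def matrix_vector_mult_def sum.distrib sum_distrib_left algebra_simps)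
  then show ?case by (simp add: info_matrix_Suc Suc O add_divide_distrib)
qed simp

section \<open>Real quadratic forms on complex vectors\<close>

definition vec_Re :: "complex^'n \<Rightarrow> real^'n" where "vec_Re x = (\<chi> i. Re (x $ i))"
definition vec_Im :: "complex^'n \<Rightarrow> real^'n" where "vec_Im x = (\<chi> i. Im (x $ i))"

lemma norm_cvec_square: "(norm x)\<^sup>2 = (\<Sum>i\<in>UNIV. (cmod (x $ i))\<^sup>2)"
  for x :: "complex^'n"
  by (simp add: norm_vec_def L2_set_def sum_nonneg)

lemma norm_cvec_Re_Im: "(norm x)\<^sup>2 = (norm (vec_Re x))\<^sup>2 + (norm (vec_Im x))\<^sup>2"
proof -
  have "(norm v)\<^sup>2 = (\<Sum>i\<in>UNIV. (v $ i)\<^sup>2)" for v :: "real^'a"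
    by (simp add: norm_vec_def L2_set_def sum_nonneg)
  then show ?thesis
    by (simp add: norm_cvec_square vec_Re_def vec_Im_def cmod_power2 sum.distrib)
qed

lemma hermitian_form_symmetric:
  assumes "transpose J = J"
  shows "hermitian_form (complex_matrix J) x = of_real (vec_Re x \<bullet> (J *v vec_Re x) + vec_Im x \<bullet> (J *v vec_Im x))"
proof -
  have J: "J $ i $ j = J $ j $ i" for i j
    using assms by (metis transpose_def vec_lambda_beta)
  have "(\<Sum>i\<in>UNIV. \<Sum>j\<in>UNIV. J $ i $ j * (Re (x $ i) * Im (x $ j)))
      = (\<Sum>i\<in>UNIV. \<Sum>j\<in>UNIV. J $ i $ j * (Im (x $ i) * Re (x $ j)))"
    by (subst sum.swap, intro sum.cong refl) (simp add: J mult_ac)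
  then show ?thesis
    by (simp add: complex_eq_iff hermitian_form_def matrix_vector_mult_def vec_Re_def vec_Im_def inner_vec_def
      sum_distrib_left sum.distrib sum_subtractf algebra_simps)
qed

text \<open>The lower constant is the minimum on the compact unit sphere; the upper one is the
  operator norm, enlarged by 1 to be positive.\<close>

lemma quadratic_form_bounds:
  fixes J :: "real^'n^'n"
  assumes "\<And>v. v \<noteq> 0 \<Longrightarrow> 0 < v \<bullet> (J *v v)"
  obtains c d where "0 < c" "0 < d" "\<And>v. c * (norm v)\<^sup>2 \<le> v \<bullet> (J *v v)" "\<And>v. v \<bullet> (J *v v) \<le> d * (norm v)\<^sup>2"
proof -
  have bl: "bounded_linear ((*v) J)" by simp
  have "norm (axis undefined 1 :: real^'n) = 1" by (simp add: norm_axis_1)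
  then have ne: "sphere (0 :: real^'n) 1 \<noteq> {}" by fastforce
  have "continuous_on (sphere 0 1) (\<lambda>v. v \<bullet> (J *v v))"
    by (intro continuous_intros bounded_linear.continuous_on[OF bl])
  then obtain u where u: "u \<in> sphere 0 1" "\<And>v. v \<in> sphere 0 1 \<Longrightarrow> u \<bullet> (J *v u) \<le> v \<bullet> (J *v v)"
    using continuous_attains_inf[OF compact_sphere ne] by blast
  define c where "c = u \<bullet> (J *v u)"
  have c: "c > 0" unfolding c_def using u(1) by (intro assms) auto
  show thesis
  proof (rule that[of c "onorm ((*v) J) + 1"])
    show "0 < onorm ((*v) J) + 1" using onorm_pos_le[OF bl] by simp
    fix v
    show "c * (norm v)\<^sup>2 \<le> v \<bullet> (J *v v)"
    proof (cases "v = 0")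
      case False
      let ?v = "v /\<^sub>R norm v"
      have "c \<le> ?v \<bullet> (J *v ?v)" unfolding c_def using False by (intro u(2)) simp
      also have "\<dots> = v \<bullet> (J *v v) / (norm v)\<^sup>2"
        by (simp add: matrix_vector_mult_scaleR power2_eq_square divide_inverse)
      finally show ?thesis using False by (simp add: field_simps)
    qed simp
    have "v \<bullet> (J *v v) \<le> norm v * norm (J *v v)" by (rule norm_cauchy_schwarz)
    also have "\<dots> \<le> norm v * (onorm ((*v) J) * norm v)"
      by (intro mult_left_mono onorm[OF bl]) auto
    also have "\<dots> \<le> (onorm ((*v) J) + 1) * (norm v)\<^sup>2"
      by (simp add: power2_eq_square algebra_simps)
    finally show "v \<bullet> (J *v v) \<le> (onorm ((*v) J) + 1) * (norm v)\<^sup>2" .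
  qed (rule c)
qed

text \<open>\<open>H\<close> is the adjoint of \<open>G\<close>. Passing to \<open>G^* G\<close>
  puts norm estimates for \<open>G\<close> into the shape that \<open>det_le_of_form_le\<close>
  accepts.\<close>

lemma norm_square_hermitian_form:
  fixes G :: "complex^'n^'n"
  defines "H \<equiv> \<chi> i j. cnj (G $ j $ i)"
  shows "hermitian_form (H ** G) x = of_real ((norm (G *v x))\<^sup>2)"
    and "cmod (det (H ** G)) = (cmod (det G))\<^sup>2"
proof -
  have "hermitian_form (H ** G) x = (\<Sum>i\<in>UNIV. cnj (x $ i) * (H *v (G *v x)) $ i)"
    by (simp add: hermitian_form_def matrix_vector_mul_assoc)
  also have "\<dots> = (\<Sum>i\<in>UNIV. \<Sum>k\<in>UNIV. cnj (G $ k $ i * x $ i) * (G *v x) $ k)"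
  proof -
    have "(H *v y) $ i = (\<Sum>k\<in>UNIV. cnj (G $ k $ i) * y $ k)" for y i
      by (simp add: matrix_vector_mult_def H_def)
    then show ?thesis by (simp add: sum_distrib_left mult_ac)
  qed
  also have "\<dots> = (\<Sum>k\<in>UNIV. cnj ((G *v x) $ k) * (G *v x) $ k)"
    by (subst sum.swap) (simp add: matrix_vector_mult_def[of G] cnj_sum sum_distrib_right)
  also have "\<dots> = of_real ((norm (G *v x))\<^sup>2)"
    unfolding norm_cvec_square of_real_sum complex_norm_square by (simp add: mult.commute)
  finally show "hermitian_form (H ** G) x = of_real ((norm (G *v x))\<^sup>2)" .
  have "det H = det (transpose H)" by simp
  also have "\<dots> = cnj (det G)"
    by (simp add: det_def transpose_def H_def)
  finally show "cmod (det (H ** G)) = (cmod (det G))\<^sup>2"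
    by (simp add: det_mul norm_mult power2_eq_square)
qed

lemma det_complex_matrix: "det (complex_matrix M) = of_real (det M)"
  by (simp add: det_def)

text \<open>Variation of constants for \<open>L = A + b C\<close>: the outputs
  \<open>C A^t x\<close> of the open loop act as forcing, and the closed loop propagates
  them.\<close>

lemma closed_loop_matrix_power:
  fixes A :: "real^'n^'n" and B C :: "real^'n"
  defines "Ac \<equiv> complex_matrix A" and "L \<equiv> complex_matrix (closed_loop_matrix A B C)"
    and "b \<equiv> \<chi> i. complex_of_real (B $ i)"
  shows "matrix_power L n *v x = matrix_power Ac n *v x + (\<Sum>t<n. cdot C (matrix_power Ac t *v x) *s (matrix_power L (n - Suc t) *v b))"
proof (induction n)
  case (Suc n)
  have L: "L *v y = Ac *v y + cdot C y *s b" for y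
    by (simp add: vec_eq_iff L_def Ac_def b_def cdot_def closed_loop_matrix_def matrix_vector_mult_def
      matrix_matrix_mult_def columnvector_def rowvector_def sum.distrib algebra_simps sum_distrib_left)
  have "L *v (\<Sum>t<n. cdot C (matrix_power Ac t *v x) *s (matrix_power L (n - Suc t) *v b))
      = (\<Sum>t<n. cdot C (matrix_power Ac t *v x) *s (matrix_power L (n - t) *v b))"
    unfolding matrix_vector_mult_sum_right
  proof (intro sum.cong refl)
    fix t assume "t \<in> {..<n}"
    then have "n - t = Suc (n - Suc t)" by auto
    then show "L *v (cdot C (matrix_power Ac t *v x) *s (matrix_power L (n - Suc t) *v b))
        = cdot C (matrix_power Ac t *v x) *s (matrix_power L (n - t) *v b)"
      by (simp add: matrix_power_Suc vector_scalar_commute flip: matrix_vector_mul_assoc)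
  qed
  moreover have "matrix_power L (Suc n) *v x = L *v (matrix_power L n *v x)"
    by (simp add: matrix_power_Suc matrix_vector_mul_assoc)
  moreover have "L *v (matrix_power Ac n *v x) = matrix_power Ac (Suc n) *v x + cdot C (matrix_power Ac n *v x) *s b"
    by (simp only: L matrix_power_Suc flip: matrix_vector_mul_assoc)
  ultimately show ?case
    by (simp add: Suc matrix_vector_right_distrib)
qed simp


(* det J_n is compared with |det (1 + w A^n)|^2: the upper bound on the form of J_n holds for any A,
   the lower bound is detectability, extracted from the closed loop by solving closed_loop_matrix_power for A^n x. *)
lemma det_info_matrix_bounds:
  fixes A J :: "real^'n^'n" and B C :: "real^'n"
  assumes stable: "schur_stable (closed_loop_matrix A B C)"
    and J: "positive_definite J" and s: "0 < s"
  obtains K \<delta> :: real and p where "1 \<le> K" "0 < \<delta>"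
    "\<And>n. 1 \<le> n \<Longrightarrow> \<delta> * growth (complex_matrix A) ^ (2 * n) \<le>
      (K * real n ^ p) ^ CARD('n) * \<bar>det (info_matrix s J (output_row A C) n)\<bar>"
    "\<And>n. 1 \<le> n \<Longrightarrow> \<bar>det (info_matrix s J (output_row A C) n)\<bar> \<le>
      (K * real n ^ p) ^ CARD('n) * growth (complex_matrix A) ^ (2 * n)"
proof -
  let ?N = "CARD('n)" and ?A = "complex_matrix A" and ?L = "complex_matrix (closed_loop_matrix A B C)"
  let ?b = "\<chi> i. complex_of_real (B $ i)"
  let ?J = "info_matrix s J (output_row A C)"
  define \<gamma> where "\<gamma> = (\<Sum>i\<in>UNIV. \<bar>C $ i\<bar>)"
  have \<gamma>0: "0 \<le> \<gamma>" by (simp add: \<gamma>_def sum_nonneg)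
  obtain K1 \<delta> where \<delta>: "0 < \<delta>" and K1: "1 \<le> K1" and
    ex: "\<And>n. 1 \<le> n \<Longrightarrow> \<exists>w. cmod w = 1 \<and>
      \<delta> * growth ?A ^ n \<le> cmod (det (mat 1 + mat w ** matrix_power ?A n)) \<and>
      cmod (det (mat 1 + mat w ** matrix_power ?A n)) \<le> 2 ^ ?N * growth ?A ^ n \<and>
      (\<forall>x. \<forall>t\<le>n. norm (matrix_power ?A t *v x) \<le> K1 * real n ^ ?N * norm ((mat 1 + mat w ** matrix_power ?A n) *v x))"
    by (rule norm_matrix_power_le_one_plus[of ?A]) blast
  have ev: "cmod l \<le> 1" if "l \<in># proots (complex_charpoly ?L)" for l
    using stable that unfolding schur_stable_def eigenvalues_def charpoly_eq_complex_charpoly by (simp add: less_imp_le)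
  obtain K2 p where K2: "1 \<le> K2"
    and L: "\<And>n x. norm (matrix_power ?L n *v x) \<le> K2 * real (Suc n) ^ p * norm x"
    using norm_matrix_power_le_polynomial[OF ev] by metis
  have sym: "transpose J = J" and pos: "\<And>v. v \<noteq> 0 \<Longrightarrow> 0 < v \<bullet> (J *v v)"
    using J by (auto simp: positive_definite_def)
  obtain c d where c: "0 < c" and d: "0 < d"
    and cJ: "\<And>v. c * (norm v)\<^sup>2 \<le> v \<bullet> (J *v v)" and dJ: "\<And>v. v \<bullet> (J *v v) \<le> d * (norm v)\<^sup>2"
    by (rule quadratic_form_bounds[OF pos]) blast+
  define F where "F n x = vec_Re x \<bullet> (J *v vec_Re x) + vec_Im x \<bullet> (J *v vec_Im x) +
    (\<Sum>t<n. (cmod (cdot C (matrix_power ?A t *v x)))\<^sup>2) / s\<^sup>2" for n x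
  have form: "hermitian_form (complex_matrix (?J n)) x = of_real (F n x)" for n x
    by (simp add: hermitian_form_info_matrix hermitian_form_symmetric[OF sym] cdot_output_row F_def)
  have F_ge: "c * (norm x)\<^sup>2 + (\<Sum>t<n. (cmod (cdot C (matrix_power ?A t *v x)))\<^sup>2) / s\<^sup>2 \<le> F n x" for n x
    using cJ[of "vec_Re x"] cJ[of "vec_Im x"] by (simp add: F_def norm_cvec_Re_Im algebra_simps)
  have F_le: "F n x \<le> d * (norm x)\<^sup>2 + (\<Sum>t<n. (cmod (cdot C (matrix_power ?A t *v x)))\<^sup>2) / s\<^sup>2" for n x
    using dJ[of "vec_Re x"] dJ[of "vec_Im x"] by (simp add: F_def norm_cvec_Re_Im algebra_simps)
  have S0: "0 \<le> (\<Sum>t<n. (cmod (cdot C (matrix_power ?A t *v x)))\<^sup>2) / s\<^sup>2" for n x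
    by (intro divide_nonneg_nonneg sum_nonneg) auto
  have cF: "c * (norm x)\<^sup>2 \<le> F n x" for n x
    using F_ge[of x n] S0[of x n] by linarith
  have F0: "0 \<le> F n x" for n x
    using cF[of x n] c by (meson less_imp_le mult_nonneg_nonneg order.trans zero_le_power2)
  \<comment> \<open>Covers both exponents that occur: \<open>2 N + 1\<close> in \<open>upper\<close>
    and \<open>2 (p + 1)\<close> in \<open>lower\<close>.\<close>
  define m where "m = 2 * (?N + p + 1)"
  define Ka where "Ka = (d + \<gamma>\<^sup>2 / s\<^sup>2) * K1\<^sup>2"
  define Kb where "Kb = ((2 + 2 ^ p * K2) / sqrt c + 2 ^ p * K2 * norm ?b * s)\<^sup>2"
  \<comment> \<open>The 4 absorbs \<open>(2^N)^2 = 4^N\<close>, the square of the factor in the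
    upper bound for \<open>cmod (det G)\<close>.\<close>
  define K where "K = (1 + Ka + Kb) * 4"
  have Ka0: "0 \<le> Ka" and Kb0: "0 \<le> Kb" using d by (auto simp: Ka_def Kb_def)
  have upper: "F n x \<le> Ka * real n ^ m * (norm y)\<^sup>2"
    if n: "1 \<le> n" and bd: "\<And>t. t \<le> n \<Longrightarrow> norm (matrix_power ?A t *v x) \<le> K1 * real n ^ ?N * norm y" for n x y
  proof -
    let ?g = "K1 * real n ^ ?N * norm y"
    have "(norm x)\<^sup>2 \<le> ?g\<^sup>2" using bd[of 0] by (intro power_mono) auto
    then have 1: "d * (norm x)\<^sup>2 \<le> d * ?g\<^sup>2" using d by simp
    have "(cmod (cdot C (matrix_power ?A t *v x)))\<^sup>2 \<le> (\<gamma> * ?g)\<^sup>2" if "t < n" for t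
      using order.trans[OF cdot_le mult_left_mono[OF bd \<gamma>0[unfolded \<gamma>_def]], of t] that
      by (intro power_mono) (auto simp: \<gamma>_def)
    then have "(\<Sum>t<n. (cmod (cdot C (matrix_power ?A t *v x)))\<^sup>2) \<le> (\<Sum>t<n. (\<gamma> * ?g)\<^sup>2)"
      by (intro sum_mono) auto
    then have "(\<Sum>t<n. (cmod (cdot C (matrix_power ?A t *v x)))\<^sup>2) / s\<^sup>2 \<le> n * (\<gamma> * ?g)\<^sup>2 / s\<^sup>2"
      by (intro divide_right_mono) auto
    with 1 F_le[of n x] have "F n x \<le> d * ?g\<^sup>2 + n * (\<gamma> * ?g)\<^sup>2 / s\<^sup>2" by linarith
    also have "d * ?g\<^sup>2 \<le> n * (d * ?g\<^sup>2)" using n d mult_right_mono[of 1 "real n" "d * ?g\<^sup>2"] by simp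
    also have "n * (d * ?g\<^sup>2) + n * (\<gamma> * ?g)\<^sup>2 / s\<^sup>2 = Ka * (real n ^ (2 * ?N + 1)) * (norm y)\<^sup>2"
      by (simp add: Ka_def power_mult_distrib field_simps flip: power_mult)
    also have "\<dots> \<le> Ka * real n ^ m * (norm y)\<^sup>2"
      using n Ka0 by (intro mult_right_mono mult_left_mono power_increasing) (auto simp: m_def)
    finally show ?thesis by simp
  qed
  have lower: "(norm (x + w *s (matrix_power ?A n *v x)))\<^sup>2 \<le> Kb * real n ^ m * F n x"
    if n: "1 \<le> n" and w: "cmod w = 1" for n x w
  proof -
    let ?S = "\<Sum>t<n. (cmod (cdot C (matrix_power ?A t *v x)))\<^sup>2"
    \<comment> \<open>The \<open>2 ^ p\<close> comes from \<open>Suc t \<le> 2 n\<close>, which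
      holds for \<open>t \<le> n\<close> and \<open>1 \<le> n\<close>.\<close>
    define k where "k = 2 ^ p * K2 * real n ^ p"
    have k: "norm (matrix_power ?L t *v y) \<le> k * norm y" if "t \<le> n" for t y
    proof -
      have "norm (matrix_power ?L t *v y) \<le> K2 * real (Suc t) ^ p * norm y" by (rule L)
      also have "\<dots> \<le> K2 * (2 * real n) ^ p * norm y"
        using that n K2 by (intro mult_right_mono mult_left_mono power_mono) auto
      finally show ?thesis by (simp add: k_def power_mult_distrib mult_ac)
    qed
    have k0: "0 \<le> k" using K2 by (simp add: k_def)
    \<comment> \<open>Both parts of \<open>F\<close> are used: the term from \<open>J\<close> bounds
      \<open>x\<close>, the output sum bounds each \<open>C A^t x\<close>, all by multiples of
      \<open>sqrt (F n x)\<close>.\<close>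
    have "(norm x)\<^sup>2 \<le> F n x / c" using cF[of x n] c by (simp add: pos_le_divide_eq mult.commute)
    then have nx: "norm x \<le> sqrt (F n x) / sqrt c"
      unfolding real_sqrt_divide[symmetric] by (rule real_le_rsqrt)
    have Ss: "?S \<le> s\<^sup>2 * F n x"
    proof -
      have "0 \<le> c * (norm x)\<^sup>2" using c by simp
      then have "?S / s\<^sup>2 \<le> F n x" using F_ge[of x n] by linarith
      then show ?thesis using s by (simp add: pos_divide_le_eq mult.commute)
    qed
    have "cmod (cdot C (matrix_power ?A t *v x)) \<le> s * sqrt (F n x)" if "t < n" for t
    proof -
      have "(cmod (cdot C (matrix_power ?A t *v x)))\<^sup>2 \<le> ?S"
        using that by (intro member_le_sum) auto
      then have "cmod (cdot C (matrix_power ?A t *v x)) \<le> sqrt (s\<^sup>2 * F n x)"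
        using Ss by (intro real_le_rsqrt) linarith
      then show ?thesis using s by (simp add: real_sqrt_mult)
    qed
    then have "norm (cdot C (matrix_power ?A t *v x) *s (matrix_power ?L (n - Suc t) *v ?b)) \<le> s * sqrt (F n x) * (k * norm ?b)"
      if "t < n" for t
      unfolding norm_vector_scalar using that k0 s F0 by (intro mult_mono k) auto
    then have "norm (\<Sum>t<n. cdot C (matrix_power ?A t *v x) *s (matrix_power ?L (n - Suc t) *v ?b))
        \<le> (\<Sum>t<n. s * sqrt (F n x) * (k * norm ?b))"
      by (intro sum_norm_le) auto
    moreover have "matrix_power ?A n *v x = matrix_power ?L n *v x - (\<Sum>t<n. cdot C (matrix_power ?A t *v x) *s (matrix_power ?L (n - Suc t) *v ?b))"
      by (subst closed_loop_matrix_power) simp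
    ultimately have "norm (matrix_power ?A n *v x) \<le> k * norm x + n * (s * sqrt (F n x) * (k * norm ?b))"
      using k[of n x] norm_triangle_ineq4[of "matrix_power ?L n *v x"
        "\<Sum>t<n. cdot C (matrix_power ?A t *v x) *s (matrix_power ?L (n - Suc t) *v ?b)"] by simp
    moreover have "norm (x + w *s (matrix_power ?A n *v x)) \<le> norm x + norm (matrix_power ?A n *v x)"
      using norm_triangle_ineq[of x "w *s (matrix_power ?A n *v x)"] w by (simp add: norm_vector_scalar)
    ultimately have "norm (x + w *s (matrix_power ?A n *v x)) \<le> (1 + k) * norm x + n * (s * sqrt (F n x) * (k * norm ?b))"
      by (simp add: algebra_simps)
    also have "(1 + k) * norm x \<le> (1 + k) * (sqrt (F n x) / sqrt c)"
      using nx k0 by (intro mult_left_mono) auto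
    also have "(1 + k) * (sqrt (F n x) / sqrt c) + n * (s * sqrt (F n x) * (k * norm ?b))
        = ((1 + k) / sqrt c + n * k * norm ?b * s) * sqrt (F n x)"
      by (simp add: field_simps)
    also have "\<dots> \<le> (((2 + 2 ^ p * K2) / sqrt c + 2 ^ p * K2 * norm ?b * s) * real n ^ (p + 1)) * sqrt (F n x)"
    proof (intro mult_right_mono)
      have np: "1 \<le> real n ^ (p + 1)" using n by (intro one_le_power) auto
      have "real n ^ p \<le> real n ^ (p + 1)" using n by (intro power_increasing) auto
      then have "k \<le> 2 ^ p * K2 * real n ^ (p + 1)" unfolding k_def using K2 by (intro mult_left_mono) auto
      with np have "1 + k \<le> (2 + 2 ^ p * K2) * real n ^ (p + 1)" by (simp add: algebra_simps)
      then have "(1 + k) / sqrt c \<le> (2 + 2 ^ p * K2) * real n ^ (p + 1) / sqrt c"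
        using c by (intro divide_right_mono) auto
      then show "(1 + k) / sqrt c + n * k * norm ?b * s \<le>
          ((2 + 2 ^ p * K2) / sqrt c + 2 ^ p * K2 * norm ?b * s) * real n ^ (p + 1)"
        by (simp add: k_def algebra_simps)
    qed (use F0 in auto)
    finally have "(norm (x + w *s (matrix_power ?A n *v x)))\<^sup>2 \<le>
      ((((2 + 2 ^ p * K2) / sqrt c + 2 ^ p * K2 * norm ?b * s) * real n ^ (p + 1)) * sqrt (F n x))\<^sup>2"
      by (intro power_mono) auto
    also have "\<dots> = Kb * real n ^ (2 * (p + 1)) * F n x"
      using F0[of n x] by (simp only: power_mult_distrib Kb_def real_sqrt_pow2 flip: power_mult) (simp add: mult.commute)
    also have "\<dots> \<le> Kb * real n ^ m * F n x"
      using n Kb0 F0 by (intro mult_right_mono mult_left_mono power_increasing) (auto simp: m_def)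
    finally show ?thesis .
  qed
  show thesis
  proof (rule that[of K "\<delta>\<^sup>2" m])
    show "1 \<le> K" "0 < \<delta>\<^sup>2" using Ka0 Kb0 \<delta> by (auto simp: K_def)
    fix n :: nat assume n: "1 \<le> n"
    from ex[OF n] obtain w where w: "cmod w = 1"
      and dl: "\<delta> * growth ?A ^ n \<le> cmod (det (mat 1 + mat w ** matrix_power ?A n))"
      and du: "cmod (det (mat 1 + mat w ** matrix_power ?A n)) \<le> 2 ^ ?N * growth ?A ^ n"
      and bd: "\<And>x t. t \<le> n \<Longrightarrow>
        norm (matrix_power ?A t *v x) \<le> K1 * real n ^ ?N * norm ((mat 1 + mat w ** matrix_power ?A n) *v x)"
      by blast
    define G where "G = mat 1 + mat w ** matrix_power ?A n"
    have Gx: "G *v x = x + w *s (matrix_power ?A n *v x)" for x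
      by (simp only: G_def one_plus_matrix_power_vector)
    define H where "H = (\<chi> i j. cnj (G $ j $ i))"
    have HG: "hermitian_form (H ** G) x = of_real ((norm (G *v x))\<^sup>2)" for x
      unfolding H_def by (rule norm_square_hermitian_form)
    have dHG: "cmod (det (H ** G)) = (cmod (det G))\<^sup>2"
      unfolding H_def by (rule norm_square_hermitian_form)
    have dJn: "cmod (det (complex_matrix (?J n))) = \<bar>det (?J n)\<bar>"
      by (simp add: det_complex_matrix)
    have lo: "cmod (hermitian_form (H ** G) x) \<le> Kb * real n ^ m * cmod (hermitian_form (complex_matrix (?J n)) x)" for x
      using lower[OF n w, of x] F0[of n x] by (simp add: HG form Gx norm_power)
    have up: "cmod (hermitian_form (complex_matrix (?J n)) x) \<le> Ka * real n ^ m * cmod (hermitian_form (H ** G) x)" for x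
      using upper[OF n bd[folded G_def], of x] F0[of n x] by (simp add: HG form norm_power)
    have nzJ: "hermitian_form (complex_matrix (?J n)) x \<noteq> 0" if "x \<noteq> 0" for x
    proof -
      have "0 < c * (norm x)\<^sup>2" using c that by simp
      also have "\<dots> \<le> F n x" by (rule cF)
      finally show ?thesis by (simp add: form)
    qed
    have nzG: "hermitian_form (H ** G) x \<noteq> 0" if "x \<noteq> 0" for x
      using bd[folded G_def, of 0 x] that by (auto simp: HG)
    have g0: "0 \<le> growth ?A" using growth_ge_1[of ?A] by simp
    have KaK: "Ka * real n ^ m * 4 \<le> K * real n ^ m" and KbK: "Kb * real n ^ m \<le> K * real n ^ m"
      unfolding K_def using Ka0 Kb0 by (auto intro!: mult_right_mono simp: algebra_simps)
    have "\<delta>\<^sup>2 * growth ?A ^ (2 * n) = (\<delta> * growth ?A ^ n)\<^sup>2"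
      by (simp add: power_mult_distrib power_even_eq)
    also have "\<dots> \<le> (cmod (det G))\<^sup>2"
      using dl \<delta> g0 by (intro power_mono) (auto simp: G_def)
    also have "\<dots> \<le> (Kb * real n ^ m) ^ ?N * \<bar>det (?J n)\<bar>"
      unfolding dHG[symmetric] dJn[symmetric] by (rule det_le_of_form_le, rule lo, rule nzJ)
    also have "\<dots> \<le> (K * real n ^ m) ^ ?N * \<bar>det (?J n)\<bar>"
      using Kb0 by (intro mult_right_mono[OF power_mono[OF KbK]]) auto
    finally show "\<delta>\<^sup>2 * growth ?A ^ (2 * n) \<le> (K * real n ^ m) ^ ?N * \<bar>det (?J n)\<bar>" .
    have "\<bar>det (?J n)\<bar> \<le> (Ka * real n ^ m) ^ ?N * (cmod (det G))\<^sup>2"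
      unfolding dHG[symmetric] dJn[symmetric] by (rule det_le_of_form_le, rule up, rule nzG)
    also have "\<dots> \<le> (Ka * real n ^ m) ^ ?N * (2 ^ ?N * growth ?A ^ n)\<^sup>2"
      using du Ka0 by (intro mult_left_mono power_mono) (auto simp: G_def)
    also have "\<dots> = (Ka * real n ^ m * 4) ^ ?N * growth ?A ^ (2 * n)"
      by (simp add: power_mult_distrib power_even_eq) (simp add: power2_eq_square flip: power_mult_distrib)
    also have "\<dots> \<le> (K * real n ^ m) ^ ?N * growth ?A ^ (2 * n)"
      using Ka0 g0 by (intro mult_right_mono[OF power_mono[OF KaK]]) auto
    finally show "\<bar>det (?J n)\<bar> \<le> (K * real n ^ m) ^ ?N * growth ?A ^ (2 * n)" .
  qed
qed


text \<open>The logarithm of the polynomial factor is \<open>e n\<close>, of order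
  \<open>ln n\<close>, so it disappears after division by \<open>n\<close>. The 2 arises because
  \<open>J(n)\<close> is compared with \<open>G^* G\<close> rather than \<open>G\<close>.\<close>

lemma ln_det_info_matrix_rate:
  fixes A J :: "real^'n^'n" and B C :: "real^'n"
  assumes "schur_stable (closed_loop_matrix A B C)" "positive_definite J" "0 < s"
  shows "(\<lambda>n. ln \<bar>det (info_matrix s J (output_row A C) n)\<bar> / real n)
    \<longlonglongrightarrow> 2 * ln (growth (complex_matrix A))"
proof -
  let ?N = "CARD('n)" and ?D = "\<lambda>n. \<bar>det (info_matrix s J (output_row A C) n)\<bar>"
  define g where "g = growth (complex_matrix A)"
  obtain K \<delta> :: real and p where K: "1 \<le> K" and \<delta>: "0 < \<delta>"
    and lo: "\<And>n. 1 \<le> n \<Longrightarrow> \<delta> * g ^ (2 * n) \<le> (K * real n ^ p) ^ ?N * ?D n"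
    and up: "\<And>n. 1 \<le> n \<Longrightarrow> ?D n \<le> (K * real n ^ p) ^ ?N * g ^ (2 * n)"
    unfolding g_def by (rule det_info_matrix_bounds[OF assms]) blast
  have g: "1 \<le> g" unfolding g_def by (rule growth_ge_1)
  define e where "e n = ?N * (ln K + p * ln (real n))" for n :: nat
  have ln_poly: "ln ((K * real n ^ p) ^ ?N) = e n" if "1 \<le> n" for n
    using that K by (simp add: e_def ln_realpow ln_mult)
  have lim: "(\<lambda>n. e n / real n) \<longlonglongrightarrow> 0"
  proof -
    have "(\<lambda>n. ?N * ln K / real n + real ?N * real p * (ln (real n) / real n)) \<longlonglongrightarrow> 0 + real ?N * real p * 0"
      by (intro tendsto_intros lim_const_over_n lim_ln_over_n)
    then show ?thesis by (simp add: e_def add_divide_distrib distrib_left mult.assoc)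
  qed
  have lim2: "(\<lambda>n. ln \<delta> / real n) \<longlonglongrightarrow> 0" by (rule lim_const_over_n)
  show ?thesis
    unfolding g_def[symmetric]
  proof (rule tendsto_sandwich)
    have "2 * ln g + ln \<delta> / n - e n / n \<le> ln (?D n) / n \<and> ln (?D n) / n \<le> 2 * ln g + e n / n" if n: "1 \<le> n" for n
    proof -
      have Kn: "0 < K * real n ^ p" using K n by simp
      have gn: "0 < \<delta> * g ^ (2 * n)" using \<delta> g by simp
      then have D: "0 < ?D n" using lo[OF n] Kn
        by (smt (verit) mult_nonneg_nonpos zero_le_power)
      have "ln (\<delta> * g ^ (2 * n)) \<le> ln ((K * real n ^ p) ^ ?N * ?D n)"
        using lo[OF n] gn by (intro ln_mono) auto
      moreover have "ln (\<delta> * g ^ (2 * n)) = ln \<delta> + 2 * n * ln g"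
        using \<delta> g by (subst ln_mult_pos) (auto simp: ln_realpow)
      moreover have "ln ((K * real n ^ p) ^ ?N * ?D n) = e n + ln (?D n)"
        using Kn D ln_mult_pos[OF zero_less_power[OF Kn] D] ln_poly[OF n] by simp
      ultimately have 1: "ln \<delta> + 2 * n * ln g \<le> e n + ln (?D n)" by simp
      have "ln (?D n) \<le> ln ((K * real n ^ p) ^ ?N * g ^ (2 * n))"
        using up[OF n] D by (intro ln_mono) auto
      also have "\<dots> = e n + ln (g ^ (2 * n))"
        using ln_mult_pos[OF zero_less_power[OF Kn], of "g ^ (2 * n)" ?N] ln_poly[OF n] g by simp
      finally have 2: "ln (?D n) \<le> e n + 2 * n * ln g" using g by (simp add: ln_realpow)
      have "(ln \<delta> + 2 * n * ln g - e n) / n \<le> ln (?D n) / n"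
        using 1 by (intro divide_right_mono) auto
      moreover have "ln (?D n) / n \<le> (e n + 2 * n * ln g) / n"
        using 2 by (intro divide_right_mono) auto
      ultimately show ?thesis
        using n by (simp add: add_divide_distrib diff_divide_distrib)
    qed
    then show "\<forall>\<^sub>F n in sequentially. 2 * ln g + ln \<delta> / n - e n / n \<le> ln (?D n) / n"
      "\<forall>\<^sub>F n in sequentially. ln (?D n) / n \<le> 2 * ln g + e n / n"
      by (auto simp: eventually_sequentially intro!: exI[of _ 1])
    show "(\<lambda>n. 2 * ln g + ln \<delta> / real n - e n / real n) \<longlonglongrightarrow> 2 * ln g"
      using tendsto_diff[OF tendsto_add[OF tendsto_const lim2] lim, of "2 * ln g"] by simp
    show "(\<lambda>n. 2 * ln g + e n / real n) \<longlonglongrightarrow> 2 * ln g"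
      using tendsto_add[OF tendsto_const lim, of "2 * ln g"] by simp
  qed
qed

lemma ln_growth: "ln (growth M) = (\<Sum>l\<in>#proots (complex_charpoly M). ln (max 1 (cmod l)))"
proof -
  have "ln (\<Prod>l\<in>#E. max 1 (cmod l)) = (\<Sum>l\<in>#E. ln (max 1 (cmod l))) \<and> 0 < (\<Prod>l\<in>#E. max 1 (cmod l))" for E
    by (induction E) (auto simp: ln_mult zero_less_mult_iff)
  then show ?thesis by (simp add: growth_def)
qed

section \<open>Jensen's formula for linear factors\<close>

text \<open>The mean value property at 0: \<open>1 - l * z\<close> has positive real part on the
  closed disc, so its principal logarithm is holomorphic there, with value 0 at the centre.\<close>

lemma has_integral_ln_cmod_one_minus:
  assumes "cmod l < 1"
  shows "((\<lambda>x. ln (cmod (1 - l * cis (2 * pi * x)))) has_integral 0) {0..1}"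
proof -
  have pos: "0 < Re (1 - l * z)" if "cmod z \<le> 1" for z
  proof -
    have "Re (l * z) \<le> cmod l * cmod z" using complex_Re_le_cmod[of "l * z"] by (simp add: norm_mult)
    also have "\<dots> \<le> cmod l" using that by (simp add: mult_left_le)
    finally show ?thesis using assms by simp
  qed
  have "(\<lambda>z. Ln (1 - l * z)) holomorphic_on cball 0 1"
    using pos by (intro holomorphic_intros) (force simp: complex_nonpos_Reals_iff)
  from Cauchy_integral_circlepath_simple[OF this, of 0]
  have "((\<lambda>z. Ln (1 - l * z) / z) has_contour_integral 0) (circlepath 0 1)" by simp
  then have "((\<lambda>x. Ln (1 - l * cis (2 * pi * x)) * (2 * pi * \<i>)) has_integral 0) {0..1}"
    unfolding has_contour_integral_def
  proof (rule has_integral_eq[rotated])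
    fix x :: real assume "x \<in> {0..1}"
    then have "vector_derivative (circlepath 0 1) (at x within {0..1}) = 2 * pi * \<i> * cis (2 * pi * x)"
      by (subst vector_derivative_circlepath01) (auto simp: cis_conv_exp mult_ac)
    moreover have "circlepath 0 1 x = cis (2 * pi * x)" by (simp add: circlepath cis_conv_exp mult_ac)
    ultimately show "Ln (1 - l * circlepath 0 1 x) / circlepath 0 1 x *
        vector_derivative (circlepath 0 1) (at x within {0..1}) = Ln (1 - l * cis (2 * pi * x)) * (2 * pi * \<i>)"
      by simp
  qed
  from has_integral_mult_left[OF this, of "1 / (2 * pi * \<i>)"]
  have "((\<lambda>x. Ln (1 - l * cis (2 * pi * x))) has_integral 0) {0..1}" by simp
  from has_integral_linear[OF this bounded_linear_Re]
  have "((\<lambda>x. Re (Ln (1 - l * cis (2 * pi * x)))) has_integral 0) {0..1}" by (simp add: o_def)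
  moreover have "1 - l * cis (2 * pi * x) \<noteq> 0" for x
    using pos[of "cis (2 * pi * x)"] by force
  ultimately show ?thesis by simp
qed

lemma integral_ln_cmod_cis_minus_lt:
  assumes "cmod l < 1"
  shows "set_integrable lborel {-1/2..1/2} (\<lambda>\<theta>. ln (cmod (cis (2 * pi * \<theta>) - l)))"
    and "(LBINT \<theta>:{-1/2..1/2}. ln (cmod (cis (2 * pi * \<theta>) - l))) = 0"
proof -
  have eq: "cmod (cis t - l) = cmod (1 - cnj l * cis t)" for t
  proof -
    have "cmod (cis t - l) = cmod (cnj (cis t - l) * cis t)" by (simp only: norm_mult complex_mod_cnj norm_cis mult_1_right)
    also have "cnj (cis t - l) * cis t = 1 - cnj l * cis t" by (simp add: algebra_simps cis_cnj cis_mult)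
    finally show ?thesis .
  qed
  have nz: "cis t - l \<noteq> 0" for t using assms norm_cis[of t] by auto
  have cont: "continuous_on A (\<lambda>\<theta>. ln (cmod (cis (2 * pi * \<theta>) - l)))" for A
    using nz by (intro continuous_intros continuous_on_cis) auto
  show int: "set_integrable lborel {-1/2..1/2} (\<lambda>\<theta>. ln (cmod (cis (2 * pi * \<theta>) - l)))"
    unfolding set_integrable_def using borel_integrable_atLeastAtMost'[OF cont] by (simp add: set_integrable_def)
  have "(LBINT \<theta>:{-1/2..1/2}. ln (cmod (cis (2 * pi * \<theta>) - l)))
      = integral {-1/2..1/2} (\<lambda>\<theta>. ln (cmod (cis (2 * pi * \<theta>) - l)))"
    by (rule set_borel_integral_eq_integral(2)[OF int])
  \<comment> \<open>Shifting the interval by one half changes the sign of \<open>cis\<close>, which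
    is absorbed by passing from \<open>cnj l\<close> to \<open>- cnj l\<close>.\<close>
  also have "\<dots> = integral {-1/2 - (-1/2)..1/2 - (-1/2)} (\<lambda>x. ln (cmod (cis (2 * pi * (x + (-1/2))) - l)))"
    by (rule integral_shift_real_ivl[symmetric])
  also have "\<dots> = integral {0..1} (\<lambda>x. ln (cmod (1 - (- cnj l) * cis (2 * pi * x))))"
  proof -
    have "cis (2 * pi * (x + (-1/2))) = - cis (2 * pi * x)" for x
      by (simp add: complex_eq_iff right_diff_distrib cos_diff sin_diff)
    then have "cmod (cis (2 * pi * (x + (-1/2))) - l) = cmod (1 - (- cnj l) * cis (2 * pi * x))" for x
      by (subst eq) (use \<open>cis (2 * pi * (x + (-1/2))) = - cis (2 * pi * x)\<close> in simp)
    then show ?thesis by (simp only:) simp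
  qed
  also have "\<dots> = 0"
    using has_integral_ln_cmod_one_minus[of "- cnj l"] assms by (intro integral_unique) simp
  finally show "(LBINT \<theta>:{-1/2..1/2}. ln (cmod (cis (2 * pi * \<theta>) - l))) = 0" .
qed

lemma AE_cis_neq:
  "AE \<theta> in restrict_space lborel {-1/2..1/2}. cis (2 * pi * \<theta>) \<noteq> l"
proof -
  \<comment> \<open>\<open>Arg\<close> takes values in the half-open interval from
    \<open>- pi\<close> to \<open>pi\<close>, so it accounts for every angle except the left
    endpoint.\<close>
  have "{\<theta>\<in>{-1/2..1/2}. cis (2 * pi * \<theta>) = l} \<subseteq> {-1/2, Arg l / (2 * pi)}"
  proof
    fix \<theta> :: real assume "\<theta> \<in> {\<theta>\<in>{-1/2..1/2}. cis (2 * pi * \<theta>) = l}"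
    then have \<theta>: "-1/2 \<le> \<theta>" "\<theta> \<le> 1/2" "cis (2 * pi * \<theta>) = l" by auto
    show "\<theta> \<in> {-1/2, Arg l / (2 * pi)}"
    proof (cases "\<theta> = -1/2")
      case False
      have "sgn l = cis (2 * pi * \<theta>)" using \<theta>(3) by (metis sgn_cis)
      moreover have "- pi < 2 * pi * \<theta>" using False \<theta> mult_strict_left_mono[of "-1/2" \<theta> "2 * pi"] by simp
      moreover have "2 * pi * \<theta> \<le> pi" using \<theta> by simp
      ultimately have "Arg l = 2 * pi * \<theta>" by (rule cis_Arg_unique)
      then show ?thesis by simp
    qed simp
  qed
  then have "finite {\<theta>\<in>{-1/2..1/2}. cis (2 * pi * \<theta>) = l}" by (rule finite_subset) simp
  then have "AE \<theta> in lborel. \<theta> \<notin> {\<theta>\<in>{-1/2..1/2}. cis (2 * pi * \<theta>) = l}"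
    by (intro AE_not_in finite_imp_null_set_lborel)
  then show ?thesis by (subst AE_restrict_space_iff) auto
qed

text \<open>The integrand has a logarithmic singularity on the path. Replacing \<open>l\<close> by
  \<open>r k * l\<close> inside the disc makes each integral 0, and up to the constant
  \<open>ln 2\<close> the approximants are dominated by the limit function itself.\<close>

lemma integral_ln_cmod_cis_minus_eq:
  assumes l: "cmod l = 1"
  shows "set_integrable lborel {-1/2..1/2} (\<lambda>\<theta>. ln (cmod (cis (2 * pi * \<theta>) - l)))"
    and "(LBINT \<theta>:{-1/2..1/2}. ln (cmod (cis (2 * pi * \<theta>) - l))) = 0"
proof -
  let ?M = "restrict_space lborel {-1/2..1/2 :: real}"
  interpret finite_measure ?M by (intro finite_measureI) (simp add: emeasure_restrict_space space_restrict_space)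
  have RM: "integrable ?M f \<longleftrightarrow> set_integrable lborel {-1/2..1/2} f"
    "integral\<^sup>L ?M f = (LBINT \<theta>:{-1/2..1/2}. f \<theta>)" for f :: "real \<Rightarrow> real"
    unfolding set_integrable_def set_lebesgue_integral_def
    by (simp_all add: integrable_restrict_space integral_restrict_space)
  define f where "f = (\<lambda>\<theta>. ln (cmod (cis (2 * pi * \<theta>) - l)))"
  \<comment> \<open>The 2 keeps \<open>r k\<close> strictly between 0 and 1 already for
    \<open>k = 0\<close>.\<close>
  define r where "r k = 1 - 1 / real (k + 2)" for k
  define F where "F k \<theta> = ln (cmod (cis (2 * pi * \<theta>) - of_real (r k) * l))" for k \<theta>
  have r: "0 < r k" "r k < 1" for k by (auto simp: r_def field_simps)
  have r1: "r \<longlonglongrightarrow> 1"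
  proof -
    have "(\<lambda>k. 1 / real (k + 2)) \<longlonglongrightarrow> 0"
      using LIMSEQ_ignore_initial_segment[OF lim_const_over_n[of 1], of 2] by simp
    from tendsto_diff[OF tendsto_const this, of 1] show ?thesis by (simp add: r_def[abs_def])
  qed
  have lk: "cmod (of_real (r k) * l) < 1" for k using r[of k] l by (simp add: norm_mult)
  have intF: "integrable ?M (F k)" and F0: "integral\<^sup>L ?M (F k) = 0" for k
    using integral_ln_cmod_cis_minus_lt[OF lk] unfolding RM F_def by auto
  have [measurable]: "F k \<in> borel_measurable ?M" for k using intF by auto
  have [measurable]: "f \<in> borel_measurable ?M"
    unfolding f_def
    by (intro measurable_restrict_space1) (simp, intro borel_measurable_ln borel_measurable_continuous_onI
      continuous_intros continuous_on_cis)
  have up: "F k \<theta> \<le> ln 2" for k \<theta>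
  proof -
    have "cmod (cis (2 * pi * \<theta>) - of_real (r k) * l) \<le> 2"
      using norm_triangle_ineq4[of "cis (2 * pi * \<theta>)" "of_real (r k) * l"] lk[of k] by simp
    moreover have "cis (2 * pi * \<theta>) - of_real (r k) * l \<noteq> 0"
      using lk[of k] norm_cis[of "2 * pi * \<theta>"] by (metis eq_iff_diff_eq_0 less_irrefl)
    ultimately show ?thesis unfolding F_def by (intro ln_mono) auto
  qed
  \<comment> \<open>For \<open>c\<close> and \<open>l\<close> of modulus 1 and
    \<open>r = r k\<close>, \<open>|c - l| \<le> |c - r l| + (1 - r)\<close> and
    \<open>1 - r \<le> |c - r l|\<close>, so the distance to \<open>l\<close> is at most twice the
    distance to \<open>r l\<close>.\<close>
  have lo: "f \<theta> - ln 2 \<le> F k \<theta>" if "cis (2 * pi * \<theta>) \<noteq> l" for k \<theta>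
  proof -
    let ?c = "cis (2 * pi * \<theta>)"
    have "cmod (?c - l) \<le> cmod (?c - of_real (r k) * l) + cmod (of_real (r k) * l - l)"
      using norm_triangle_ineq[of "?c - of_real (r k) * l" "of_real (r k) * l - l"] by simp
    also have "of_real (r k) * l - l = of_real (r k - 1) * l" by (simp add: algebra_simps)
    also have "cmod \<dots> = 1 - r k" unfolding norm_mult norm_of_real using r[of k] l by simp
    also have "1 - r k \<le> cmod (?c - of_real (r k) * l)"
      using norm_triangle_ineq2[of ?c "of_real (r k) * l"] l r[of k] by (simp add: norm_mult)
    finally have "cmod (?c - l) / 2 \<le> cmod (?c - of_real (r k) * l)" by simp
    moreover have "0 < cmod (?c - l)" using that by simp
    ultimately have "ln (cmod (?c - l) / 2) \<le> F k \<theta>" unfolding F_def by (intro ln_mono) auto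
    then show ?thesis using that by (simp add: f_def ln_div)
  qed
  have lim: "(\<lambda>k. F k \<theta>) \<longlonglongrightarrow> f \<theta>" if "cis (2 * pi * \<theta>) \<noteq> l" for \<theta>
  proof -
    have "(\<lambda>k. cmod (cis (2 * pi * \<theta>) - of_real (r k) * l)) \<longlonglongrightarrow> cmod (cis (2 * pi * \<theta>) - of_real 1 * l)"
      by (intro tendsto_intros r1)
    then show ?thesis unfolding F_def f_def using that by (intro tendsto_ln) auto
  qed
  have AE: "AE \<theta> in ?M. cis (2 * pi * \<theta>) \<noteq> l" by (rule AE_cis_neq)
  \<comment> \<open>Away from the singularity this is the limit of \<open>up\<close>; at the
    singularity the default value \<open>ln 0 = 0\<close> is used.\<close>
  have upf: "f \<theta> \<le> ln 2" for \<theta>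
  proof (cases "cis (2 * pi * \<theta>) = l")
    case False
    then show ?thesis using LIMSEQ_le_const2[OF lim[OF False]] up by auto
  qed (simp add: f_def)
  (* Fatou for ln 2 - F k >= 0 gives integrability without analysing the singularity. *)
  have "(\<integral>\<^sup>+\<theta>. ennreal (ln 2 - f \<theta>) \<partial>?M) = (\<integral>\<^sup>+\<theta>. liminf (\<lambda>k. ennreal (ln 2 - F k \<theta>)) \<partial>?M)"
  proof (rule nn_integral_cong_AE, use AE in eventually_elim)
    fix \<theta> assume "cis (2 * pi * \<theta>) \<noteq> l"
    then have "(\<lambda>k. ennreal (ln 2 - F k \<theta>)) \<longlonglongrightarrow> ennreal (ln 2 - f \<theta>)"
      by (intro tendsto_intros lim)
    then show "ennreal (ln 2 - f \<theta>) = liminf (\<lambda>k. ennreal (ln 2 - F k \<theta>))"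
      by (simp add: lim_imp_Liminf)
  qed
  also have "\<dots> \<le> liminf (\<lambda>k. \<integral>\<^sup>+\<theta>. ennreal (ln 2 - F k \<theta>) \<partial>?M)"
    by (intro nn_integral_liminf) measurable
  also have "(\<lambda>k. \<integral>\<^sup>+\<theta>. ennreal (ln 2 - F k \<theta>) \<partial>?M) = (\<lambda>k. ennreal (\<integral>\<theta>. ln 2 - F k \<theta> \<partial>?M))"
    using up by (intro ext nn_integral_eq_integral Bochner_Integration.integrable_diff integrable_const intF AE_I2) simp
  also have "liminf \<dots> < \<infinity>"
    by (simp only: Bochner_Integration.integral_diff[OF integrable_const intF] F0) (simp add: Liminf_const)
  finally have fin: "(\<integral>\<^sup>+\<theta>. ennreal (ln 2 - f \<theta>) \<partial>?M) < \<infinity>" .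
  have "(\<lambda>\<theta>. ln 2 - f \<theta>) \<in> borel_measurable ?M" by measurable
  then have "integrable ?M (\<lambda>\<theta>. ln 2 - f \<theta>)"
    by (rule integrableI_nonneg) (use upf fin in auto)
  then have intf: "integrable ?M f"
    using Bochner_Integration.integrable_diff[OF integrable_const[of "ln 2"], of "\<lambda>\<theta>. ln 2 - f \<theta>"] by simp
  then show "set_integrable lborel {-1/2..1/2} (\<lambda>\<theta>. ln (cmod (cis (2 * pi * \<theta>) - l)))"
    unfolding RM f_def .
  have "(\<lambda>k. integral\<^sup>L ?M (F k)) \<longlonglongrightarrow> integral\<^sup>L ?M f"
  proof (rule integral_dominated_convergence[where w="\<lambda>\<theta>. ln 2 + \<bar>f \<theta>\<bar>"])
    show "AE \<theta> in ?M. (\<lambda>k. F k \<theta>) \<longlonglongrightarrow> f \<theta>"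
      using AE by eventually_elim (rule lim)
    show "AE \<theta> in ?M. norm (F k \<theta>) \<le> ln 2 + \<bar>f \<theta>\<bar>" for k
      using AE
    proof eventually_elim
      case (elim \<theta>)
      show ?case using up[of k \<theta>] lo[OF elim, of k] ln_ge_zero[of 2] unfolding real_norm_def abs_le_iff by linarith
    qed
    show "integrable ?M (\<lambda>\<theta>. ln 2 + \<bar>f \<theta>\<bar>)"
      by (intro Bochner_Integration.integrable_add integrable_const integrable_abs intf)
  qed measurable
  then have "(\<lambda>k. 0 :: real) \<longlonglongrightarrow> integral\<^sup>L ?M f" unfolding F0 .
  then have "integral\<^sup>L ?M f = 0" by (rule LIMSEQ_unique[OF _ tendsto_const])
  then show "(LBINT \<theta>:{-1/2..1/2}. ln (cmod (cis (2 * pi * \<theta>) - l))) = 0"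
    unfolding RM f_def .
qed

lemma
  shows set_integrable_ln_cmod_cis_minus:
      "set_integrable lborel {-1/2..1/2} (\<lambda>\<theta>. ln (cmod (cis (2 * pi * \<theta>) - l)))" (is ?int)
    and integral_ln_cmod_cis_minus:
      "(LBINT \<theta>:{-1/2..1/2}. ln (cmod (cis (2 * pi * \<theta>) - l))) = ln (max 1 (cmod l))" (is ?eq)
proof -
  have "?int \<and> ?eq"
  proof (cases "cmod l \<le> 1")
    case True
    then show ?thesis
      using integral_ln_cmod_cis_minus_lt[of l] integral_ln_cmod_cis_minus_eq[of l]
      by (cases "cmod l = 1") auto
  next
    case False
    \<comment> \<open>A point outside the disc is reflected in the unit circle:
      \<open>|cis t - l| = |l| |cis t - 1 / cnj l|\<close>. The constant factor supplies
      \<open>ln (cmod l)\<close>, the reflected point contributes 0.\<close>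
    let ?k = "1 / cnj l"
    have k: "cmod ?k < 1" using False by (simp add: norm_divide divide_less_eq)
    have l0: "l \<noteq> 0" using False by auto
    have "cmod (cis t - l) = cmod l * cmod (cis t - ?k)" for t
    proof -
      have "cmod (cis t - l) = cmod (cnj (cis t - l) * cis t)" by (simp only: norm_mult complex_mod_cnj norm_cis mult_1_right)
      also have "cnj (cis t - l) * cis t = - cnj l * (cis t - ?k)"
        using l0 by (simp add: algebra_simps cis_cnj cis_mult)
      finally show ?thesis by (simp add: norm_mult)
    qed
    moreover have "cis t - ?k \<noteq> 0" for t using k norm_cis[of t] by (metis eq_iff_diff_eq_0 less_irrefl)
    ultimately have eq: "ln (cmod (cis t - l)) = ln (cmod l) + ln (cmod (cis t - ?k))" for t
      using l0 by (simp add: ln_mult)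
    have c: "set_integrable lborel {-1/2..1/2 :: real} (\<lambda>_. ln (cmod l))"
      by (intro borel_integrable_atLeastAtMost') auto
    have cint: "(LBINT \<theta>:{-1/2..1/2 :: real}. ln (cmod l)) = ln (cmod l)"
      by (simp add: set_integral_const)
    show ?thesis
      unfolding eq using set_integral_add[OF c integral_ln_cmod_cis_minus_lt(1)[OF k]]
        integral_ln_cmod_cis_minus_lt(2)[OF k] False cint by (auto simp: max_def)
  qed
  then show ?int ?eq by auto
qed

section \<open>Gaussian kernels\<close>

lemma transpose_eq_iff_inner:
  fixes S :: "real^'n^'n"
  shows "transpose S = S \<longleftrightarrow> (\<forall>x y. x \<bullet> (S *v y) = (S *v x) \<bullet> y)"
proof
  assume "transpose S = S"
  then show "\<forall>x y. x \<bullet> (S *v y) = (S *v x) \<bullet> y"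
    by (metis dot_lmul_matrix transpose_matrix_vector)
next
  assume *: "\<forall>x y. x \<bullet> (S *v y) = (S *v x) \<bullet> y"
  have "axis i 1 \<bullet> (S *v axis j 1) = S $ i $ j" "(S *v axis i 1) \<bullet> axis j 1 = S $ j $ i" for i j
    by (simp_all add: inner_axis' inner_axis matrix_vector_mult_basis column_def)
  then show "transpose S = S" using * by (simp add: transpose_def vec_eq_iff)
qed

lemma positive_definite_invertible:
  fixes S :: "real^'n^'n"
  assumes "positive_definite S"
  shows "invertible S" and "S *v (matrix_inv S *v x) = x" and "det S \<noteq> 0"
proof -
  have "inj ((*v) S)"
  proof (rule injI)
    fix x y assume "S *v x = S *v y"
    then have "(x - y) \<bullet> (S *v (x - y)) = 0" by (simp add: matrix_vector_mult_diff_distrib)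
    then show "x = y" using assms by (metis eq_iff_diff_eq_0 less_irrefl positive_definite_def)
  qed
  then show "det S \<noteq> 0"
    by (metis det_nz_iff_inj_gen matrix_of_matrix_vector_mul matrix_vector_mul_linear_gen)
  then show "invertible S" by (simp add: invertible_det_nz)
  then show "S *v (matrix_inv S *v x) = x"
    by (simp add: matrix_vector_mul_assoc invertible_matrix_inv)
qed

lemma positive_definite_matrix_inv:
  fixes S :: "real^'n^'n"
  assumes S: "positive_definite S"
  shows "positive_definite (matrix_inv S)"
proof -
  note inv = positive_definite_invertible(2)[OF S]
  have sym: "x \<bullet> (S *v y) = (S *v x) \<bullet> y" for x y
    using S by (auto simp: positive_definite_def transpose_eq_iff_inner)
  have "x \<bullet> (matrix_inv S *v y) = (matrix_inv S *v x) \<bullet> y" for x y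
    using sym[of "matrix_inv S *v x" "matrix_inv S *v y"] by (simp add: inv)
  moreover have "0 < x \<bullet> (matrix_inv S *v x)" if "x \<noteq> 0" for x
  proof -
    have "matrix_inv S *v x \<noteq> 0" using inv[of x] that by auto
    then have "0 < (matrix_inv S *v x) \<bullet> (S *v (matrix_inv S *v x))"
      using S by (simp add: positive_definite_def)
    then show ?thesis by (simp add: inv inner_commute)
  qed
  ultimately show ?thesis by (simp add: positive_definite_def transpose_eq_iff_inner)
qed

section \<open>Information matrices and the Kalman update\<close>

lemma outer_vector_mult: "(\<chi> i j. h $ i * h $ j / c) *v x = (h \<bullet> x / c) *\<^sub>R h"
  for h :: "real^'n"
  by (simp add: vec_eq_iff matrix_vector_mult_def inner_vec_def sum_divide_distrib sum_distrib_right sum_distrib_left mult_ac)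

lemma info_matrix_Suc_vector:
  "info_matrix s J h (Suc n) *v x = info_matrix s J h n *v x + (h n \<bullet> x / s\<^sup>2) *\<^sub>R h n"
  by (simp add: info_matrix_Suc matrix_vector_mult_add_rdistrib outer_vector_mult)

lemma positive_definite_info_matrix:
  assumes "positive_definite J"
  shows "positive_definite (info_matrix s J h n)"
proof (induction n)
  case (Suc n)
  then show ?case
    unfolding positive_definite_def transpose_eq_iff_inner info_matrix_Suc_vector
    by (auto simp: inner_right_distrib inner_left_distrib inner_commute intro!: add_pos_nonneg)
qed (simp add: assms)

text \<open>The noise variance plus the variance of \<open>h n \<bullet> z(0)\<close> given the
  past, the inverse information matrix being the posterior covariance of
  \<open>z(0)\<close>.\<close>

definition innovation_variance :: "real \<Rightarrow> real^'n^'n \<Rightarrow> (nat \<Rightarrow> real^'n) \<Rightarrow> nat \<Rightarrow> real" where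
  "innovation_variance s J h n = s\<^sup>2 + h n \<bullet> (matrix_inv (info_matrix s J h n) *v h n)"

lemma innovation_variance_pos:
  assumes "positive_definite J" "0 < s"
  shows "0 < innovation_variance s J h n"
proof -
  have "positive_definite (matrix_inv (info_matrix s J h n))"
    by (intro positive_definite_matrix_inv positive_definite_info_matrix assms)
  then have "0 \<le> h n \<bullet> (matrix_inv (info_matrix s J h n) *v h n)"
    by (cases "h n = 0") (auto simp: positive_definite_def less_imp_le)
  then show ?thesis using assms(2) by (simp add: innovation_variance_def add_pos_nonneg)
qed

text \<open>The determinant lemma, applied to the rank-one step from \<open>J(n)\<close> to
  \<open>J(n+1)\<close>.\<close>

lemma innovation_variance_eq_det_ratio:
  assumes "positive_definite J" "0 < s"
  shows "innovation_variance s J h n =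
    s\<^sup>2 * det (info_matrix s J h (Suc n)) / det (info_matrix s J h n)"
proof -
  let ?J = "info_matrix s J h n"
  have nz: "det ?J \<noteq> 0"
    by (intro positive_definite_invertible positive_definite_info_matrix assms)
  have "info_matrix s J h (Suc n) = ?J + (\<chi> i j. h n $ i * (h n /\<^sub>R s\<^sup>2) $ j)"
    by (simp add: info_matrix_Suc divide_inverse mult_ac)
  then have "det (info_matrix s J h (Suc n)) =
      det ?J * (1 + (\<Sum>i\<in>UNIV. (h n /\<^sub>R s\<^sup>2) $ i * (matrix_inv ?J *v h n) $ i))"
    using det_rank_one_update[OF nz, of "h n" "h n /\<^sub>R s\<^sup>2"] by (simp only:)
  also have "(\<Sum>i\<in>UNIV. (h n /\<^sub>R s\<^sup>2) $ i * (matrix_inv ?J *v h n) $ i)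
      = h n \<bullet> (matrix_inv ?J *v h n) / s\<^sup>2"
    by (simp add: inner_vec_def sum_divide_distrib divide_inverse sum_distrib_left mult_ac)
  finally show ?thesis
    using nz assms(2) by (simp add: innovation_variance_def field_simps)
qed

definition kalman_gain :: "real \<Rightarrow> real^'n^'n \<Rightarrow> (nat \<Rightarrow> real^'n) \<Rightarrow> nat \<Rightarrow> real^'n" where
  "kalman_gain s J h n =
    (matrix_inv (info_matrix s J h n) *v h n) /\<^sub>R innovation_variance s J h n"

text \<open>Bayes' rule in the exponent, with state and observation centred at their predictions. On
  the left stand likelihood and prior, on the right the marginal of \<open>y\<close> and the
  posterior of \<open>v\<close>, recentred by the gain.\<close>

lemma kalman_complete_square:
  fixes J :: "real^'n^'n"
  assumes "positive_definite J" "0 < s"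
  shows "(y - h n \<bullet> v)\<^sup>2 / s\<^sup>2 + v \<bullet> (info_matrix s J h n *v v) =
    y\<^sup>2 / innovation_variance s J h n +
    (v - y *\<^sub>R kalman_gain s J h n) \<bullet> (info_matrix s J h (Suc n) *v (v - y *\<^sub>R kalman_gain s J h n))"
proof -
  let ?J = "info_matrix s J h n"
  have pd: "positive_definite ?J" by (intro positive_definite_info_matrix assms)
  have sym: "x \<bullet> (?J *v y) = (?J *v x) \<bullet> y" for x y
    using pd by (auto simp: positive_definite_def transpose_eq_iff_inner)
  define q where "q = matrix_inv ?J *v h n"
  define a where "a = h n \<bullet> q"
  define S where "S = innovation_variance s J h n"
  \<comment> \<open>With \<open>X\<close> as variable, \<open>y = X (s^2 + a)\<close> and the shift
    by the gain is \<open>X q\<close>, where \<open>J(n) q = h n\<close>. The inverse matrix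
    disappears, and an identity of polynomials remains.\<close>
  define X where "X = y / S"
  have S: "S = s\<^sup>2 + a" by (simp add: S_def innovation_variance_def a_def q_def)
  have S0: "S > 0" unfolding S_def by (intro innovation_variance_pos assms)
  have Jq: "?J *v q = h n" unfolding q_def by (rule positive_definite_invertible(2)[OF pd])
  have k: "y *\<^sub>R kalman_gain s J h n = X *\<^sub>R q"
    by (simp add: kalman_gain_def X_def S_def q_def divide_inverse)
  have "(v - X *\<^sub>R q) \<bullet> (info_matrix s J h (Suc n) *v (v - X *\<^sub>R q))
      = (v - X *\<^sub>R q) \<bullet> (?J *v (v - X *\<^sub>R q)) + (h n \<bullet> (v - X *\<^sub>R q))\<^sup>2 / s\<^sup>2"
    by (simp add: info_matrix_Suc_vector inner_right_distrib inner_commute power2_eq_square)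
  also have "?J *v (v - X *\<^sub>R q) = ?J *v v - X *\<^sub>R h n"
    by (simp add: matrix_vector_mult_diff_distrib matrix_vector_mult_scaleR Jq)
  also have "(v - X *\<^sub>R q) \<bullet> (?J *v v - X *\<^sub>R h n) = v \<bullet> (?J *v v) - 2 * X * (h n \<bullet> v) + X\<^sup>2 * a"
    using sym[of q v] by (simp add: inner_diff_left inner_diff_right Jq a_def inner_commute algebra_simps power2_eq_square)
  also have "h n \<bullet> (v - X *\<^sub>R q) = h n \<bullet> v - X * a"
    by (simp add: inner_diff_right a_def)
  finally have 1: "(v - X *\<^sub>R q) \<bullet> (info_matrix s J h (Suc n) *v (v - X *\<^sub>R q)) =
    v \<bullet> (?J *v v) - 2 * X * (h n \<bullet> v) + X\<^sup>2 * a + (h n \<bullet> v - X * a)\<^sup>2 / s\<^sup>2" .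
  have y: "y = X * (s\<^sup>2 + a)" using S0 S by (simp add: X_def)
  have 2: "y\<^sup>2 / S = X\<^sup>2 * S" using S0 by (simp add: X_def power2_eq_square)
  have s: "s\<^sup>2 \<noteq> 0" using assms by simp
  have "(y - H)\<^sup>2 = s\<^sup>2 * (X\<^sup>2 * s\<^sup>2 + 2 * X * (X * a - H)) + (H - X * a)\<^sup>2" for H
    unfolding y by (simp add: power2_eq_square algebra_simps)
  then have 3: "(y - H)\<^sup>2 / s\<^sup>2 = X\<^sup>2 * s\<^sup>2 + 2 * X * (X * a - H) + (H - X * a)\<^sup>2 / s\<^sup>2" for H
    using s by (simp add: add_divide_distrib)
  show ?thesis
    unfolding k 1 S_def[symmetric] 2 3 unfolding S by (simp add: algebra_simps power2_eq_square)
qed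

text \<open>The factor \<open>S / s\<close> exchanges the normalisation of the noise density for
  that of the innovation density.\<close>

lemma normal_density_mult_gaussian:
  fixes J :: "real^'n^'n" and h :: "nat \<Rightarrow> real^'n" and n :: nat
  assumes J: "positive_definite J" and s: "0 < s"
  defines "S \<equiv> sqrt (innovation_variance s J h n)"
  shows "normal_density (h n \<bullet> v) s y * exp (- (v \<bullet> (info_matrix s J h n *v v)) / 2) =
    normal_density 0 S y * (S / s * exp (- ((v - y *\<^sub>R kalman_gain s J h n) \<bullet>
      (info_matrix s J h (Suc n) *v (v - y *\<^sub>R kalman_gain s J h n))) / 2))"
proof -
  have S: "0 < S" "S\<^sup>2 = innovation_variance s J h n"
    using innovation_variance_pos[OF J s, of h n] by (auto simp: S_def)
  have "normal_density (h n \<bullet> v) s y * exp (- (v \<bullet> (info_matrix s J h n *v v)) / 2) =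
     1 / sqrt (2 * pi * s\<^sup>2) * exp (- ((y - h n \<bullet> v)\<^sup>2 / s\<^sup>2 + v \<bullet> (info_matrix s J h n *v v)) / 2)"
    by (simp add: normal_density_def mult.assoc flip: exp_add)
  also have "1 / sqrt (2 * pi * s\<^sup>2) = 1 / sqrt (2 * pi * S\<^sup>2) * (S / s)"
    using S(1) s by (simp add: real_sqrt_mult)
  also have "exp (- ((y - h n \<bullet> v)\<^sup>2 / s\<^sup>2 + v \<bullet> (info_matrix s J h n *v v)) / 2) =
      exp (- (y - 0)\<^sup>2 / (2 * S\<^sup>2)) * exp (- ((v - y *\<^sub>R kalman_gain s J h n) \<bullet>
        (info_matrix s J h (Suc n) *v (v - y *\<^sub>R kalman_gain s J h n))) / 2)"
    unfolding kalman_complete_square[OF J s] S(2)[symmetric]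
    by (simp add: diff_divide_distrib mult.commute flip: exp_add)
  finally show ?thesis by (simp only: normal_density_def mult_ac)
qed

text \<open>The density of the estimation error of \<open>z(0)\<close> after \<open>n\<close>
  observations. The product collects the normalising factors of the updates, so the total mass
  remains that of \<open>n = 0\<close>.\<close>

definition gaussian_kernel :: "real \<Rightarrow> real^'n^'n \<Rightarrow> (nat \<Rightarrow> real^'n) \<Rightarrow> real \<Rightarrow> nat \<Rightarrow> real^'n \<Rightarrow> real" where
  "gaussian_kernel s J h \<kappa> n v =
    \<kappa> * (\<Prod>t<n. sqrt (innovation_variance s J h t) / s) * exp (- (v \<bullet> (info_matrix s J h n *v v)) / 2)"

lemma gaussian_kernel_measurable [measurable]: "gaussian_kernel s J h \<kappa> n \<in> borel_measurable borel"
  unfolding gaussian_kernel_def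
  by (intro borel_measurable_continuous_onI continuous_intros
    bounded_linear.continuous_on[OF matrix_vector_mul_bounded_linear]) simp

lemma gaussian_kernel_nonneg:
  assumes "positive_definite J" "0 < s" "0 \<le> \<kappa>"
  shows "0 \<le> gaussian_kernel s J h \<kappa> n v"
  using assms by (auto simp: gaussian_kernel_def intro!: mult_nonneg_nonneg prod_nonneg divide_nonneg_pos
    less_imp_le[OF innovation_variance_pos])

text \<open>Likelihood times prior equals marginal times posterior.\<close>

lemma gaussian_kernel_Suc:
  assumes "positive_definite J" "0 < s"
  shows "normal_density (h n \<bullet> v) s y * gaussian_kernel s J h \<kappa> n v =
    normal_density 0 (sqrt (innovation_variance s J h n)) y *
    gaussian_kernel s J h \<kappa> (Suc n) (v - y *\<^sub>R kalman_gain s J h n)"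
  using arg_cong[OF normal_density_mult_gaussian[OF assms, of h n v y],
    of "\<lambda>r. \<kappa> * (\<Prod>t<n. sqrt (innovation_variance s J h t) / s) * r"]
  by (simp add: gaussian_kernel_def mult_ac)

lemma nn_integral_lborel_shift:
  fixes f :: "'a::euclidean_space \<Rightarrow> ennreal"
  assumes [measurable]: "f \<in> borel_measurable borel"
  shows "(\<integral>\<^sup>+x. f (x - c) \<partial>lborel) = (\<integral>\<^sup>+x. f x \<partial>lborel)"
proof -
  have "(\<integral>\<^sup>+x. f x \<partial>lborel) = (\<integral>\<^sup>+x. f x \<partial>distr lborel borel ((+) (- c)))"
    by (simp add: lborel_distr_plus)
  also have "\<dots> = (\<integral>\<^sup>+x. f (x - c) \<partial>lborel)"
    by (subst nn_integral_distr) auto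
  finally show ?thesis by simp
qed

lemma nn_integral_normal_density:
  assumes "0 < s"
  shows "(\<integral>\<^sup>+y. ennreal (normal_density m s y) \<partial>lborel) = 1"
  using prob_space.emeasure_space_1[OF prob_space_normal_density[OF assms, of m]]
  by (simp add: emeasure_density)

text \<open>Integrating Bayes' rule over \<open>y\<close> and \<open>v\<close> in both orders
  carries mass 1 from \<open>n\<close> to \<open>n + 1\<close>. No multivariate Gaussian integral is
  evaluated: the case 0 will be read off the law of \<open>z0\<close>.\<close>

lemma nn_integral_gaussian_kernel:
  assumes J: "positive_definite J" and s: "0 < s" and \<kappa>: "0 \<le> \<kappa>"
    and 0: "(\<integral>\<^sup>+v. ennreal (gaussian_kernel s J h \<kappa> 0 v) \<partial>lborel) = 1"
  shows "(\<integral>\<^sup>+v. ennreal (gaussian_kernel s J h \<kappa> n v) \<partial>lborel) = 1"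
proof (induction n)
  case (Suc n)
  let ?g = "gaussian_kernel s J h \<kappa>" and ?S = "sqrt (innovation_variance s J h n)"
  let ?k = "kalman_gain s J h n"
  note nn = gaussian_kernel_nonneg[OF J s \<kappa>]
  have S: "0 < ?S" using innovation_variance_pos[OF J s] by simp
  have "1 = (\<integral>\<^sup>+v. ennreal (?g n v) * (\<integral>\<^sup>+y. ennreal (normal_density (h n \<bullet> v) s y) \<partial>lborel) \<partial>lborel)"
    using Suc by (simp add: nn_integral_normal_density s)
  also have "\<dots> = (\<integral>\<^sup>+v. \<integral>\<^sup>+y. ennreal (normal_density (h n \<bullet> v) s y * ?g n v) \<partial>lborel \<partial>lborel)"
    by (simp add: ennreal_mult' nn mult.commute flip: nn_integral_cmult)
  also have "\<dots> = (\<integral>\<^sup>+v. \<integral>\<^sup>+y. ennreal (normal_density 0 ?S y * ?g (Suc n) (v - y *\<^sub>R ?k)) \<partial>lborel \<partial>lborel)"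
    by (simp only: gaussian_kernel_Suc[OF J s])
  also have "\<dots> = (\<integral>\<^sup>+y. \<integral>\<^sup>+v. ennreal (normal_density 0 ?S y * ?g (Suc n) (v - y *\<^sub>R ?k)) \<partial>lborel \<partial>lborel)"
    by (rule lborel_pair.Fubini') measurable
  also have "\<dots> = (\<integral>\<^sup>+y. ennreal (normal_density 0 ?S y) * (\<integral>\<^sup>+v. ennreal (?g (Suc n) (v - y *\<^sub>R ?k)) \<partial>lborel) \<partial>lborel)"
    by (simp add: ennreal_mult nn nn_integral_cmult)
  also have "\<dots> = (\<integral>\<^sup>+v. ennreal (?g (Suc n) v) \<partial>lborel)"
    by (subst nn_integral_lborel_shift) (simp_all add: nn_integral_multc nn_integral_normal_density[OF S])
  finally show ?case by simp
qed (rule 0)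

section \<open>Entropy of the innovations\<close>

text \<open>Rectangles determine a law on a product. Independence is expressed by events so that the
  ranges may differ, as for a real noise value and a tuple of state and past signals.\<close>

lemma (in prob_space) distr_pair_of_indep_events:
  assumes X: "X \<in> measurable M S" and Y: "Y \<in> measurable M T"
    and indep: "\<And>E F. E \<in> sets S \<Longrightarrow> F \<in> sets T \<Longrightarrow>
      prob ((X -` E \<inter> space M) \<inter> (Y -` F \<inter> space M)) = prob (X -` E \<inter> space M) * prob (Y -` F \<inter> space M)"
  shows "distr M (S \<Otimes>\<^sub>M T) (\<lambda>\<omega>. (X \<omega>, Y \<omega>)) = distr M S X \<Otimes>\<^sub>M distr M T Y"
proof -
  interpret PX: prob_space "distr M S X" by (rule prob_space_distr[OF X])
  interpret PY: prob_space "distr M T Y" by (rule prob_space_distr[OF Y])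
  note [measurable] = X Y
  show ?thesis
  proof (rule pair_measure_eqI[symmetric])
    fix E F assume "E \<in> sets (distr M S X)" "F \<in> sets (distr M T Y)"
    then have EF [measurable]: "E \<in> sets S" "F \<in> sets T" by auto
    have "(\<lambda>\<omega>. (X \<omega>, Y \<omega>)) -` (E \<times> F) \<inter> space M = (X -` E \<inter> space M) \<inter> (Y -` F \<inter> space M)" by auto
    then show "emeasure (distr M S X) E * emeasure (distr M T Y) F =
        emeasure (distr M (S \<Otimes>\<^sub>M T) (\<lambda>\<omega>. (X \<omega>, Y \<omega>))) (E \<times> F)"
      using indep[OF EF] by (simp add: emeasure_distr emeasure_eq_measure ennreal_mult)
  qed (auto intro: PX.sigma_finite_measure_axioms PY.sigma_finite_measure_axioms)
qed

section \<open>Independence of the noise from the initial state and the past\<close>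

locale noisy_channel = prob_space M for M :: "'a measure" +
  fixes z0 :: "'a \<Rightarrow> real^'n" and \<xi> :: "nat \<Rightarrow> 'a \<Rightarrow> real" and \<sigma> :: real
  assumes noise_indep: "indep_vars (\<lambda>_. borel) \<xi> UNIV"
    and \<sigma>_pos: "0 < \<sigma>"
    and noise_normal: "\<And>t. distributed M lborel (\<xi> t) (normal_density 0 \<sigma>)"
    and init_indep: "independent_rv M borel z0 (Pi\<^sub>M UNIV (\<lambda>_. borel)) (\<lambda>\<omega> t. \<xi> t \<omega>)"
begin

lemma noise_measurable [measurable]: "\<xi> t \<in> borel_measurable M"
  using noise_indep by (auto simp: indep_vars_def)

lemma init_measurable [measurable]: "z0 \<in> borel_measurable M"
  using init_indep by (simp add: independent_rv_def)

abbreviation past :: "nat \<Rightarrow> 'a \<Rightarrow> nat \<Rightarrow> real" where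
  "past n \<omega> \<equiv> \<lambda>t\<in>{..<n}. \<xi> t \<omega>"

text \<open>The sigma-algebra of all that is determined before the noise at time \<open>n\<close>:
  earlier signals are measurable in it, while \<open>\<xi> n\<close> is independent of it.\<close>

definition history :: "nat \<Rightarrow> 'a measure" where
  "history n = vimage_algebra (space M) (\<lambda>\<omega>. (z0 \<omega>, past n \<omega>)) (borel \<Otimes>\<^sub>M Pi\<^sub>M {..<n} (\<lambda>_. borel))"

lemma space_history [simp]: "space (history n) = space M"
  by (simp add: history_def)

lemma pair_in_space: "(\<lambda>\<omega>. (z0 \<omega>, past n \<omega>)) \<in> space M \<rightarrow> space (borel \<Otimes>\<^sub>M Pi\<^sub>M {..<n} (\<lambda>_. borel))"
  by (auto simp: space_pair_measure space_PiM)

lemma init_measurable_history [measurable]: "z0 \<in> borel_measurable (history n)"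
  and noise_measurable_history: "t < n \<Longrightarrow> \<xi> t \<in> borel_measurable (history n)"
proof -
  note m = measurable_vimage_algebra1[OF pair_in_space, folded history_def]
  show "z0 \<in> borel_measurable (history n)"
    using measurable_compose[OF m measurable_fst] by simp
  have "(\<lambda>\<omega>. past n \<omega>) \<in> measurable (history n) (Pi\<^sub>M {..<n} (\<lambda>_. borel))"
    using measurable_compose[OF m measurable_snd] by simp
  then have "(\<lambda>\<omega>. past n \<omega> t) \<in> borel_measurable (history n)" if "t < n"
    by (rule measurable_compose[OF _ measurable_component_singleton]) (use that in simp)
  then show "t < n \<Longrightarrow> \<xi> t \<in> borel_measurable (history n)" by simp
qed

lemma sets_history_subset: "sets (history n) \<subseteq> sets M"
proof -
  have "(\<lambda>\<omega>. (z0 \<omega>, past n \<omega>)) \<in> measurable M (borel \<Otimes>\<^sub>M Pi\<^sub>M {..<n} (\<lambda>_. borel))"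
    by measurable
  then show ?thesis
    unfolding history_def sets_vimage_algebra2[OF pair_in_space] by (auto intro: measurable_sets)
qed

lemma prob_init_noise:
  assumes "E \<in> sets borel" "G \<in> sets (Pi\<^sub>M UNIV (\<lambda>_. borel))"
  shows "prob ((z0 -` E \<inter> space M) \<inter> ((\<lambda>\<omega> t. \<xi> t \<omega>) -` G \<inter> space M)) =
    prob (z0 -` E \<inter> space M) * prob ((\<lambda>\<omega> t. \<xi> t \<omega>) -` G \<inter> space M)"
proof -
  have "indep_set (sigma_sets (space M) {z0 -` E \<inter> space M | E. E \<in> sets borel})
      (sigma_sets (space M) {(\<lambda>\<omega> t. \<xi> t \<omega>) -` E \<inter> space M | E. E \<in> sets (Pi\<^sub>M UNIV (\<lambda>_. borel))})"
    using init_indep by (simp add: independent_rv_def)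
  then show ?thesis
    using assms by (intro indep_setD) (auto intro!: sigma_sets.Basic)
qed

lemma prob_past_noise:
  assumes [measurable]: "F \<in> sets (Pi\<^sub>M {..<n} (\<lambda>_. borel))" "B \<in> sets borel"
  shows "prob ((past n -` F \<inter> space M) \<inter> (\<xi> n -` B \<inter> space M)) =
    prob (past n -` F \<inter> space M) * prob (\<xi> n -` B \<inter> space M)"
proof -
  have "indep_var (Pi\<^sub>M {..<n} (\<lambda>_. borel)) (\<lambda>\<omega>. restrict (\<lambda>i. \<xi> i \<omega>) {..<n})
      (Pi\<^sub>M {n} (\<lambda>_. borel)) (\<lambda>\<omega>. restrict (\<lambda>i. \<xi> i \<omega>) {n})"
    by (rule indep_var_restrict[OF noise_indep]) auto
  then have ind: "indep_set (sigma_sets (space M) {past n -` A \<inter> space M | A. A \<in> sets (Pi\<^sub>M {..<n} (\<lambda>_. borel))})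
      (sigma_sets (space M) {(\<lambda>\<omega>. restrict (\<lambda>i. \<xi> i \<omega>) {n}) -` A \<inter> space M | A. A \<in> sets (Pi\<^sub>M {n} (\<lambda>_. borel))})"
    unfolding indep_var_eq by simp
  let ?B = "{x \<in> space (Pi\<^sub>M {n} (\<lambda>_. borel)). x n \<in> B}"
  have B: "?B \<in> sets (Pi\<^sub>M {n} (\<lambda>_. borel))" by measurable
  have "\<xi> n -` B \<inter> space M = (\<lambda>\<omega>. restrict (\<lambda>i. \<xi> i \<omega>) {n}) -` ?B \<inter> space M"
    by (auto simp: space_PiM)
  moreover have "prob ((past n -` F \<inter> space M) \<inter> ((\<lambda>\<omega>. restrict (\<lambda>i. \<xi> i \<omega>) {n}) -` ?B \<inter> space M)) =
      prob (past n -` F \<inter> space M) * prob ((\<lambda>\<omega>. restrict (\<lambda>i. \<xi> i \<omega>) {n}) -` ?B \<inter> space M)"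
    by (intro indep_setD[OF ind] sigma_sets.Basic CollectI exI[of _ F] exI[of _ ?B] conjI refl assms B)
  ultimately show ?thesis by (simp only:)
qed

text \<open>Independence of \<open>z0\<close> is used for the joint event of past and present noise,
  which is then split by independence within the noise. Preimages of rectangles are stable under
  intersection and generate the history.\<close>

lemma prob_history_noise:
  assumes H: "H \<in> sets (history n)" and B [measurable]: "B \<in> sets borel"
  shows "prob (H \<inter> (\<xi> n -` B \<inter> space M)) = prob H * prob (\<xi> n -` B \<inter> space M)"
proof -
  let ?Y = "\<lambda>\<omega>. (z0 \<omega>, past n \<omega>)" and ?P = "Pi\<^sub>M {..<n} (\<lambda>_. borel) :: (nat \<Rightarrow> real) measure"
  define \<A> where "\<A> = {?Y -` R \<inter> space M | R. R \<in> {E \<times> F | E F. E \<in> sets borel \<and> F \<in> sets ?P}}"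
  define \<B> where "\<B> = {\<xi> n -` B \<inter> space M | B. B \<in> sets borel}"
  have rect: "?Y -` (E \<times> F) \<inter> space M = (z0 -` E \<inter> space M) \<inter> (past n -` F \<inter> space M)" for E F
    by auto
  have prod: "prob ((?Y -` (E \<times> F) \<inter> space M) \<inter> (\<xi> n -` B \<inter> space M)) =
      prob (?Y -` (E \<times> F) \<inter> space M) * prob (\<xi> n -` B \<inter> space M)"
    if [measurable]: "E \<in> sets borel" "F \<in> sets ?P" "B \<in> sets borel" for E F B
  proof -
    \<comment> \<open>\<open>init_indep\<close> concerns the whole noise sequence, so past and
      present events are rewritten as cylinders over all times.\<close>
    let ?F = "{x \<in> space (Pi\<^sub>M UNIV (\<lambda>_. borel)). restrict x {..<n} \<in> F}"
    let ?B = "{x \<in> space (Pi\<^sub>M UNIV (\<lambda>_. borel)). x n \<in> B}"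
    have [measurable]: "?F \<in> sets (Pi\<^sub>M UNIV (\<lambda>_. borel))" "?B \<in> sets (Pi\<^sub>M UNIV (\<lambda>_. borel))" by measurable
    have F: "past n -` F \<inter> space M = (\<lambda>\<omega> t. \<xi> t \<omega>) -` ?F \<inter> space M"
      and FB: "(past n -` F \<inter> space M) \<inter> (\<xi> n -` B \<inter> space M) = (\<lambda>\<omega> t. \<xi> t \<omega>) -` (?F \<inter> ?B) \<inter> space M"
      by (auto simp: space_PiM)
    have "prob ((z0 -` E \<inter> space M) \<inter> ((past n -` F \<inter> space M) \<inter> (\<xi> n -` B \<inter> space M)))
        = prob (z0 -` E \<inter> space M) * prob ((past n -` F \<inter> space M) \<inter> (\<xi> n -` B \<inter> space M))"
      unfolding FB by (intro prob_init_noise) measurable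
    moreover have "prob ((z0 -` E \<inter> space M) \<inter> (past n -` F \<inter> space M))
        = prob (z0 -` E \<inter> space M) * prob (past n -` F \<inter> space M)"
      unfolding F by (intro prob_init_noise) measurable
    ultimately show ?thesis
      by (simp only: rect Int_assoc[of "z0 -` E \<inter> space M" "past n -` F \<inter> space M"]
        prob_past_noise[OF that(2,3)] mult.assoc)
  qed
  have Aev: "\<A> \<subseteq> events" 
  proof -
    have Ym: "?Y \<in> measurable M (borel \<Otimes>\<^sub>M ?P)" by measurable
    have "?Y -` (E \<times> F) \<inter> space M \<in> events" if "E \<in> sets borel" "F \<in> sets ?P" for E F
      by (intro measurable_sets[OF Ym] pair_measureI that)
    then show ?thesis unfolding \<A>_def by blast
  qed
  have Bev: "\<B> \<subseteq> events" unfolding \<B>_def by (auto intro!: measurable_sets)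
  have "indep_set \<A> \<B>"
    unfolding indep_sets2_eq using Aev Bev prod by (auto simp: \<A>_def \<B>_def)
  moreover have "Int_stable \<A>"
  proof (rule Int_stableI)
    fix a b assume "a \<in> \<A>" "b \<in> \<A>"
    then obtain E F E' F' where "E \<in> sets borel" "F \<in> sets ?P" "E' \<in> sets borel" "F' \<in> sets ?P"
      "a = ?Y -` (E \<times> F) \<inter> space M" "b = ?Y -` (E' \<times> F') \<inter> space M" by (auto simp: \<A>_def)
    moreover from this have "a \<inter> b = ?Y -` ((E \<inter> E') \<times> (F \<inter> F')) \<inter> space M" by blast
    moreover have "E \<inter> E' \<in> sets borel" "F \<inter> F' \<in> sets ?P" using calculation by blast+
    ultimately show "a \<inter> b \<in> \<A>" unfolding \<A>_def by blast
  qed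
  moreover have "Int_stable \<B>"
  proof (rule Int_stableI)
    fix a b assume "a \<in> \<B>" "b \<in> \<B>"
    then obtain B B' where "B \<in> sets borel" "B' \<in> sets borel"
      "a = \<xi> n -` B \<inter> space M" "b = \<xi> n -` B' \<inter> space M" by (auto simp: \<B>_def)
    then show "a \<inter> b \<in> \<B>"
      unfolding \<B>_def by (intro CollectI exI[of _ "B \<inter> B'"]) auto
  qed
  ultimately have "indep_set (sigma_sets (space M) \<A>) (sigma_sets (space M) \<B>)"
    by (rule indep_set_sigma_sets)
  moreover have "sets (history n) = sigma_sets (space M) \<A>"
    unfolding history_def sets_vimage_algebra2[OF pair_in_space] \<A>_def sets_pair_measure
    by (rule sigma_sets_vimage_commute) (auto simp: space_PiM)
  moreover have "\<xi> n -` B \<inter> space M \<in> sigma_sets (space M) \<B>"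
    using B unfolding \<B>_def by (auto intro!: sigma_sets.Basic)
  ultimately show ?thesis using H by (auto intro: indep_setD)
qed

text \<open>Measurability in \<open>history n\<close> makes \<open>Y\<close> independent of
  \<open>\<xi> n\<close>, so their joint law is a product and the new noise can be integrated
  separately.\<close>

lemma nn_integral_noise_indep:
  assumes Y: "Y \<in> measurable (history n) T" and G [measurable]: "G \<in> borel_measurable (lborel \<Otimes>\<^sub>M T)"
  shows "(\<integral>\<^sup>+\<omega>. G (\<xi> n \<omega>, Y \<omega>) \<partial>M) =
    (\<integral>\<^sup>+y. (\<integral>\<^sup>+\<omega>. G (y, Y \<omega>) \<partial>M) * ennreal (normal_density 0 \<sigma> y) \<partial>lborel)"
proof -
  have [measurable]: "Y \<in> measurable M T"
    using Y sets_history_subset[of n] by (auto simp: measurable_def)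
  have [measurable]: "\<xi> n \<in> measurable M lborel" by simp
  interpret PY: prob_space "distr M T Y" by (rule prob_space_distr) simp
  have "distr M (lborel \<Otimes>\<^sub>M T) (\<lambda>\<omega>. (\<xi> n \<omega>, Y \<omega>)) = distr M lborel (\<xi> n) \<Otimes>\<^sub>M distr M T Y"
  proof (rule distr_pair_of_indep_events)
    fix E :: "real set" and F assume E: "E \<in> sets lborel" and F: "F \<in> sets T"
    have "Y -` F \<inter> space M \<in> sets (history n)" using measurable_sets[OF Y F] by simp
    from prob_history_noise[OF this, of E] E
    show "prob ((\<xi> n -` E \<inter> space M) \<inter> (Y -` F \<inter> space M)) = prob (\<xi> n -` E \<inter> space M) * prob (Y -` F \<inter> space M)"
      by (simp add: Int_commute mult.commute)
  qed simp_all
  also have "distr M lborel (\<xi> n) = density lborel (normal_density 0 \<sigma>)"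
    by (rule distributed_distr_eq_density[OF noise_normal])
  finally have D: "distr M (lborel \<Otimes>\<^sub>M T) (\<lambda>\<omega>. (\<xi> n \<omega>, Y \<omega>)) = density lborel (normal_density 0 \<sigma>) \<Otimes>\<^sub>M distr M T Y" .
  have "(\<integral>\<^sup>+\<omega>. G (\<xi> n \<omega>, Y \<omega>) \<partial>M) = (\<integral>\<^sup>+x. G x \<partial>distr M (lborel \<Otimes>\<^sub>M T) (\<lambda>\<omega>. (\<xi> n \<omega>, Y \<omega>)))"
    by (subst nn_integral_distr) auto
  also have "\<dots> = (\<integral>\<^sup>+y. \<integral>\<^sup>+x. G (y, x) \<partial>distr M T Y \<partial>density lborel (normal_density 0 \<sigma>))"
    unfolding D by (rule PY.nn_integral_fst[symmetric]) (simp cong: measurable_cong_sets sets_pair_measure_cong)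
  also have "\<dots> = (\<integral>\<^sup>+y. (\<integral>\<^sup>+x. G (y, x) \<partial>distr M T Y) * ennreal (normal_density 0 \<sigma> y) \<partial>lborel)"
    by (subst nn_integral_density) (auto simp: mult.commute intro!: nn_integral_cong PY.borel_measurable_nn_integral_fst)
  also have "\<dots> = (\<integral>\<^sup>+y. (\<integral>\<^sup>+\<omega>. G (y, Y \<omega>) \<partial>M) * ennreal (normal_density 0 \<sigma> y) \<partial>lborel)"
    by (intro nn_integral_cong, subst nn_integral_distr) auto
  finally show ?thesis .
qed

end

section \<open>Joint densities of the signals and the Kalman filter\<close>

lemma prod_lborel_sigma_finite: "product_sigma_finite (\<lambda>_ :: nat. lborel :: real measure)"
  by standard

lemma sigma_finite_PiM_lborel: "sigma_finite_measure (Pi\<^sub>M {..<n::nat} (\<lambda>_. lborel :: real measure))"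
proof -
  interpret product_sigma_finite "\<lambda>_ :: nat. lborel :: real measure" by (rule prod_lborel_sigma_finite)
  show ?thesis by (rule sigma_finite) simp
qed

lemma nn_integral_PiM_lborel_Suc:
  assumes "f \<in> borel_measurable (Pi\<^sub>M {..<Suc n} (\<lambda>_. lborel :: real measure))"
  shows "(\<integral>\<^sup>+x. f x \<partial>Pi\<^sub>M {..<Suc n} (\<lambda>_. lborel)) =
    (\<integral>\<^sup>+x. \<integral>\<^sup>+y. f (x(n := y)) \<partial>lborel \<partial>Pi\<^sub>M {..<n} (\<lambda>_. lborel))"
proof -
  interpret product_sigma_finite "\<lambda>_ :: nat. lborel :: real measure" by (rule prod_lborel_sigma_finite)
  show ?thesis
    using product_nn_integral_insert[of "{..<n}" n f] assms by (simp add: lessThan_Suc)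
qed

lemma measurable_fun_upd_Suc:
  "(\<lambda>(x, y). x(n := y)) \<in> measurable (Pi\<^sub>M {..<n} (\<lambda>_. lborel) \<Otimes>\<^sub>M lborel) (Pi\<^sub>M {..<Suc n} (\<lambda>_. lborel :: real measure))"
  using measurable_add_dim[of n "{..<n}" "\<lambda>_. lborel :: real measure"] by (simp add: lessThan_Suc)

lemma measurable_fun_updI:
  assumes "f \<in> measurable N (Pi\<^sub>M {..<n} (\<lambda>_. lborel))" "g \<in> measurable N (lborel :: real measure)"
  shows "(\<lambda>x. (f x)(n := g x)) \<in> measurable N (Pi\<^sub>M {..<Suc n} (\<lambda>_. lborel))"
  using measurable_compose[OF measurable_Pair[OF assms] measurable_fun_upd_Suc] by simp

lemma distributedI_nn_integral:
  assumes "X \<in> measurable M N" "f \<in> borel_measurable N"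
    and "\<And>A. A \<in> sets N \<Longrightarrow> (\<integral>\<^sup>+\<omega>. indicator A (X \<omega>) \<partial>M) = (\<integral>\<^sup>+x. f x * indicator A x \<partial>N)"
  shows "distributed M N X f"
  unfolding distributed_def
proof (intro conjI assms measure_eqI)
  fix A assume "A \<in> sets (distr M N X)"
  then have A: "A \<in> sets N" by simp
  have "emeasure (distr M N X) A = (\<integral>\<^sup>+x. indicator A x \<partial>distr M N X)" using A by simp
  also have "\<dots> = (\<integral>\<^sup>+\<omega>. indicator A (X \<omega>) \<partial>M)" using A assms(1) by (intro nn_integral_distr) auto
  finally show "emeasure (distr M N X) A = emeasure (density N f) A"
    using A assms(2,3) by (simp add: emeasure_density)
qed simp

locale gaussian_channel = noisy_channel M z0 \<xi> \<sigma>
  for M :: "'a measure" and z0 :: "'a \<Rightarrow> real^'n" and \<xi> :: "nat \<Rightarrow> 'a \<Rightarrow> real" and \<sigma> :: real +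
  fixes J :: "real^'n^'n" and \<mu> :: "real^'n" and \<kappa> :: real and h :: "nat \<Rightarrow> real^'n"
    and e :: "nat \<Rightarrow> real" and D :: "nat \<Rightarrow> nat \<Rightarrow> real" and v :: "nat \<Rightarrow> 'a \<Rightarrow> real"
  assumes J: "positive_definite J" and \<kappa>: "0 \<le> \<kappa>"
    and init_law: "distributed M lborel z0 (\<lambda>x. ennreal (gaussian_kernel \<sigma> J h \<kappa> 0 (x - \<mu>)))"
    and signal: "\<And>t \<omega>. \<omega> \<in> space M \<Longrightarrow> v t \<omega> = \<xi> t \<omega> + h t \<bullet> z0 \<omega> + e t + (\<Sum>k<t. D t k * v k \<omega>)"
begin

abbreviation "P n \<equiv> Pi\<^sub>M {..<n} (\<lambda>_ :: nat. lborel :: real measure)"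
abbreviation "g \<equiv> gaussian_kernel \<sigma> J h \<kappa>"
abbreviation "K \<equiv> kalman_gain \<sigma> J h"
abbreviation "S t \<equiv> sqrt (innovation_variance \<sigma> J h t)"
abbreviation "V n \<omega> \<equiv> \<lambda>t\<in>{..<n}. v t \<omega>"

definition drift :: "nat \<Rightarrow> (nat \<Rightarrow> real) \<Rightarrow> real" where
  "drift t x = e t + (\<Sum>k<t. D t k * x k)"

text \<open>The Kalman filter for a state that does not move: the conditional mean of
  \<open>z0\<close>, corrected at each time by the gain times the innovation.\<close>

primrec estimate :: "nat \<Rightarrow> (nat \<Rightarrow> real) \<Rightarrow> real^'n" where
  "estimate 0 x = \<mu>"
| "estimate (Suc n) x = estimate n x + (x n - drift n x - h n \<bullet> estimate n x) *\<^sub>R K n"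

definition predictor :: "nat \<Rightarrow> (nat \<Rightarrow> real) \<Rightarrow> real" where
  "predictor t x = drift t x + h t \<bullet> estimate t x"

text \<open>The chain rule for densities, with one conditional normal density per time, centred at
  the prediction.\<close>

definition past_density :: "nat \<Rightarrow> (nat \<Rightarrow> real) \<Rightarrow> real" where
  "past_density n x = (\<Prod>t<n. normal_density (predictor t x) (S t) (x t))"

lemma S_pos: "0 < S t"
  using innovation_variance_pos[OF J \<sigma>_pos] by simp

lemma g_nonneg: "0 \<le> g n x"
  by (rule gaussian_kernel_nonneg[OF J \<sigma>_pos \<kappa>])

lemma past_density_pos: "0 < past_density n x"
  unfolding past_density_def using S_pos by (intro prod_pos) (auto intro: normal_density_pos)

lemma drift_cong: "(\<And>k. k < n \<Longrightarrow> x k = y k) \<Longrightarrow> drift n x = drift n y"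
  by (simp add: drift_def)

lemma estimate_cong: "(\<And>k. k < n \<Longrightarrow> x k = y k) \<Longrightarrow> estimate n x = estimate n y"
proof (induction n)
  case (Suc n)
  then have "estimate n x = estimate n y" "drift n x = drift n y" "x n = y n"
    by (auto intro: drift_cong)
  then show ?case by simp
qed simp

lemma predictor_cong: "(\<And>k. k < n \<Longrightarrow> x k = y k) \<Longrightarrow> predictor n x = predictor n y"
  using drift_cong[of n x y] estimate_cong[of n x y] by (simp add: predictor_def)

lemma past_density_cong: "(\<And>k. k < n \<Longrightarrow> x k = y k) \<Longrightarrow> past_density n x = past_density n y"
  unfolding past_density_def using predictor_cong[of _ x y] by (intro prod.cong) auto

lemma fun_upd_simps [simp]:
  "drift n (x(n := y)) = drift n x" "estimate n (x(n := y)) = estimate n x"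
  "predictor n (x(n := y)) = predictor n x" "past_density n (x(n := y)) = past_density n x"
  by (auto intro: drift_cong estimate_cong predictor_cong past_density_cong)

lemma past_density_Suc:
  "past_density (Suc n) x = past_density n x * normal_density (predictor n x) (S n) (x n)"
  by (simp add: past_density_def)

lemma component_measurable: "k < N \<Longrightarrow> (\<lambda>x. x k) \<in> borel_measurable (P N)"
  using measurable_component_singleton[of k "{..<N}" "\<lambda>_. lborel :: real measure"] by simp

lemma drift_measurable: "n \<le> N \<Longrightarrow> drift n \<in> borel_measurable (P N)"
  unfolding drift_def
  by (intro borel_measurable_add borel_measurable_sum borel_measurable_times component_measurable) auto

lemma estimate_measurable: "n \<le> N \<Longrightarrow> estimate n \<in> borel_measurable (P N)"
proof (induction n)
  case 0
  have "estimate 0 = (\<lambda>_. \<mu>)" by auto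
  then show ?case by simp
next
  case (Suc n)
  have [measurable]: "(\<lambda>x. x n) \<in> borel_measurable (P N)" "drift n \<in> borel_measurable (P N)"
    "estimate n \<in> borel_measurable (P N)"
    using Suc by (auto intro: component_measurable drift_measurable)
  have "estimate (Suc n) = (\<lambda>x. estimate n x + (x n - drift n x - h n \<bullet> estimate n x) *\<^sub>R K n)" by auto
  then show ?case by simp
qed

lemma estimate_measurable' [measurable]: "estimate n \<in> borel_measurable (P n)"
  and drift_measurable' [measurable]: "drift n \<in> borel_measurable (P n)"
  by (simp_all add: estimate_measurable drift_measurable)

lemma predictor_measurable: "n \<le> N \<Longrightarrow> predictor n \<in> borel_measurable (P N)"
  unfolding predictor_def using drift_measurable[of n N] estimate_measurable[of n N]
  by (intro borel_measurable_add borel_measurable_inner) auto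

lemma predictor_measurable' [measurable]: "predictor n \<in> borel_measurable (P n)"
  by (simp add: predictor_measurable)

lemma past_density_measurable [measurable]: "past_density n \<in> borel_measurable (P n)"
  unfolding past_density_def
proof (intro borel_measurable_prod)
  fix t assume "t \<in> {..<n}"
  then have [measurable]: "predictor t \<in> borel_measurable (P n)" "(\<lambda>x. x t) \<in> borel_measurable (P n)"
    by (auto intro: predictor_measurable component_measurable)
  show "(\<lambda>x. normal_density (predictor t x) (S t) (x t)) \<in> borel_measurable (P n)"
    unfolding normal_density_def by measurable
qed

text \<open>\<open>gaussian_kernel_Suc\<close> with the estimation error in place of
  \<open>v\<close> and the innovation in place of \<open>y\<close>.\<close>

lemma normal_density_mult_g:
  "normal_density (h n \<bullet> z + drift n x) \<sigma> y * g n (z - estimate n x) =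
    normal_density (predictor n x) (S n) y * g (Suc n) (z - estimate (Suc n) (x(n := y)))"
proof -
  let ?y = "y - drift n x - h n \<bullet> estimate n x" and ?v = "z - estimate n x"
  have "normal_density (h n \<bullet> z + drift n x) \<sigma> y = normal_density (h n \<bullet> ?v) \<sigma> ?y"
    by (simp add: normal_density_def inner_diff_right algebra_simps)
  moreover have "normal_density (predictor n x) (S n) y = normal_density 0 (S n) ?y"
    by (simp add: normal_density_def predictor_def algebra_simps)
  ultimately show ?thesis
    using gaussian_kernel_Suc[OF J \<sigma>_pos, of h n ?v ?y \<kappa>] by (simp add: algebra_simps)
qed

lemma signal_measurable_history: "t < n \<Longrightarrow> v t \<in> borel_measurable (history n)"
proof (induction t rule: less_induct)
  case (less t)
  have [measurable]: "\<xi> t \<in> borel_measurable (history n)" using less by (intro noise_measurable_history)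
  have [measurable]: "v k \<in> borel_measurable (history n)" if "k < t" for k using less that by simp
  have "(\<lambda>\<omega>. \<xi> t \<omega> + h t \<bullet> z0 \<omega> + e t + (\<Sum>k<t. D t k * v k \<omega>)) \<in> borel_measurable (history n)"
    by (intro borel_measurable_add borel_measurable_sum borel_measurable_times borel_measurable_inner) auto
  then show ?case by (subst measurable_cong[OF signal]) simp_all
qed

lemma signal_measurable [measurable]: "v t \<in> borel_measurable M"
  using signal_measurable_history[of t "Suc t"] sets_history_subset[of "Suc t"]
  by (auto simp: measurable_def)

lemma past_measurable_history: "V n \<in> measurable (history n) (P n)"
  by (intro measurable_restrict) (auto intro: signal_measurable_history)

lemma past_measurable [measurable]: "V n \<in> measurable M (P n)"
  by (intro measurable_restrict) simp

lemma past_Suc: "\<omega> \<in> space M \<Longrightarrow> V (Suc n) \<omega> = (V n \<omega>)(n := \<xi> n \<omega> + (h n \<bullet> z0 \<omega> + drift n (V n \<omega>)))"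
  by (auto simp: fun_eq_iff less_Suc_eq signal[of \<omega> n] drift_def)

text \<open>The joint law of state and signals, factored into the marginal density of the signals
  and the posterior of \<open>z0\<close>. In the induction step the new noise is split off by
  independence, translated into the new signal value, and absorbed by Bayes' rule.\<close>

lemma nn_integral_init_past:
  "F \<in> borel_measurable (lborel \<Otimes>\<^sub>M P n) \<Longrightarrow>
  (\<integral>\<^sup>+\<omega>. F (z0 \<omega>, V n \<omega>) \<partial>M) =
    (\<integral>\<^sup>+x. \<integral>\<^sup>+z. F (z, x) * ennreal (past_density n x * g n (z - estimate n x)) \<partial>lborel \<partial>P n)"
proof (induction n arbitrary: F)
  case 0
  have "(\<lambda>z. F (z, \<lambda>_. undefined)) \<in> borel_measurable lborel"
    by (rule measurable_compose[OF _ 0]) (auto simp: space_PiM intro!: measurable_Pair)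
  from distributed_nn_integral[OF init_law this]
  show ?case
    by (simp add: PiM_empty nn_integral_count_space_finite past_density_def mult.commute restrict_def)
next
  case (Suc n)
  note [measurable] = Suc.prems
  interpret sigma_finite_measure "P n" by (rule sigma_finite_PiM_lborel)
  interpret PL: pair_sigma_finite "P n" "lborel :: real measure" ..
  interpret PN: pair_sigma_finite "P n" "lborel :: (real^'n) measure" ..
  let ?a = "\<lambda>z x. h n \<bullet> z + drift n x"
  \<comment> \<open>\<open>F\<close> with the new signal expressed through noise, state and past;
    the noise stands first to match \<open>nn_integral_noise_indep\<close>.\<close>
  define G where "G = (\<lambda>(y, z, x). F (z, x(n := y + ?a z x)))"
  have upd [measurable]: "(\<lambda>x. (f x)(n := k x)) \<in> measurable N (P (Suc n))"
    if "f \<in> measurable N (P n)" "k \<in> borel_measurable N" for f k and N :: "'z measure"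
    using that by (intro measurable_fun_updI) auto
  have G [measurable]: "G \<in> borel_measurable (lborel \<Otimes>\<^sub>M (lborel \<Otimes>\<^sub>M P n))"
    unfolding G_def split_beta'
    by (rule measurable_compose[OF _ Suc.prems], rule measurable_Pair, measurable)
  have "(\<integral>\<^sup>+\<omega>. F (z0 \<omega>, V (Suc n) \<omega>) \<partial>M) = (\<integral>\<^sup>+\<omega>. G (\<xi> n \<omega>, (z0 \<omega>, V n \<omega>)) \<partial>M)"
    by (intro nn_integral_cong) (simp only: past_Suc G_def split)
  also have "\<dots> = (\<integral>\<^sup>+y. (\<integral>\<^sup>+\<omega>. G (y, z0 \<omega>, V n \<omega>) \<partial>M) * ennreal (normal_density 0 \<sigma> y) \<partial>lborel)"
    by (rule nn_integral_noise_indep[OF measurable_Pair[OF _ past_measurable_history] G]) simp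
  also have "\<dots> = (\<integral>\<^sup>+y. (\<integral>\<^sup>+x. \<integral>\<^sup>+z. G (y, z, x) * ennreal (past_density n x * g n (z - estimate n x)) \<partial>lborel \<partial>P n)
      * ennreal (normal_density 0 \<sigma> y) \<partial>lborel)"
    by (intro nn_integral_cong, subst Suc.IH) simp_all
  also have "\<dots> = (\<integral>\<^sup>+y. \<integral>\<^sup>+x. \<integral>\<^sup>+z. F (z, x(n := y + ?a z x)) *
      ennreal (past_density n x * g n (z - estimate n x)) * ennreal (normal_density 0 \<sigma> y) \<partial>lborel \<partial>P n \<partial>lborel)"
  proof (rule nn_integral_cong)
    fix y
    let ?c = "ennreal (normal_density 0 \<sigma> y)"
    let ?f = "\<lambda>x z. F (z, x(n := y + ?a z x)) * ennreal (past_density n x * g n (z - estimate n x))"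
    have "(\<integral>\<^sup>+x. \<integral>\<^sup>+z. ?f x z \<partial>lborel \<partial>P n) * ?c = (\<integral>\<^sup>+x. (\<integral>\<^sup>+z. ?f x z \<partial>lborel) * ?c \<partial>P n)"
      by (rule nn_integral_multc[symmetric]) measurable
    also have "\<dots> = (\<integral>\<^sup>+x. \<integral>\<^sup>+z. ?f x z * ?c \<partial>lborel \<partial>P n)"
    proof (rule nn_integral_cong)
      fix x assume [measurable]: "x \<in> space (P n)"
      show "(\<integral>\<^sup>+z. ?f x z \<partial>lborel) * ?c = (\<integral>\<^sup>+z. ?f x z * ?c \<partial>lborel)"
        by (rule nn_integral_multc[symmetric]) measurable
    qed
    finally show "(\<integral>\<^sup>+x. \<integral>\<^sup>+z. G (y, z, x) * ennreal (past_density n x * g n (z - estimate n x)) \<partial>lborel \<partial>P n) * ?c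
        = (\<integral>\<^sup>+x. \<integral>\<^sup>+z. ?f x z * ?c \<partial>lborel \<partial>P n)"
      by (simp only: G_def split)
  qed
  \<comment> \<open>The translation from noise to signal depends on \<open>x\<close> and
    \<open>z\<close>, so \<open>y\<close> is moved to the innermost place before it is
    shifted.\<close>
  also have "\<dots> = (\<integral>\<^sup>+x. \<integral>\<^sup>+y. \<integral>\<^sup>+z. F (z, x(n := y + ?a z x)) *
      ennreal (past_density n x * g n (z - estimate n x)) * ennreal (normal_density 0 \<sigma> y) \<partial>lborel \<partial>lborel \<partial>P n)"
    by (rule PL.Fubini') measurable
  also have "\<dots> = (\<integral>\<^sup>+x. \<integral>\<^sup>+z. \<integral>\<^sup>+y. F (z, x(n := y + ?a z x)) *
      ennreal (past_density n x * g n (z - estimate n x)) * ennreal (normal_density 0 \<sigma> y) \<partial>lborel \<partial>lborel \<partial>P n)"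
    by (intro nn_integral_cong lborel_pair.Fubini') measurable
  also have "\<dots> = (\<integral>\<^sup>+x. \<integral>\<^sup>+z. \<integral>\<^sup>+y. F (z, x(n := y)) *
      ennreal (past_density n x * g n (z - estimate n x)) * ennreal (normal_density 0 \<sigma> (y - ?a z x)) \<partial>lborel \<partial>lborel \<partial>P n)"
  proof (rule nn_integral_cong, rule nn_integral_cong)
    fix x z assume [measurable]: "x \<in> space (P n)"
    let ?f = "\<lambda>y. F (z, x(n := y + ?a z x)) *
      ennreal (past_density n x * g n (z - estimate n x)) * ennreal (normal_density 0 \<sigma> y)"
    have "?f \<in> borel_measurable borel" by measurable
    from nn_integral_lborel_shift[OF this, of "?a z x"]
    show "(\<integral>\<^sup>+y. ?f y \<partial>lborel) = (\<integral>\<^sup>+y. F (z, x(n := y)) *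
      ennreal (past_density n x * g n (z - estimate n x)) * ennreal (normal_density 0 \<sigma> (y - ?a z x)) \<partial>lborel)"
      by simp
  qed
  also have "\<dots> = (\<integral>\<^sup>+x. \<integral>\<^sup>+z. \<integral>\<^sup>+y. F (z, x(n := y)) *
      ennreal (past_density (Suc n) (x(n := y)) * g (Suc n) (z - estimate (Suc n) (x(n := y)))) \<partial>lborel \<partial>lborel \<partial>P n)"
  proof (intro nn_integral_cong)
    fix x z y
    have "normal_density 0 \<sigma> (y - ?a z x) = normal_density (?a z x) \<sigma> y"
      by (simp add: normal_density_def)
    then have eq: "past_density n x * g n (z - estimate n x) * normal_density 0 \<sigma> (y - ?a z x)
        = past_density (Suc n) (x(n := y)) * g (Suc n) (z - estimate (Suc n) (x(n := y)))"
      using arg_cong[OF normal_density_mult_g[of n z x y], of "\<lambda>r. past_density n x * r"]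
      by (simp only: past_density_Suc fun_upd_simps fun_upd_same mult_ac)
    show "F (z, x(n := y)) * ennreal (past_density n x * g n (z - estimate n x)) * ennreal (normal_density 0 \<sigma> (y - ?a z x))
      = F (z, x(n := y)) * ennreal (past_density (Suc n) (x(n := y)) * g (Suc n) (z - estimate (Suc n) (x(n := y))))"
      unfolding eq[symmetric] ennreal_mult''[OF normal_density_nonneg] by (simp only: mult.assoc)
  qed
  also have "\<dots> = (\<integral>\<^sup>+x. \<integral>\<^sup>+y. \<integral>\<^sup>+z. F (z, x(n := y)) *
      ennreal (past_density (Suc n) (x(n := y)) * g (Suc n) (z - estimate (Suc n) (x(n := y)))) \<partial>lborel \<partial>lborel \<partial>P n)"
    by (intro nn_integral_cong lborel_pair.Fubini') measurable
  also have "\<dots> = (\<integral>\<^sup>+x. \<integral>\<^sup>+z. F (z, x) * ennreal (past_density (Suc n) x * g (Suc n) (z - estimate (Suc n) x)) \<partial>lborel \<partial>P (Suc n))"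
    by (rule nn_integral_PiM_lborel_Suc[symmetric]) measurable
  finally show ?case .
qed

text \<open>The posterior kernel has mass 1 around every centre, so \<open>z0\<close> integrates
  out. Its mass at time 0 comes from the law of \<open>z0\<close>.\<close>

lemma nn_integral_past:
  assumes [measurable]: "F \<in> borel_measurable (P n)"
  shows "(\<integral>\<^sup>+\<omega>. F (V n \<omega>) \<partial>M) = (\<integral>\<^sup>+x. F x * ennreal (past_density n x) \<partial>P n)"
proof -
  have "(\<integral>\<^sup>+z. ennreal (g 0 z) \<partial>lborel) = (\<integral>\<^sup>+z. ennreal (g 0 (z - \<mu>)) * 1 \<partial>lborel)"
    by (simp add: nn_integral_lborel_shift[of "\<lambda>z. ennreal (g 0 z)"])
  also have "\<dots> = (\<integral>\<^sup>+\<omega>. 1 \<partial>M)"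
    using distributed_nn_integral[OF init_law, of "\<lambda>_. 1"] by simp
  finally have "(\<integral>\<^sup>+z. ennreal (g 0 z) \<partial>lborel) = 1" by (simp add: emeasure_space_1)
  from nn_integral_gaussian_kernel[OF J \<sigma>_pos \<kappa> this]
  have g1: "(\<integral>\<^sup>+z. ennreal (g n (z - c)) \<partial>lborel) = 1" for c
    by (simp add: nn_integral_lborel_shift[of "\<lambda>z. ennreal (g n z)"])
  have "(\<integral>\<^sup>+\<omega>. F (V n \<omega>) \<partial>M) =
      (\<integral>\<^sup>+x. \<integral>\<^sup>+z. F x * ennreal (past_density n x * g n (z - estimate n x)) \<partial>lborel \<partial>P n)"
    by (subst nn_integral_init_past[of "\<lambda>(z, x). F x", unfolded split]) simp_all
  also have "\<dots> = (\<integral>\<^sup>+x. F x * ennreal (past_density n x) \<partial>P n)"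
  proof (intro nn_integral_cong)
    fix x
    have "(\<integral>\<^sup>+z. F x * ennreal (past_density n x * g n (z - estimate n x)) \<partial>lborel) =
        (\<integral>\<^sup>+z. (F x * ennreal (past_density n x)) * ennreal (g n (z - estimate n x)) \<partial>lborel)"
      using past_density_pos[of n x] g_nonneg by (simp add: ennreal_mult mult.assoc)
    also have "\<dots> = F x * ennreal (past_density n x)"
      by (simp add: nn_integral_cmult g1)
    finally show "(\<integral>\<^sup>+z. F x * ennreal (past_density n x * g n (z - estimate n x)) \<partial>lborel) =
      F x * ennreal (past_density n x)" .
  qed
  finally show ?thesis .
qed

lemma nn_integral_signal_past:
  assumes F [measurable]: "F \<in> borel_measurable (lborel \<Otimes>\<^sub>M P n)"
  shows "(\<integral>\<^sup>+\<omega>. F (v n \<omega>, V n \<omega>) \<partial>M) =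
    (\<integral>\<^sup>+x. \<integral>\<^sup>+y. F (y, x) * ennreal (past_density n x * normal_density (predictor n x) (S n) y) \<partial>lborel \<partial>P n)"
proof -
  let ?F = "\<lambda>x. F (x n, restrict x {..<n})"
  have [measurable]: "(\<lambda>x. x n) \<in> borel_measurable (P (Suc n))" by (rule component_measurable) simp
  have [measurable]: "(\<lambda>x. restrict x {..<n}) \<in> measurable (P (Suc n)) (P n)"
    by (rule measurable_restrict_subset) auto
  have "(\<integral>\<^sup>+\<omega>. F (v n \<omega>, V n \<omega>) \<partial>M) = (\<integral>\<^sup>+\<omega>. ?F (V (Suc n) \<omega>) \<partial>M)"
    by (intro nn_integral_cong arg_cong[of _ _ F]) (auto simp: restrict_def fun_eq_iff)
  also have "\<dots> = (\<integral>\<^sup>+x. ?F x * ennreal (past_density (Suc n) x) \<partial>P (Suc n))"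
    by (rule nn_integral_past) measurable
  also have "\<dots> = (\<integral>\<^sup>+x. \<integral>\<^sup>+y. ?F (x(n := y)) * ennreal (past_density (Suc n) (x(n := y))) \<partial>lborel \<partial>P n)"
    by (rule nn_integral_PiM_lborel_Suc) measurable
  also have "\<dots> = (\<integral>\<^sup>+x. \<integral>\<^sup>+y. F (y, x) * ennreal (past_density n x * normal_density (predictor n x) (S n) y) \<partial>lborel \<partial>P n)"
  proof (intro nn_integral_cong)
    fix x y assume "x \<in> space (P n)"
    then have "restrict (x(n := y)) {..<n} = x"
      by (auto simp: space_PiM PiE_def extensional_def fun_eq_iff)
    then show "?F (x(n := y)) * ennreal (past_density (Suc n) (x(n := y))) =
        F (y, x) * ennreal (past_density n x * normal_density (predictor n x) (S n) y)"
      by (simp add: past_density_Suc)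
  qed
  finally show ?thesis .
qed

lemma distributed_past: "distributed M (P n) (V n) (\<lambda>x. ennreal (past_density n x))"
  by (rule distributedI_nn_integral) (simp_all add: nn_integral_past mult.commute)

lemma distributed_signal_past:
  "distributed M (lborel \<Otimes>\<^sub>M P n) (\<lambda>\<omega>. (v n \<omega>, V n \<omega>))
    (\<lambda>(y, x). ennreal (past_density n x * normal_density (predictor n x) (S n) y))"
proof (rule distributedI_nn_integral)
  interpret sigma_finite_measure "P n" by (rule sigma_finite_PiM_lborel)
  interpret LP: pair_sigma_finite "lborel :: real measure" "P n" ..
  show [measurable]: "(\<lambda>(y, x). ennreal (past_density n x * normal_density (predictor n x) (S n) y))
      \<in> borel_measurable (lborel \<Otimes>\<^sub>M P n)"
    unfolding normal_density_def by measurable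
  fix A :: "(real \<times> (nat \<Rightarrow> real)) set" assume [measurable]: "A \<in> sets (lborel \<Otimes>\<^sub>M P n)"
  show "(\<integral>\<^sup>+\<omega>. indicator A (v n \<omega>, V n \<omega>) \<partial>M) =
      (\<integral>\<^sup>+yx. (case yx of (y, x) \<Rightarrow> ennreal (past_density n x * normal_density (predictor n x) (S n) y)) * indicator A yx \<partial>(lborel \<Otimes>\<^sub>M P n))"
    by (subst nn_integral_signal_past, simp, subst LP.nn_integral_snd[symmetric])
      (simp_all add: mult.commute)
qed measurable

text \<open>Given the past, the signal is normal about its prediction with a variance that does not
  depend on the past, so the centred signal has the same law unconditionally.\<close>

lemma distributed_innovation:
  "distributed M lborel (\<lambda>\<omega>. v n \<omega> - predictor n (V n \<omega>)) (\<lambda>y. ennreal (normal_density 0 (S n) y))"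
proof (rule distributedI_nn_integral)
  fix A :: "real set" assume "A \<in> sets lborel"
  then have [measurable]: "A \<in> sets borel" by simp
  have "(\<integral>\<^sup>+\<omega>. indicator A (v n \<omega> - predictor n (V n \<omega>)) \<partial>M) =
      (\<integral>\<^sup>+x. \<integral>\<^sup>+y. indicator A (y - predictor n x) * ennreal (past_density n x * normal_density (predictor n x) (S n) y) \<partial>lborel \<partial>P n)"
    by (subst nn_integral_signal_past[of "\<lambda>(y, x). indicator A (y - predictor n x)", unfolded split]) simp_all
  also have "\<dots> = (\<integral>\<^sup>+x. (\<integral>\<^sup>+y. ennreal (normal_density 0 (S n) y) * indicator A y \<partial>lborel) * ennreal (past_density n x) \<partial>P n)"
  proof (intro nn_integral_cong)
    fix x
    have "(\<integral>\<^sup>+y. indicator A (y - predictor n x) * ennreal (past_density n x * normal_density (predictor n x) (S n) y) \<partial>lborel)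
      = (\<integral>\<^sup>+y. (\<lambda>y. ennreal (normal_density 0 (S n) y) * indicator A y * ennreal (past_density n x)) (y - predictor n x) \<partial>lborel)"
    proof (intro nn_integral_cong)
      fix y
      have "normal_density (predictor n x) (S n) y = normal_density 0 (S n) (y - predictor n x)"
        by (simp add: normal_density_def)
      then show "indicator A (y - predictor n x) * ennreal (past_density n x * normal_density (predictor n x) (S n) y)
        = (\<lambda>y. ennreal (normal_density 0 (S n) y) * indicator A y * ennreal (past_density n x)) (y - predictor n x)"
        using past_density_pos[of n x] by (simp only: ennreal_mult less_imp_le normal_density_nonneg mult_ac)
    qed
    also have "\<dots> = (\<integral>\<^sup>+y. ennreal (normal_density 0 (S n) y) * indicator A y * ennreal (past_density n x) \<partial>lborel)"
      by (rule nn_integral_lborel_shift) measurable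
    also have "\<dots> = (\<integral>\<^sup>+y. ennreal (normal_density 0 (S n) y) * indicator A y \<partial>lborel) * ennreal (past_density n x)"
      by (rule nn_integral_multc) measurable
    finally show "(\<integral>\<^sup>+y. indicator A (y - predictor n x) * ennreal (past_density n x * normal_density (predictor n x) (S n) y) \<partial>lborel) =
      (\<integral>\<^sup>+y. ennreal (normal_density 0 (S n) y) * indicator A y \<partial>lborel) * ennreal (past_density n x)" .
  qed
  also have "\<dots> = (\<integral>\<^sup>+\<omega>. (\<integral>\<^sup>+y. ennreal (normal_density 0 (S n) y) * indicator A y \<partial>lborel) \<partial>M)"
    by (rule nn_integral_past[symmetric]) simp
  finally show "(\<integral>\<^sup>+\<omega>. indicator A (v n \<omega> - predictor n (V n \<omega>)) \<partial>M) =
      (\<integral>\<^sup>+y. ennreal (normal_density 0 (S n) y) * indicator A y \<partial>lborel)"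
    by (simp add: emeasure_space_1)
qed measurable

(* Given its past, the signal is the innovation shifted by a function of the past,
   so its conditional entropy is the unconditional entropy of the innovation. *)
lemma entropy_given_past_eq:
  assumes b: "1 < b"
  shows "entropy_given_past M b v n = log b (2 * pi * exp 1 * innovation_variance \<sigma> J h n) / 2"
proof -
  interpret information_space M b by standard (rule b)
  let ?W = "\<lambda>\<omega>. v n \<omega> - predictor n (V n \<omega>)"
  let ?p = "\<lambda>yx. past_density n (snd yx) * normal_density (predictor n (snd yx)) (S n) (fst yx)"
  have joint: "distributed M (lborel \<Otimes>\<^sub>M P n) (\<lambda>\<omega>. (v n \<omega>, V n \<omega>)) (\<lambda>yx. ennreal (?p yx))"
    using distributed_signal_past[of n] by (simp add: split_beta')
  have pn: "0 \<le> ?p yx" for yx using past_density_pos[of n "snd yx"] by simp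
  have "entropy_given_past M b v n = - (\<integral>(y, x). ?p (y, x) * log b (?p (y, x) / past_density n x) \<partial>(lborel \<Otimes>\<^sub>M P n))"
    unfolding entropy_given_past_def
    using past_density_pos[of n] pn
    by (intro conditional_entropy_generic_eq distributed_past joint sigma_finite_PiM_lborel
      sigma_finite_lborel) (auto intro: less_imp_le)
  also have "(\<integral>(y, x). ?p (y, x) * log b (?p (y, x) / past_density n x) \<partial>(lborel \<Otimes>\<^sub>M P n)) =
      (\<integral>yx. ?p yx * log b (normal_density 0 (S n) (fst yx - predictor n (snd yx))) \<partial>(lborel \<Otimes>\<^sub>M P n))"
  proof (intro Bochner_Integration.integral_cong refl)
    fix yx :: "real \<times> (nat \<Rightarrow> real)"
    have "normal_density (predictor n (snd yx)) (S n) (fst yx) = normal_density 0 (S n) (fst yx - predictor n (snd yx))"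
      by (simp add: normal_density_def)
    then show "(case yx of (y, x) \<Rightarrow> ?p (y, x) * log b (?p (y, x) / past_density n x)) =
        ?p yx * log b (normal_density 0 (S n) (fst yx - predictor n (snd yx)))"
      using past_density_pos[of n "snd yx"] by (simp add: split_beta')
  qed
  \<comment> \<open>The change of variables passes through \<open>M\<close>: from the joint density
    to the expectation of a function of the innovation, and from there to the normal
    density.\<close>
  also have "\<dots> = (\<integral>\<omega>. log b (normal_density 0 (S n) (?W \<omega>)) \<partial>M)"
    using distributed_integral[OF joint, of "\<lambda>yx. log b (normal_density 0 (S n) (fst yx - predictor n (snd yx)))"] pn
    by (simp add: normal_density_def)
  also have "\<dots> = (\<integral>y. normal_density 0 (S n) y * log b (normal_density 0 (S n) y) \<partial>lborel)"
    by (rule distributed_integral[OF distributed_innovation, symmetric]) (simp_all add: normal_density_def)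
  also have "- \<dots> = entropy b lborel ?W"
    by (rule entropy_distr[OF distributed_innovation, symmetric]) simp
  also have "\<dots> = log b (2 * pi * exp 1 * (S n)\<^sup>2) / 2"
    by (rule entropy_normal_density[OF S_pos distributed_innovation])
  finally show ?thesis using innovation_variance_pos[OF J \<sigma>_pos, of h n] by simp
qed

end

section \<open>Entropy rate and sensitivity integral\<close>

lemma
  fixes E :: "complex multiset"
  shows set_integrable_sum_ln_cmod_cis_minus:
      "set_integrable lborel {-1/2..1/2} (\<lambda>\<theta>. \<Sum>l\<in>#E. ln (cmod (cis (2 * pi * \<theta>) - l)))"
    and integral_sum_ln_cmod_cis_minus:
      "(LBINT \<theta>:{-1/2..1/2}. \<Sum>l\<in>#E. ln (cmod (cis (2 * pi * \<theta>) - l))) = (\<Sum>l\<in>#E. ln (max 1 (cmod l)))"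
proof -
  have "set_integrable lborel {-1/2..1/2} (\<lambda>\<theta>. \<Sum>l\<in>#E. ln (cmod (cis (2 * pi * \<theta>) - l))) \<and>
    (LBINT \<theta>:{-1/2..1/2}. \<Sum>l\<in>#E. ln (cmod (cis (2 * pi * \<theta>) - l))) = (\<Sum>l\<in>#E. ln (max 1 (cmod l)))"
  proof (induction E)
    case empty
    then show ?case by (simp add: set_integrable_def set_lebesgue_integral_def)
  next
    case (add l E)
    then show ?case
      using set_integral_add[OF set_integrable_ln_cmod_cis_minus[of l] conjunct1[OF add]]
      by (simp only: image_mset_add_mset sum_mset.add_mset integral_ln_cmod_cis_minus add simp_thms)
  qed
  then show "set_integrable lborel {-1/2..1/2} (\<lambda>\<theta>. \<Sum>l\<in>#E. ln (cmod (cis (2 * pi * \<theta>) - l)))"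
    "(LBINT \<theta>:{-1/2..1/2}. \<Sum>l\<in>#E. ln (cmod (cis (2 * pi * \<theta>) - l))) = (\<Sum>l\<in>#E. ln (max 1 (cmod l)))"
    by auto
qed

lemma ln_prod_mset:
  fixes f :: "'b \<Rightarrow> real"
  assumes "\<And>x. x \<in># E \<Longrightarrow> 0 < f x"
  shows "ln (\<Prod>x\<in>#E. f x) = (\<Sum>x\<in>#E. ln (f x))"
proof -
  have "ln (\<Prod>x\<in>#E. f x) = (\<Sum>x\<in>#E. ln (f x)) \<and> 0 < (\<Prod>x\<in>#E. f x)"
    using assms by (induction E) (auto simp: ln_mult_pos)
  then show ?thesis ..
qed

text \<open>By \<open>sensitivity_eq\<close> the logarithm is almost everywhere a sum over open loop
  eigenvalues minus one over closed loop eigenvalues, and Jensen's formula evaluates each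
  term.\<close>

lemma
  assumes stable: "schur_stable (closed_loop_matrix A B C)" and b: "1 < b"
  shows set_integrable_log_sensitivity:
      "set_integrable lborel {-1/2..1/2} (\<lambda>\<theta>. log b (cmod (sensitivity A B C (cis (2 * pi * \<theta>)))))"
    and integral_log_sensitivity:
      "(LBINT \<theta>:{-1/2..1/2}. log b (cmod (sensitivity A B C (cis (2 * pi * \<theta>))))) =
        ln (growth (complex_matrix A)) / ln b"
proof -
  let ?M = "restrict_space lborel {-1/2..1/2 :: real}"
  have RM: "integrable ?M f \<longleftrightarrow> set_integrable lborel {-1/2..1/2} f"
    "integral\<^sup>L ?M f = (LBINT \<theta>:{-1/2..1/2}. f \<theta>)" for f :: "real \<Rightarrow> real"
    unfolding set_integrable_def set_lebesgue_integral_def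
    by (simp_all add: integrable_restrict_space integral_restrict_space)
  define E where "E = proots (complex_charpoly (complex_matrix A))"
  define F where "F = proots (complex_charpoly (complex_matrix (closed_loop_matrix A B C)))"
  define f where "f \<theta> = log b (cmod (sensitivity A B C (cis (2 * pi * \<theta>))))" for \<theta>
  define k where "k G \<theta> = (\<Sum>l\<in>#G. ln (cmod (cis (2 * pi * \<theta>) - l)))" for G \<theta>
  have F1: "cmod l < 1" if "l \<in># F" for l
    using stable that by (simp add: F_def schur_stable_def eigenvalues_def charpoly_eq_complex_charpoly)
  have numer: "poly (charpoly A) s = (\<Prod>l\<in>#E. s - l)" for s
    by (simp only: charpoly_eq_complex_charpoly poly_complex_charpoly_prod E_def)
  have denom: "poly (charpoly (closed_loop_matrix A B C)) s = (\<Prod>l\<in>#F. s - l)" for s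
    by (simp only: charpoly_eq_complex_charpoly poly_complex_charpoly_prod F_def)
  have nzF: "cis t - l \<noteq> 0" if "l \<in># F" for t l
    using F1[OF that] norm_cis[of t] by (metis eq_iff_diff_eq_0 less_irrefl)
  have denom_nz: "poly (charpoly (closed_loop_matrix A B C)) (cis t) \<noteq> 0" for t
    using nzF by (auto simp: denom)
  have f_eq: "f \<theta> = ln (cmod (poly (charpoly A) (cis (2 * pi * \<theta>))) /
      cmod (poly (charpoly (closed_loop_matrix A B C)) (cis (2 * pi * \<theta>)))) / ln b" for \<theta>
    by (simp add: f_def sensitivity_eq[OF denom_nz] norm_divide log_def)
  have "(\<lambda>\<theta>. cmod (poly (charpoly A) (cis (2 * pi * \<theta>))) /
      cmod (poly (charpoly (closed_loop_matrix A B C)) (cis (2 * pi * \<theta>)))) \<in> borel_measurable borel"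
    using denom_nz by (intro borel_measurable_continuous_onI continuous_intros continuous_on_cis) auto
  from borel_measurable_divide[OF borel_measurable_ln[OF this] borel_measurable_const[of "ln b"]]
  have "f \<in> borel_measurable lborel"
    by (simp flip: f_eq)
  then have fm: "f \<in> borel_measurable ?M" by (rule measurable_restrict_space1)
  have ik: "integrable ?M (k G)" "integral\<^sup>L ?M (k G) = (\<Sum>l\<in>#G. ln (max 1 (cmod l)))" for G
    unfolding RM k_def by (rule set_integrable_sum_ln_cmod_cis_minus integral_sum_ln_cmod_cis_minus)+
  have ig: "integrable ?M (\<lambda>\<theta>. (k E \<theta> - k F \<theta>) / ln b)"
    by (intro integrable_divide Bochner_Integration.integrable_diff ik)
  have AE: "AE \<theta> in ?M. f \<theta> = (k E \<theta> - k F \<theta>) / ln b"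
  proof -
    \<comment> \<open>At an open loop eigenvalue on the unit circle the sensitivity vanishes and the
      logarithm of the product does not split; these points form a null set.\<close>
    have "AE \<theta> in ?M. \<forall>l\<in>set_mset E. cis (2 * pi * \<theta>) \<noteq> l"
      by (rule AE_finite_allI) (auto intro: AE_cis_neq)
    then show ?thesis
    proof eventually_elim
      case (elim \<theta>)
      let ?s = "cis (2 * pi * \<theta>)"
      have "ln (\<Prod>l\<in>#E. cmod (?s - l)) = k E \<theta>" "ln (\<Prod>l\<in>#F. cmod (?s - l)) = k F \<theta>"
        unfolding k_def using elim nzF by (auto intro!: ln_prod_mset)
      moreover have "0 < cmod (poly (charpoly A) ?s)"
        using elim by (auto simp: numer)
      then have "f \<theta> = (ln (cmod (poly (charpoly A) ?s)) -
          ln (cmod (poly (charpoly (closed_loop_matrix A B C)) ?s))) / ln b"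
        using denom_nz by (simp add: f_eq ln_div)
      ultimately show ?case by (simp only: numer denom prod_mset_norm)
    qed
  qed
  have "integrable ?M f"
    by (subst integrable_cong_AE[OF fm _ AE]) (use ig in auto)
  then show "set_integrable lborel {-1/2..1/2} (\<lambda>\<theta>. log b (cmod (sensitivity A B C (cis (2 * pi * \<theta>)))))"
    unfolding RM f_def .
  have "integral\<^sup>L ?M f = (\<integral>\<theta>. (k E \<theta> - k F \<theta>) / ln b \<partial>?M)"
    by (rule integral_cong_AE[OF fm _ AE]) (use ig in auto)
  also have "\<dots> = ((\<Sum>l\<in>#E. ln (max 1 (cmod l))) - (\<Sum>l\<in>#F. ln (max 1 (cmod l)))) / ln b"
    using ik[of E] ik[of F] by simp
  \<comment> \<open>Stability puts all closed loop eigenvalues inside the disc, where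
    \<open>ln (max 1 (cmod l)) = ln 1\<close>.\<close>
  also have "(\<Sum>l\<in>#F. ln (max 1 (cmod l))) = (\<Sum>l\<in>#F. 0)"
    using F1 by (intro arg_cong[of _ _ sum_mset] image_mset_cong) (simp add: max_absorb1 less_imp_le)
  finally show "(LBINT \<theta>:{-1/2..1/2}. log b (cmod (sensitivity A B C (cis (2 * pi * \<theta>))))) =
        ln (growth (complex_matrix A)) / ln b"
    unfolding RM f_def by (simp add: ln_growth E_def)
qed

lemma sum_unstable_eigenvalues:
  "(\<Sum>s\<in>#unstable_eigenvalues A. log b (cmod s)) = ln (growth (complex_matrix A)) / ln b"
proof -
  have "(\<Sum>s\<in>#filter_mset (\<lambda>z. 1 < cmod z) E. log b (cmod s)) = (\<Sum>l\<in>#E. ln (max 1 (cmod l))) / ln b" for E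
    by (induction E) (auto simp: max_def log_def add_divide_distrib)
  then show ?thesis
    by (simp add: ln_growth unstable_eigenvalues_def eigenvalues_def charpoly_eq_complex_charpoly)
qed

section \<open>The feedback loop as a Gaussian channel\<close>

lemma inner_output_row: "output_row A C t \<bullet> x = C \<bullet> ((\<lambda>y. A *v y) ^^ t) x"
proof (induction t arbitrary: x)
  case (Suc t)
  have "output_row A C (Suc t) \<bullet> x = output_row A C t \<bullet> (A *v x)"
    unfolding output_row_def funpow.simps o_apply
    by (metis dot_lmul_matrix transpose_matrix_vector)
  then show ?case by (simp add: Suc funpow_swap1)
qed (simp add: output_row_def)

text \<open>Variation of constants for the open loop driven by \<open>u\<close>. It separates the
  contribution of the unknown \<open>z 0\<close> from that of past inputs, which are known to the
  predictor.\<close>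

lemma state_eq_sum:
  fixes A :: "real^'n^'n"
  assumes "\<And>t. z (Suc t) = A *v z t + u t *\<^sub>R B"
  shows "z t = ((\<lambda>y. A *v y) ^^ t) (z 0) + (\<Sum>k<t. u k *\<^sub>R ((\<lambda>y. A *v y) ^^ (t - Suc k)) B)"
proof (induction t)
  case (Suc t)
  have "A *v (\<Sum>k<t. u k *\<^sub>R ((\<lambda>y. A *v y) ^^ (t - Suc k)) B) =
      (\<Sum>k<t. u k *\<^sub>R ((\<lambda>y. A *v y) ^^ (t - k)) B)"
    unfolding matrix_vector_mult_sum_right
  proof (intro sum.cong refl)
    fix k assume "k \<in> {..<t}"
    then have "t - k = Suc (t - Suc k)" by auto
    then show "A *v (u k *\<^sub>R ((\<lambda>y. A *v y) ^^ (t - Suc k)) B) = u k *\<^sub>R ((\<lambda>y. A *v y) ^^ (t - k)) B"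
      by (simp add: matrix_vector_mult_scaleR)
  qed
  then show ?case by (subst assms, subst Suc) (simp add: matrix_vector_right_distrib)
qed simp

theorem theorem11:
  fixes M :: "'a measure" and b \<sigma> c :: real
    and A :: "real^'n^'n" and B C :: "real^'n"
    and z :: "nat \<Rightarrow> 'a \<Rightarrow> real^'n" and w u \<xi> :: "nat \<Rightarrow> 'a \<Rightarrow> real"
  assumes "prob_space M" and "1 < b"
    and state_eq: "\<And>t \<omega>. \<omega> \<in> space M \<Longrightarrow> z (Suc t) \<omega> = A *v z t \<omega> + u t \<omega> *\<^sub>R B"
    and output_eq: "\<And>t \<omega>. \<omega> \<in> space M \<Longrightarrow> w t \<omega> = C \<bullet> z t \<omega>"
    and input_eq: "\<And>t \<omega>. \<omega> \<in> space M \<Longrightarrow> u t \<omega> = w t \<omega> + \<xi> t \<omega>"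
    and stable: "schur_stable (closed_loop_matrix A B C)"
    and noise_indep: "prob_space.indep_vars M (\<lambda>_. borel) \<xi> UNIV"
    and "0 < \<sigma>"
    and noise_normal: "\<And>t. distributed M lborel (\<xi> t) (normal_density 0 \<sigma>)"
    and init_normal: "gaussian_vector M (z 0)"
    and init_indep: "independent_rv M borel (z 0) (Pi\<^sub>M UNIV (\<lambda>_. borel)) (\<lambda>\<omega> t. \<xi> t \<omega>)"
  shows "convergent (mean_information_transfer M b c u \<xi>) \<and>
    set_integrable lborel {-1/2..1/2}
      (\<lambda>\<theta>. log b (cmod (sensitivity A B C (cis (2 * pi * \<theta>))))) \<and>
    average_information_transfer M b c u \<xi> =
      (LBINT \<theta>:{-1/2..1/2}. log b (cmod (sensitivity A B C (cis (2 * pi * \<theta>))))) \<and>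
    (LBINT \<theta>:{-1/2..1/2}. log b (cmod (sensitivity A B C (cis (2 * pi * \<theta>))))) =
      (\<Sum>s\<in>#unstable_eigenvalues A. log b (cmod s))"
proof -
  interpret prob_space M by fact
  obtain \<mu> \<Sigma> where \<Sigma>: "positive_definite \<Sigma>"
    and z0: "distributed M lborel (z 0) (mv_normal_density \<mu> \<Sigma>)"
    using init_normal by (auto simp: gaussian_vector_def)
  define J where "J = matrix_inv \<Sigma>"
  have J: "positive_definite J" unfolding J_def by (rule positive_definite_matrix_inv[OF \<Sigma>])
  define \<kappa> where "\<kappa> = 1 / sqrt ((2 * pi) ^ CARD('n) * det \<Sigma>)"
  have mv: "mv_normal_density \<mu> \<Sigma> x = \<kappa> * exp (- ((x - \<mu>) \<bullet> (J *v (x - \<mu>))) / 2)" for x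
    by (simp add: mv_normal_density_def J_def \<kappa>_def)
  \<comment> \<open>The sign of \<open>det \<Sigma>\<close> is not computed: a negative
    \<open>\<kappa>\<close> would make the density vanish as an \<open>ennreal\<close>,
    contradicting total mass 1.\<close>
  have \<kappa>: "0 \<le> \<kappa>"
  proof (rule ccontr)
    assume "\<not> 0 \<le> \<kappa>"
    then have "ennreal (mv_normal_density \<mu> \<Sigma> x) = 0" for x
      unfolding mv by (intro ennreal_neg) (simp add: mult_nonpos_nonneg)
    then show False
      using distributed_nn_integral[OF z0, of "\<lambda>_. 1"] by (simp add: emeasure_space_1)
  qed
  have init_law: "distributed M lborel (z 0) (\<lambda>x. ennreal (gaussian_kernel \<sigma> J h \<kappa> 0 (x - \<mu>)))" for h
    using z0 by (simp add: mv gaussian_kernel_def)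
  interpret noisy_channel M "z 0" \<xi> \<sigma>
    by unfold_locales (fact noise_indep \<open>0 < \<sigma>\<close> noise_normal init_indep)+
  let ?h = "output_row A C"
  \<comment> \<open>The impulse response \<open>C A^(t-k-1) B\<close> from the input at time
    \<open>k\<close> to the output at time \<open>t\<close>.\<close>
  let ?D = "\<lambda>t k. C \<bullet> ((\<lambda>y. A *v y) ^^ (t - Suc k)) B"
  interpret closed: gaussian_channel M "z 0" \<xi> \<sigma> J \<mu> \<kappa> ?h "\<lambda>_. 0" ?D u
  proof (unfold_locales, fact J, fact \<kappa>, fact init_law)
    fix t \<omega> assume \<omega>: "\<omega> \<in> space M"
    show "u t \<omega> = \<xi> t \<omega> + ?h t \<bullet> z 0 \<omega> + 0 + (\<Sum>k<t. ?D t k * u k \<omega>)"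
      unfolding input_eq[OF \<omega>, of t] output_eq[OF \<omega>]
      by (subst state_eq_sum[of "\<lambda>t. z t \<omega>" A "\<lambda>t. u t \<omega>" B])
        (simp_all add: state_eq[OF \<omega>] inner_output_row inner_right_distrib inner_sum_right mult.commute)
  qed
  \<comment> \<open>With zero rows nothing about \<open>z 0\<close> is observed, and the innovation
    variance reduces to \<open>\<sigma>\<^sup>2\<close>.\<close>
  interpret frozen: gaussian_channel M "z 0" \<xi> \<sigma> J \<mu> \<kappa> "\<lambda>_. 0" "\<lambda>_. c" "\<lambda>_ _. 0" "\<lambda>t \<omega>. c + \<xi> t \<omega>"
    by (unfold_locales, fact J, fact \<kappa>, fact init_law) simp
  define f where "f n = ln \<bar>det (info_matrix \<sigma> J ?h n)\<bar>" for n
  have transfer: "information_transfer M b c u \<xi> n = (f (Suc n) - f n) / (2 * ln b)" for n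
  proof -
    let ?s = "innovation_variance \<sigma> J ?h n"
    have s: "0 < ?s" by (rule innovation_variance_pos[OF J \<open>0 < \<sigma>\<close>])
    have det: "det (info_matrix \<sigma> J ?h n) \<noteq> 0" for n
      by (intro positive_definite_invertible positive_definite_info_matrix J)
    have "?s = \<bar>?s\<bar>" using s by simp
    also have "\<dots> = \<sigma>\<^sup>2 * \<bar>det (info_matrix \<sigma> J ?h (Suc n))\<bar> / \<bar>det (info_matrix \<sigma> J ?h n)\<bar>"
      by (simp add: innovation_variance_eq_det_ratio[OF J \<open>0 < \<sigma>\<close>] abs_mult)
    finally have "ln ?s = ln (\<sigma>\<^sup>2) + f (Suc n) - f n"
      using det \<open>0 < \<sigma>\<close> by (simp add: f_def ln_mult ln_div)
    moreover have "information_transfer M b c u \<xi> n =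
        log b (2 * pi * exp 1 * ?s) / 2 - log b (2 * pi * exp 1 * \<sigma>\<^sup>2) / 2"
      unfolding information_transfer_def closed.entropy_given_past_eq[OF \<open>1 < b\<close>]
        frozen.entropy_given_past_eq[OF \<open>1 < b\<close>]
      by (simp add: innovation_variance_def)
    ultimately show ?thesis
      using s \<open>0 < \<sigma>\<close> by (simp add: log_def ln_mult diff_divide_distrib add_divide_distrib)
  qed
  \<comment> \<open>The sum starts at \<open>i = 1\<close>, hence the boundary term
    \<open>f 1\<close>. The quotient \<open>Suc T / T\<close> matches the average over
    \<open>T\<close> terms with the rate of \<open>f\<close> at \<open>Suc T\<close>.\<close>
  have mean: "mean_information_transfer M b c u \<xi> T =
      (f (Suc T) / real (Suc T) * (real (Suc T) / real T) - f 1 / real T) / (2 * ln b)" for T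
  proof -
    have "(\<Sum>i=1..T. information_transfer M b c u \<xi> i) = (f (Suc T) - f 1) / (2 * ln b)"
      unfolding transfer sum_divide_distrib[symmetric] by (subst sum_Suc_diff) auto
    then show ?thesis
      unfolding mean_information_transfer_def by (simp add: diff_divide_distrib mult.commute)
  qed
  let ?L = "ln (growth (complex_matrix A))"
  have "(\<lambda>T. f (Suc T) / real (Suc T)) \<longlonglongrightarrow> 2 * ?L"
    unfolding f_def by (rule LIMSEQ_Suc[OF ln_det_info_matrix_rate[OF stable J \<open>0 < \<sigma>\<close>]])
  moreover have "(\<lambda>T. real (Suc T) / real T) \<longlonglongrightarrow> 1" by (rule LIMSEQ_Suc_n_over_n)
  moreover have "(\<lambda>T. f 1 / real T) \<longlonglongrightarrow> 0" by (rule lim_const_over_n)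
  moreover have "2 * ln b \<noteq> 0" using \<open>1 < b\<close> by simp
  ultimately have "(\<lambda>T. (f (Suc T) / real (Suc T) * (real (Suc T) / real T) - f 1 / real T) / (2 * ln b))
      \<longlonglongrightarrow> (2 * ?L * 1 - 0) / (2 * ln b)"
    by (intro tendsto_divide tendsto_diff tendsto_mult tendsto_const)
  then have lim: "mean_information_transfer M b c u \<xi> \<longlonglongrightarrow> ?L / ln b"
    unfolding mean[symmetric] by simp
  show ?thesis
    unfolding integral_log_sensitivity[OF stable \<open>1 < b\<close>] sum_unstable_eigenvalues
      average_information_transfer_def limI[OF lim]
    using convergentI[OF lim] set_integrable_log_sensitivity[OF stable \<open>1 < b\<close>] by simp
qed

end
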